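(* Let $K$ be a field, let $\mathcal P$ be a finite poset with incidence algebra $I(\mathcal P)$ over $K$, and let $\mathcal X$ be a set of connected spread modules over $I(\mathcal P)$ which contains the indecomposable projective modules. (1) If every spread (module) in $\mathcal X$ has a unique source, then the association $M\mapsto[M]_{\mathcal X}$ (i.e. the quotient map $K_0^{split}(I(\mathcal P))\to K_0(I(\mathcal P),\mathcal X)$) is a homological invariant. (2) If every spread module in $\mathcal X$ is supported on an upset of $\mathcal P$, then the association $M\mapsto[M]_{\mathcal X}$ is a homological invariant.
   Context: $\mathrm{mod}\,I(\mathcal P)$ is the category of finitely generated (right) $I(\mathcal P)$-modules, identified with functors from $\mathcal P$ (viewed as a category with a unique morphism $a\to b$ whenever $a\le b$) to finite-dimensional $K$-vector spaces; modules are identified with their isomorphism classes. Spreads: for $B\subseteq\mathcal P$ and $a\in\mathcal P$, write $a\le B$ (resp. $B\le a$) if there is $b\in B$ with $a\le b$ (resp. $b\le a$). For sets $A,B$ of pairwise incomparable elements, $A\le B$ means $a\le B$ and $A\le b$ for all $a\in A$, $b\in B$. If $A\le B$, the spread from $A$ to $B$ is $[A,B]=\{x\mid\exists a\in A,b\in B:\ a\le x\le b\}$; $A$ is its set of sources and $B$ its set of targets. A spread is connected if any two of its points are joined by an unoriented path in it in the Hasse quiver of $\mathcal P$. The spread module $M_{[A,B]}$ has $M_{[A,B]}(p)=K$ if $p\in[A,B]$ and $0$ otherwise, with $M_{[A,B]}(p,q)=1_K$ if $p\leq q$ both lie in $[A,B]$ and $0$ otherwise; it is a connected spread module if $[A,B]$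 is connected. Indecomposable projectives are $P_a=M_{[a,\infty]}$ with $[a,\infty]=\{x\mid a\le x\}$. An upset is a subset closed under taking larger elements. Write $\Lambda=I(\mathcal P)$. $K_0^{split}(\Lambda)$ is the free abelian group on isomorphism classes $[M]$, $M\in\mathrm{mod}\,\Lambda$, modulo $[M\oplus N]=[M]+[N]$. An invariant is a surjective group homomorphism $K_0^{split}(\Lambda)\to\mathbb Z^n$ for some $n$; two invariants are equivalent if they have the same kernel. $\mathcal E_{\mathcal X}$ is the class of short exact sequences $0\to M\to N\xrightarrow{g}L\to0$ in $\mathrm{mod}\,\Lambda$ such that $\operatorname{Hom}_\Lambda(R,g)$ is surjective for all $R\in\mathcal X$. $K_0(\Lambda,\mathcal X)$ is the free abelian group on isomorphism classes $[M]$ modulo the subgroup generated by all $[M]-[N]+[L]$ for sequences in $\mathcal E_{\mathcal X}$; $[M]_{\mathcal X}$ is the class of $M$. $\mathrm{add}(\mathcal X)$ consists of finite direct sums of modules in $\mathcal X$. An $\mathcal X$-approximation of $M$ is a morphism $f:R\to M$ with $R\in\mathrm{add}(\mathcal X)$ through which every morphism $R'\to M$ with $R'\in\mathrm{add}(\mathcal X)$ factors; it is minimal if every $g:R\to R$ with $fg=f$ is an isomorphism. A (minimal) $\mathcal X$-resolution of $M$ is obtained by iteratively taking (minimal) $\mathcal X$-approximations of $M$ and of the successive kernels. The $\mathcal X$-dimension of $M$ is $\min(\{j\mid R_{j+1}=0\}\cup\{\infty\})$ for a minimal $\mathcal X$-resolution $R_\bullet$; the $\mathcal X$-dimension of $\Lambda$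 is properly infinite if some module has infinite $\mathcal X$-dimension. An invariant is homological (relative to $\mathcal X$) if $\mathcal X$ is a finite set of indecomposables containing all indecomposable projectives, the $\mathcal X$-dimension of $\Lambda$ is not properly infinite, and the invariant is equivalent to the quotient map $K_0^{split}(\Lambda)\to K_0(\Lambda,\mathcal X)\simeq\mathbb Z^{|\mathcal X|}$. *)

theory Defs
  imports
    "Jordan_Normal_Form.Matrix_Kernel"
    "HOL-Algebra.Free_Abelian_Groups"
    "HOL-Library.Extended_Nat"
begin

text \<open>The finite poset is the universe of a type of class finite and order. A finitely generated
  module is given as a functor from the poset to finite-dimensional vector spaces; since modules
  only matter up to isomorphism, the space at p is taken to be the space of column vectors
  of length vdim M p, and a linear map is the matrix acting on the left of such vectors.
  The value of tmap M p q is irrelevant unless p \<open>\<le>\<close> q; no notion below depends on it.\<close>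

record ('p, 'k) pmod =
  vdim :: "'p \<Rightarrow> nat"
  tmap :: "'p \<Rightarrow> 'p \<Rightarrow> 'k mat"

definition is_pmod :: "('p::order, 'k::field) pmod \<Rightarrow> bool" where
  "is_pmod M \<longleftrightarrow>
     (\<forall>p q. p \<le> q \<longrightarrow> tmap M p q \<in> carrier_mat (vdim M q) (vdim M p)) \<and>
     (\<forall>p. tmap M p p = 1\<^sub>m (vdim M p)) \<and>
     (\<forall>p q r. p \<le> q \<longrightarrow> q \<le> r \<longrightarrow> tmap M p r = tmap M q r * tmap M p q)"

definition pm_hom ::
  "('p::order, 'k::field) pmod \<Rightarrow> ('p, 'k) pmod \<Rightarrow> ('p \<Rightarrow> 'k mat) set" where
  "pm_hom M N = {f. (\<forall>p. f p \<in> carrier_mat (vdim N p) (vdim M p)) \<and>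
                    (\<forall>p q. p \<le> q \<longrightarrow> f q * tmap M p q = tmap N p q * f p)}"

definition pm_comp :: "('p \<Rightarrow> 'k::field mat) \<Rightarrow> ('p \<Rightarrow> 'k mat) \<Rightarrow> 'p \<Rightarrow> 'k mat" where
  "pm_comp g f = (\<lambda>p. g p * f p)"

definition pm_id :: "('p, 'k::field) pmod \<Rightarrow> 'p \<Rightarrow> 'k mat" where
  "pm_id M = (\<lambda>p. 1\<^sub>m (vdim M p))"

definition pm_isomorphism ::
  "('p::order, 'k::field) pmod \<Rightarrow> ('p, 'k) pmod \<Rightarrow> ('p \<Rightarrow> 'k mat) \<Rightarrow> bool" where
  "pm_isomorphism M N f \<longleftrightarrow>
     f \<in> pm_hom M N \<and> (\<exists>g\<in>pm_hom N M. pm_comp g f = pm_id M \<and> pm_comp f g = pm_id N)"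

definition pm_isomorphic :: "('p::order, 'k::field) pmod \<Rightarrow> ('p, 'k) pmod \<Rightarrow> bool" where
  "pm_isomorphic M N \<longleftrightarrow> (\<exists>f. pm_isomorphism M N f)"

definition is_zero_pmod :: "('p, 'k) pmod \<Rightarrow> bool" where
  "is_zero_pmod M \<longleftrightarrow> (\<forall>p. vdim M p = 0)"

definition zero_pmod :: "('p, 'k::field) pmod" where
  "zero_pmod = \<lparr>vdim = (\<lambda>_. 0), tmap = (\<lambda>_ _. 0\<^sub>m 0 0)\<rparr>"

definition pm_dsum :: "('p, 'k::field) pmod \<Rightarrow> ('p, 'k) pmod \<Rightarrow> ('p, 'k) pmod" where
  "pm_dsum M N = \<lparr>vdim = (\<lambda>p. vdim M p + vdim N p),
     tmap = (\<lambda>p q. four_block_mat (tmap M p q) (0\<^sub>m (vdim M q) (vdim N p))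
                                  (0\<^sub>m (vdim N q) (vdim M p)) (tmap N p q))\<rparr>"

definition pm_supp :: "('p, 'k) pmod \<Rightarrow> 'p set" where
  "pm_supp M = {p. vdim M p \<noteq> 0}"

definition indecomposable_pmod :: "('p::order, 'k::field) pmod \<Rightarrow> bool" where
  "indecomposable_pmod M \<longleftrightarrow> is_pmod M \<and> \<not> is_zero_pmod M \<and>
     (\<forall>A B. is_pmod A \<and> is_pmod B \<and> pm_isomorphic M (pm_dsum A B) \<longrightarrow>
            is_zero_pmod A \<or> is_zero_pmod B)"

definition mat_range :: "'k::field mat \<Rightarrow> 'k vec set" where
  "mat_range A = (\<lambda>v. A *\<^sub>v v) ` carrier_vec (dim_col A)"

definition pm_mono :: "('p \<Rightarrow> 'k::field mat) \<Rightarrow> bool" where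
  "pm_mono f \<longleftrightarrow> (\<forall>p. inj_on (\<lambda>v. f p *\<^sub>v v) (carrier_vec (dim_col (f p))))"

definition pm_epi :: "('p \<Rightarrow> 'k::field mat) \<Rightarrow> bool" where
  "pm_epi g \<longleftrightarrow> (\<forall>p. mat_range (g p) = carrier_vec (dim_row (g p)))"

definition is_kernel :: "('p::order, 'k::field) pmod \<Rightarrow> ('p \<Rightarrow> 'k mat) \<Rightarrow>
    ('p, 'k) pmod \<Rightarrow> ('p \<Rightarrow> 'k mat) \<Rightarrow> ('p, 'k) pmod \<Rightarrow> bool" where
  "is_kernel M f N g L \<longleftrightarrow> is_pmod M \<and> is_pmod N \<and> is_pmod L \<and>
     f \<in> pm_hom M N \<and> g \<in> pm_hom N L \<and> pm_mono f \<and>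
     (\<forall>p. mat_range (f p) = mat_kernel (g p))"

definition short_exact :: "('p::order, 'k::field) pmod \<Rightarrow> ('p \<Rightarrow> 'k mat) \<Rightarrow>
    ('p, 'k) pmod \<Rightarrow> ('p \<Rightarrow> 'k mat) \<Rightarrow> ('p, 'k) pmod \<Rightarrow> bool" where
  "short_exact M f N g L \<longleftrightarrow> is_kernel M f N g L \<and> pm_epi g"

definition projective_pmod :: "('p::order, 'k::field) pmod \<Rightarrow> bool" where
  "projective_pmod Q \<longleftrightarrow> is_pmod Q \<and>
     (\<forall>N L g h. is_pmod N \<and> is_pmod L \<and> g \<in> pm_hom N L \<and> pm_epi g \<and> h \<in> pm_hom Q L \<longrightarrow>
        (\<exists>k\<in>pm_hom Q N. pm_comp g k = h))"

definition iso_class :: "('p::order, 'k::field) pmod \<Rightarrow> ('p, 'k) pmod set" where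
  "iso_class M = {N. is_pmod N \<and> pm_isomorphic M N}"

definition iso_classes :: "('p::order, 'k::field) pmod set set" where
  "iso_classes = iso_class ` {M. is_pmod M}"

definition incomparable :: "'p::order set \<Rightarrow> bool" where
  "incomparable A \<longleftrightarrow> (\<forall>a\<in>A. \<forall>b\<in>A. a \<le> b \<longrightarrow> a = b)"

definition set_le :: "'p::order set \<Rightarrow> 'p set \<Rightarrow> bool" where
  "set_le A B \<longleftrightarrow> (\<forall>a\<in>A. \<exists>b\<in>B. a \<le> b) \<and> (\<forall>b\<in>B. \<exists>a\<in>A. a \<le> b)"

definition spread :: "'p::order set \<Rightarrow> 'p set \<Rightarrow> 'p set" where
  "spread A B = {x. \<exists>a\<in>A. \<exists>b\<in>B. a \<le> x \<and> x \<le> b}"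

definition hasse_arrows :: "'p::order set \<Rightarrow> ('p \<times> 'p) set" where
  "hasse_arrows S = {(x, y). x \<in> S \<and> y \<in> S \<and> x < y \<and> \<not> (\<exists>z. x < z \<and> z < y)}"

text \<open>The empty spread is not connected: its spread module is zero, hence not indecomposable.\<close>

definition connected_spread :: "'p::order set \<Rightarrow> 'p set \<Rightarrow> bool" where
  "connected_spread A B \<longleftrightarrow> incomparable A \<and> incomparable B \<and> set_le A B \<and>
     spread A B \<noteq> {} \<and>
     (\<forall>x\<in>spread A B. \<forall>y\<in>spread A B.
        (x, y) \<in> (hasse_arrows (spread A B) \<union> (hasse_arrows (spread A B))\<inverse>)\<^sup>*)"

definition spread_module :: "'p::order set \<Rightarrow> ('p, 'k::field) pmod" where
  "spread_module S = \<lparr>vdim = (\<lambda>p. if p \<in> S then 1 else 0),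
     tmap = (\<lambda>p q. if p \<in> S \<and> q \<in> S then 1\<^sub>m 1
                    else 0\<^sub>m (if q \<in> S then 1 else 0) (if p \<in> S then 1 else 0))\<rparr>"

definition upset :: "'p::order set \<Rightarrow> bool" where
  "upset U \<longleftrightarrow> (\<forall>x\<in>U. \<forall>y. x \<le> y \<longrightarrow> y \<in> U)"

text \<open>From here on X is a set of isomorphism classes, so that card X counts modules up to
  isomorphism.\<close>

definition in_add :: "('p::order, 'k::field) pmod set set \<Rightarrow> ('p, 'k) pmod \<Rightarrow> bool" where
  "in_add X R \<longleftrightarrow> is_pmod R \<and>
     (\<exists>Ys. (\<forall>Y\<in>set Ys. is_pmod Y \<and> iso_class Y \<in> X) \<and>
           pm_isomorphic R (foldr pm_dsum Ys zero_pmod))"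

definition approximation :: "('p::order, 'k::field) pmod set set \<Rightarrow>
    ('p, 'k) pmod \<Rightarrow> ('p \<Rightarrow> 'k mat) \<Rightarrow> ('p, 'k) pmod \<Rightarrow> bool" where
  "approximation X R f M \<longleftrightarrow> in_add X R \<and> f \<in> pm_hom R M \<and>
     (\<forall>R' h. in_add X R' \<and> h \<in> pm_hom R' M \<longrightarrow> (\<exists>k\<in>pm_hom R' R. pm_comp f k = h))"

definition minimal_approximation :: "('p::order, 'k::field) pmod set set \<Rightarrow>
    ('p, 'k) pmod \<Rightarrow> ('p \<Rightarrow> 'k mat) \<Rightarrow> ('p, 'k) pmod \<Rightarrow> bool" where
  "minimal_approximation X R f M \<longleftrightarrow> approximation X R f M \<and>
     (\<forall>g\<in>pm_hom R R. pm_comp f g = f \<longrightarrow> pm_isomorphism R R g)"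

text \<open>Z n is the n-th syzygy, with inclusion i n of Z (n + 1) into R n.\<close>

definition minimal_resolution ::
  "('p::order, 'k::field) pmod set set \<Rightarrow> ('p, 'k) pmod \<Rightarrow> (nat \<Rightarrow> ('p, 'k) pmod) \<Rightarrow> bool" where
  "minimal_resolution X M R \<longleftrightarrow>
     (\<exists>Z f i. Z 0 = M \<and>
        (\<forall>n. minimal_approximation X (R n) (f n) (Z n) \<and>
             is_kernel (Z (Suc n)) (i n) (R n) (f n) (Z n)))"

text \<open>Minimal resolutions are unique up to isomorphism, so the infimum below is the one of any
  single minimal resolution. The infimum of the empty set is \<open>\<infinity>\<close>.\<close>

definition rel_dim :: "('p::order, 'k::field) pmod set set \<Rightarrow> ('p, 'k) pmod \<Rightarrow> enat" where
  "rel_dim X M =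
     Inf {enat j | j. \<exists>R. minimal_resolution X M R \<and> is_zero_pmod (R (Suc j))}"

definition properly_infinite :: "('p::order, 'k::field) pmod set set \<Rightarrow> bool" where
  "properly_infinite X \<longleftrightarrow> (\<exists>M. is_pmod M \<and> rel_dim X M = \<infinity>)"

abbreviation free_iso ::
  "(('p::order, 'k::field) pmod set \<Rightarrow>\<^sub>0 int) monoid" where
  "free_iso \<equiv> free_Abelian_group iso_classes"

definition split_rel :: "(('p::order, 'k::field) pmod set \<Rightarrow>\<^sub>0 int) set" where
  "split_rel = generate free_iso
     {frag_of (iso_class (pm_dsum M N)) - frag_of (iso_class M) - frag_of (iso_class N) | M N.
        is_pmod M \<and> is_pmod N}"

definition K0_split :: "(('p::order, 'k::field) pmod set \<Rightarrow>\<^sub>0 int) set monoid" where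
  "K0_split = free_iso Mod split_rel"

definition rel_exact :: "('p::order, 'k::field) pmod set set \<Rightarrow> ('p, 'k) pmod \<Rightarrow>
    ('p \<Rightarrow> 'k mat) \<Rightarrow> ('p, 'k) pmod \<Rightarrow> ('p \<Rightarrow> 'k mat) \<Rightarrow> ('p, 'k) pmod \<Rightarrow> bool" where
  "rel_exact X M f N g L \<longleftrightarrow> short_exact M f N g L \<and>
     (\<forall>R. is_pmod R \<and> iso_class R \<in> X \<longrightarrow>
        (\<forall>h\<in>pm_hom R L. \<exists>k\<in>pm_hom R N. pm_comp g k = h))"

definition exact_rel ::
  "('p::order, 'k::field) pmod set set \<Rightarrow> (('p, 'k) pmod set \<Rightarrow>\<^sub>0 int) set" where
  "exact_rel X = generate free_iso
     {frag_of (iso_class M) - frag_of (iso_class N) + frag_of (iso_class L) | M N L.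
        \<exists>f g. rel_exact X M f N g L}"

definition K0_rel ::
  "('p::order, 'k::field) pmod set set \<Rightarrow> (('p, 'k) pmod set \<Rightarrow>\<^sub>0 int) set monoid" where
  "K0_rel X = free_iso Mod exact_rel X"

text \<open>Split sequences are always in the exact structure, so split_rel is contained in exact_rel X
  and the quotient map sends a coset c + split_rel to the coset c + exact_rel X, which is the
  sum of the sets exact_rel X and c + split_rel.\<close>

definition K0_quot :: "('p::order, 'k::field) pmod set set \<Rightarrow>
    (('p, 'k) pmod set \<Rightarrow>\<^sub>0 int) set \<Rightarrow> (('p, 'k) pmod set \<Rightarrow>\<^sub>0 int) set" where
  "K0_quot X C = exact_rel X <#>\<^bsub>free_iso\<^esub> C"

definition Z_pow :: "nat \<Rightarrow> (nat \<Rightarrow> int) monoid" where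
  "Z_pow n = product_group {..<n} (\<lambda>_. integer_group)"

text \<open>The target of an invariant is allowed to be any group isomorphic to some power of the
  integers, so that the quotient map onto K0_rel X itself can be an invariant.\<close>

definition is_invariant :: "'b monoid \<Rightarrow>
    ((('p::order, 'k::field) pmod set \<Rightarrow>\<^sub>0 int) set \<Rightarrow> 'b) \<Rightarrow> bool" where
  "is_invariant G \<phi> \<longleftrightarrow> \<phi> \<in> epi K0_split G \<and> (\<exists>n. G \<cong> Z_pow n)"

definition homological_invariant :: "('p::order, 'k::field) pmod set set \<Rightarrow> 'b monoid \<Rightarrow>
    ((('p, 'k) pmod set \<Rightarrow>\<^sub>0 int) set \<Rightarrow> 'b) \<Rightarrow> bool" where
  "homological_invariant X G \<phi> \<longleftrightarrow> is_invariant G \<phi> \<and>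
     finite X \<and>
     (\<forall>c\<in>X. \<exists>M. indecomposable_pmod M \<and> c = iso_class M) \<and>
     (\<forall>Q. projective_pmod Q \<and> indecomposable_pmod Q \<longrightarrow> iso_class Q \<in> X) \<and>
     \<not> properly_infinite X \<and>
     K0_rel X \<cong> Z_pow (card X) \<and>
     Coset.kernel K0_split G \<phi> = Coset.kernel K0_split (K0_rel X) (K0_quot X)"

end

theory Submission
  imports Defs "HOL-Library.Function_Algebras"
begin

text \<open>Let SS be the family of supports of the spread modules in X. Both parts rest on the same two facts. First,
  every morphism between two of these spread modules is a scalar multiple of the canonical map, the identity on the
  intersection of the supports. Second, the relation of having a nonzero morphism between different members of SS
  has no cycles, so it increases a suitable rank. If all spreads have a single source, a morphism is
  determined by its value at the source of its domain, and a nonzero one either moves to a strictly lower source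
  or keeps the source and shrinks the spread (\<open>scalar_if_least\<close>, \<open>source_rank_less\<close>). If all spreads are
  connected upsets, a nonzero morphism is constant and exists only along an inclusion (\<open>scalar_if_upset\<close>,
  \<open>leads_upset_subset\<close>). The locale \<open>directed_spreads\<close> records these two facts, and the rest is common to both
  parts.

  Finite dimension: a generating set of morphisms to M with the fewest elements gives a minimal approximation.
  A morphism of spread modules into the approximation that becomes zero in M only has components of strictly higher
  rank than its source (\<open>approximation_kernel_sections\<close>), because otherwise a generator would be redundant. This makes
  endomorphisms over M unitriangular, hence invertible, and it shows that the highest rank with a nonzero
  morphism to M no longer occurs for the kernel (\<open>minimal_approximation_step\<close>). So resolutions stop.

  Grothendieck group: the dimensions of the spaces of morphisms from the members of X are additive on the exact
  sequences in question. On the members of X themselves they form a unitriangular integer matrix, so they map the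
  formal sums of modules onto the free abelian group of rank |X|. Conversely, a finite resolution rewrites every module
  as a combination of members of X, so nothing but the exact relations is killed (\<open>exact_rel_eq\<close>).

  Morphisms from a spread module are recorded as sections, families of vectors over its support, so that all
  spaces of morphisms are subspaces of one space of functions.\<close>

section \<open>Linear algebra of functions\<close>

text \<open>Pointwise scaling. Vectors are functions from an index set to the field, so that all spaces of
  morphisms below are subspaces of one vector space and can be compared without coercions.\<close>

definition fscale :: "'k::field \<Rightarrow> ('i \<Rightarrow> 'k) \<Rightarrow> 'i \<Rightarrow> 'k" where
  "fscale c v = (\<lambda>i. c * v i)"

lemma fscale_apply [simp]: "fscale c v i = c * v i"
  by (simp add: fscale_def)

interpretation fvs: vector_space "fscale :: 'k::field \<Rightarrow> ('i \<Rightarrow> 'k) \<Rightarrow> 'i \<Rightarrow> 'k"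
  by unfold_locales (auto simp: fun_eq_iff algebra_simps)

interpretation fvp: vector_space_pair "fscale :: 'k::field \<Rightarrow> ('i \<Rightarrow> 'k) \<Rightarrow> 'i \<Rightarrow> 'k"
    "fscale :: 'k::field \<Rightarrow> ('j \<Rightarrow> 'k) \<Rightarrow> 'j \<Rightarrow> 'k"
  by unfold_locales

lemma sum_fun_apply: "(\<Sum>i\<in>I. f i) x = (\<Sum>i\<in>I. f i x)" for f :: "'a \<Rightarrow> 'b \<Rightarrow> 'c::comm_monoid_add"
  by (induction I rule: infinite_finite_induct) auto

abbreviation flinear :: "(('i \<Rightarrow> 'k::field) \<Rightarrow> 'j \<Rightarrow> 'k) \<Rightarrow> bool" where
  "flinear \<equiv> Vector_Spaces.linear fscale fscale"

lemma flinearI: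
  assumes "\<And>u v. f (u + v) = f u + f v" "\<And>c v. f (fscale c v) = fscale c (f v)"
  shows "flinear f"
  by (rule Vector_Spaces.linear_iff[THEN iffD2]) (auto simp: assms fvs.vector_space_axioms)

lemma supported_in_span:
  fixes v :: "'i \<Rightarrow> 'k::field"
  assumes "finite F" "\<forall>i. i \<notin> F \<longrightarrow> v i = 0"
  shows "v \<in> fvs.span ((\<lambda>j i. if i = j then 1 else 0) ` F)"
proof -
  have "v = (\<Sum>j\<in>F. fscale (v j) (\<lambda>i. if i = j then 1 else 0))"
    using assms by (auto simp: fun_eq_iff sum_fun_apply if_distrib cong: if_cong)
  then show ?thesis
    by (metis (no_types, lifting) fvs.span_base fvs.span_scale fvs.span_sum imageI)
qed

lemma finite_basis:
  fixes V :: "('i \<Rightarrow> 'k::field) set"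
  assumes "finite F" "\<And>v i. v \<in> V \<Longrightarrow> i \<notin> F \<Longrightarrow> v i = 0"
  obtains B where "finite B" "B \<subseteq> V" "\<not> fvs.dependent B" "V \<subseteq> fvs.span B"
proof -
  obtain B where B: "B \<subseteq> V" "\<not> fvs.dependent B" "V \<subseteq> fvs.span B"
    using fvs.maximal_independent_subset[of V] by metis
  have "B \<subseteq> fvs.span ((\<lambda>j i. if i = j then 1 else 0) ` F)"
    using B(1) assms by (auto intro!: supported_in_span)
  then have "finite B"
    using fvs.independent_span_bound[OF _ B(2)] assms(1) by blast
  with B that show ?thesis by blast
qed

lemma in_span_image:
  fixes \<phi> :: "'a \<Rightarrow> 'i \<Rightarrow> 'k::field"
  assumes "finite I" "x \<in> fvs.span (\<phi> ` I)"
  obtains c where "x = (\<Sum>i\<in>I. fscale (c i) (\<phi> i))"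
proof -
  have "\<exists>c. x = (\<Sum>i\<in>I. fscale (c i) (\<phi> i))"
    using assms(2)
  proof (induction rule: fvs.span_induct_alt)
    case base
    have "0 = (\<Sum>i\<in>I. fscale ((\<lambda>_. 0) i) (\<phi> i))" by (simp add: fun_eq_iff sum_fun_apply)
    then show ?case by (rule exI[of _ "\<lambda>_. 0"])
  next
    case (step a y z)
    then obtain c j where c: "z = (\<Sum>i\<in>I. fscale (c i) (\<phi> i))" and j: "j \<in> I" "y = \<phi> j" by blast
    have "fscale a y + z = (\<Sum>i\<in>I. fscale (c i + (if i = j then a else 0)) (\<phi> i))"
      using j assms(1) unfolding c
      by (auto simp: fun_eq_iff sum_fun_apply distrib_right sum.distrib if_distrib[of "\<lambda>t. t * _"] cong: if_cong)
    then show ?case by metis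
  qed
  with that show ?thesis by blast
qed

text \<open>Rank-nullity on a subspace. The ambient function space may have infinite dimension; the bases
  that are compared are finite because all vectors of U are supported in the finite set F.\<close>

lemma dim_exact:
  fixes f :: "('i \<Rightarrow> 'k::field) \<Rightarrow> 'i \<Rightarrow> 'k"
  assumes lin: "flinear f"
    and U: "fvs.subspace U" and fU: "f ` U = W" and V: "V = {u \<in> U. f u = 0}"
    and fin: "finite F" "\<And>v i. v \<in> U \<Longrightarrow> i \<notin> F \<Longrightarrow> v i = 0"
  shows "fvs.dim U = fvs.dim V + fvs.dim W"
proof -
  have linadd: "f (x + y) = f x + f y" "f (x - y) = f x - f y" for x y
    using lin fvp.linear_add fvp.linear_diff by blast+
  have subV: "fvs.subspace V"
    unfolding V using U lin
    by (auto simp: fvs.subspace_def fvp.linear_add fvp.linear_scale fvp.linear_0)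
  obtain B where B: "finite B" "B \<subseteq> V" "\<not> fvs.dependent B" "V \<subseteq> fvs.span B"
    using finite_basis[of F V] fin V by blast
  obtain C where C: "B \<subseteq> C" "C \<subseteq> U" "\<not> fvs.dependent C" "U \<subseteq> fvs.span C"
    using fvs.maximal_independent_subset_extend[of B U] B V by blast
  have "C \<subseteq> fvs.span ((\<lambda>j i. if i = j then 1 else 0) ` F)"
    using C(2) fin by (auto intro!: supported_in_span)
  then have finC: "finite C"
    using fvs.independent_span_bound[OF _ C(3)] fin(1) by blast
  have spV: "fvs.span B = V" using B subV by (simp add: fvs.span_subspace)
  have spU: "fvs.span C = U" using C U by (simp add: fvs.span_subspace)
  have disj: "fvs.span B \<inter> fvs.span (C - B) = {0}"
  proof -
    have "x = 0" if xB: "x \<in> fvs.span B" and xC: "x \<in> fvs.span (C - B)" for x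
    proof -
      obtain b where b: "x = (\<Sum>v\<in>B. fscale (b v) (id v))" 
        by (rule in_span_image[of B x id]) (use B xB in auto)
      obtain c where c: "x = (\<Sum>v\<in>C - B. fscale (c v) (id v))" 
        by (rule in_span_image[of "C - B" x id]) (use finC xC in auto)
      \<comment> \<open>a common vector of both spans is a linear relation between the elements of C\<close>
      let ?d = "\<lambda>v. if v \<in> B then b v else - c v"
      have "(\<Sum>v\<in>C. fscale (?d v) v) = (\<Sum>v\<in>B. fscale (?d v) v) + (\<Sum>v\<in>C - B. fscale (?d v) v)"
        using C(1) finC by (metis (no_types, lifting) add.commute sum.subset_diff)
      also have "(\<Sum>v\<in>B. fscale (?d v) v) = x" unfolding b by simp
      also have "(\<Sum>v\<in>C - B. fscale (?d v) v) = - x"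
        unfolding c sum_negf[symmetric] by (rule sum.cong) auto
      finally have "(\<Sum>v\<in>C. fscale (?d v) v) = 0" by (simp only: add.right_inverse)
      then have z: "(\<Sum>v\<in>C. fscale (?d v) v) = 0" .
      have "\<forall>v\<in>C. ?d v = 0"
      proof (rule ccontr)
        assume "\<not> (\<forall>v\<in>C. ?d v = 0)"
        then have "\<exists>u. (\<exists>v\<in>C. u v \<noteq> 0) \<and> (\<Sum>v\<in>C. fscale (u v) v) = 0"
          using z by (intro exI[of _ ?d]) blast
        then show False using C(3) by (simp only: fvs.dependent_finite[OF finC] not_True_eq_False)
      qed
      then have "b v = 0" if "v \<in> B" for v using C(1) that by force
      then show "x = 0" unfolding b by simp
    qed
    then show ?thesis using fvs.span_zero by blast
  qed
  have inj: "inj_on f (fvs.span (C - B))"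
  proof (rule inj_onI)
    fix x y assume x: "x \<in> fvs.span (C - B)" and y: "y \<in> fvs.span (C - B)" and eq: "f x = f y"
    have d: "x - y \<in> fvs.span (C - B)" using x y by (rule fvs.span_diff)
    then have "x - y \<in> U" using spU fvs.span_mono[of "C - B" C] by auto
    then have "x - y \<in> V" using eq by (simp add: V linadd)
    then have "x - y = 0" using d disj spV by blast
    then show "x = y" by simp
  qed
  have dW: "\<not> fvs.dependent (f ` (C - B))"
    using fvp.linear_independent_injective_image[OF lin _ inj] fvs.independent_mono[OF C(3)] by blast
  have "fvs.span (f ` (C - B)) = W"
  proof
    have "f ` (C - B) \<subseteq> W" using C(2) fU by blast
    moreover have "fvs.subspace W" using U fU fvp.linear_subspace_image[OF lin] by blast
    ultimately show "fvs.span (f ` (C - B)) \<subseteq> W" by (rule fvs.span_minimal)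
    show "W \<subseteq> fvs.span (f ` (C - B))"
    proof
      fix w assume "w \<in> W"
      then obtain u where u: "u \<in> U" "w = f u" using fU by blast
      have "B \<union> (C - B) = C" using C(1) by blast
      then have "u \<in> {x + y |x y. x \<in> fvs.span B \<and> y \<in> fvs.span (C - B)}"
        using u spU fvs.span_Un[of B "C - B"] by metis
      then obtain b c where bc: "b \<in> fvs.span B" "c \<in> fvs.span (C - B)" "u = b + c"
        by blast
      have "f b = 0" using bc spV V by blast
      then have "w = f c" using bc u by (simp add: linadd)
      then show "w \<in> fvs.span (f ` (C - B))"
        using bc(2) fvp.linear_span_image[OF lin, of "C - B"] by blast
    qed
  qed
  then have "fvs.dim W = card (f ` (C - B))"
    using fvs.dim_eq_card[OF _ dW] by (metis fvs.span_span)
  also have "\<dots> = card (C - B)"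
    using inj fvs.span_superset[of "C - B"] by (meson card_image inj_on_subset)
  finally have "fvs.dim W = card (C - B)" .
  moreover have "fvs.dim V = card B" using fvs.dim_eq_card[of B V] spV B(3) fvs.span_span by metis
  moreover have "fvs.dim U = card C" using fvs.dim_eq_card[of C U] spU C(3) fvs.span_span by metis
  moreover have "card C = card B + card (C - B)"
    using finC C(1) B(1) by (metis card_Diff_subset card_mono le_add_diff_inverse)
  ultimately show ?thesis by simp
qed

section \<open>Matrices acting on functions\<close>

text \<open>Column vectors of length n are treated as functions on the natural numbers that vanish from n
  on. Matrices then act as operators on a single type, and sums and composites of such operators need no
  side conditions on dimensions.\<close>

definition supp :: "nat \<Rightarrow> (nat \<Rightarrow> 'k::zero) \<Rightarrow> bool" where
  "supp n v \<longleftrightarrow> (\<forall>i\<ge>n. v i = 0)"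

definition mv :: "'k::field mat \<Rightarrow> (nat \<Rightarrow> 'k) \<Rightarrow> nat \<Rightarrow> 'k" where
  "mv A v = (\<lambda>i. if i < dim_row A then \<Sum>j<dim_col A. A $$ (i, j) * v j else 0)"

abbreviation fun_of_vec :: "'k::zero vec \<Rightarrow> nat \<Rightarrow> 'k" where
  "fun_of_vec v \<equiv> (\<lambda>i. if i < dim_vec v then v $ i else 0)"

lemma supp_0 [simp]: "supp n 0" by (simp add: supp_def)
lemma supp_0_iff [simp]: "supp 0 v \<longleftrightarrow> v = 0" by (auto simp: supp_def fun_eq_iff)

lemma supp_mv [simp]: "A \<in> carrier_mat m n \<Longrightarrow> supp m (mv A v)"
  by (auto simp: supp_def mv_def)

lemma mv_mult:
  assumes "A \<in> carrier_mat m n" "B \<in> carrier_mat n l"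
  shows "mv (A * B) v = mv A (mv B v)"
proof -
  have "(\<Sum>j<l. (\<Sum>k<n. A $$ (i, k) * B $$ (k, j)) * v j) = (\<Sum>k<n. A $$ (i, k) * (\<Sum>j<l. B $$ (k, j) * v j))" for i
    unfolding sum_distrib_left sum_distrib_right by (subst sum.swap) (simp add: mult.assoc)
  then show ?thesis using assms
    by (auto simp: mv_def fun_eq_iff scalar_prod_def atLeast0LessThan)
qed

lemma mv_one: "supp n v \<Longrightarrow> mv (1\<^sub>m n) v = v"
  by (auto simp: mv_def fun_eq_iff supp_def if_distrib[of "\<lambda>t. t * _"] cong: if_cong)

lemma mv_zero [simp]: "mv (0\<^sub>m m n) v = 0"
  by (auto simp: mv_def fun_eq_iff)

lemma mv_add: "mv A (u + v) = mv A u + mv A v"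
  by (auto simp: mv_def fun_eq_iff algebra_simps sum.distrib)

lemma mv_scale: "mv A (fscale c v) = fscale c (mv A v)"
  by (auto simp: mv_def fun_eq_iff algebra_simps sum_distrib_left)

lemma mv_0 [simp]: "mv A 0 = 0"
  by (auto simp: mv_def fun_eq_iff)

lemma mv_diff: "mv A (u - v) = mv A u - mv A v"
  by (auto simp: mv_def fun_eq_iff algebra_simps sum_subtractf)

lemma mv_unit: "j < dim_col A \<Longrightarrow> i < dim_row A \<Longrightarrow> mv A (\<lambda>i. if i = j then 1 else 0) i = A $$ (i, j)"
  by (simp add: mv_def if_distrib[of "\<lambda>t. _ * t"] cong: if_cong)

lemma mat_eq_by_mv:
  assumes "A \<in> carrier_mat m n" "B \<in> carrier_mat m n" "\<And>v. supp n v \<Longrightarrow> mv A v = mv B v"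
  shows "A = B"
proof (rule eq_matI)
  fix i j assume ij: "i < dim_row B" "j < dim_col B"
  have "supp n (\<lambda>i. if i = j then 1 else 0 :: 'a)" using ij assms by (auto simp: supp_def)
  from fun_cong[OF assms(3)[OF this], of i] show "A $$ (i, j) = B $$ (i, j)"
    using ij assms by (simp add: mv_unit)
qed (use assms in auto)

lemma mat_with_columns:
  fixes w :: "nat \<Rightarrow> nat \<Rightarrow> 'k::field"
  assumes "\<And>j. j < n \<Longrightarrow> supp m (w j)" "supp n v"
  shows "mv (mat m n (\<lambda>(i, j). w j i)) v = (\<Sum>j<n. fscale (v j) (w j))"
  using assms by (auto simp: fun_eq_iff mv_def sum_fun_apply supp_def mult.commute intro!: sum.cong sum.neutral)

text \<open>The equation B T = D is solved column by column.\<close>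

lemma mat_factor:
  fixes B D :: "'k::field mat"
  assumes B: "B \<in> carrier_mat m k" and D: "D \<in> carrier_mat m n"
    and lift: "\<And>v. supp n v \<Longrightarrow> \<exists>w. supp k w \<and> mv B w = mv D v"
  obtains T where "T \<in> carrier_mat k n" "B * T = D"
proof -
  let ?e = "\<lambda>j i. if i = j then 1 else 0 :: 'k"
  have "\<exists>w. supp k w \<and> mv B w = mv D (?e j)" if "j < n" for j
    using that by (intro lift) (auto simp: supp_def)
  then obtain w where w: "\<And>j. j < n \<Longrightarrow> supp k (w j) \<and> mv B (w j) = mv D (?e j)" by metis
  let ?T = "mat k n (\<lambda>(i, j). w j i)"
  have T: "mv ?T (?e j) = w j" if "j < n" for j
  proof -
    have "mv ?T (?e j) = (\<Sum>l<n. fscale (?e j l) (w l))"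
      by (rule mat_with_columns) (use w that in \<open>auto simp: supp_def\<close>)
    also have "\<dots> = w j" using that by (auto simp: fun_eq_iff sum_fun_apply if_distrib[of "\<lambda>t. t * _"] cong: if_cong)
    finally show ?thesis .
  qed
  have "B * ?T = D"
  proof (rule eq_matI)
    fix i j assume ij: "i < dim_row D" "j < dim_col D"
    have "mv (B * ?T) (?e j) = mv D (?e j)"
      using mv_mult[OF B, of ?T n "?e j"] T w ij D by simp
    from fun_cong[OF this, of i] show "(B * ?T) $$ (i, j) = D $$ (i, j)"
      using ij B D mv_unit[of j "B * ?T" i] mv_unit[of j D i] by simp
  qed (use B D in auto)
  then show ?thesis using that[of ?T] by simp
qed

text \<open>The columns of B are a basis of the null space of A; this is how the inclusion of a kernel is
  written as a matrix.\<close>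

lemma kernel_mat_exists:
  fixes A :: "'k::field mat"
  assumes A: "A \<in> carrier_mat m n"
  obtains k B where "B \<in> carrier_mat n k"
    "\<And>w. supp k w \<Longrightarrow> mv B w = 0 \<Longrightarrow> w = 0"
    "\<And>v. supp n v \<Longrightarrow> mv A v = 0 \<longleftrightarrow> (\<exists>w. supp k w \<and> mv B w = v)"
proof -
  let ?V = "{v. supp n v \<and> mv A v = 0}"
  have sub: "fvs.subspace ?V"
    by (auto simp: fvs.subspace_def supp_def mv_add mv_scale)
  obtain C where C: "finite C" "C \<subseteq> ?V" "\<not> fvs.dependent C" "?V \<subseteq> fvs.span C"
    by (rule finite_basis[of "{..<n}" ?V]) (auto simp: supp_def)
  obtain cs where cs: "set cs = C" "distinct cs" using finite_distinct_list[OF C(1)] by blast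
  let ?k = "length cs"
  have bij: "bij_betw (\<lambda>j. cs ! j) {..<?k} C" using cs bij_betw_nth[of cs "{..<?k}" C] by simp
  let ?B = "mat n ?k (\<lambda>(i, j). (cs ! j) i)"
  have mvB: "mv ?B w = (\<Sum>j<?k. fscale (w j) (cs ! j))" if "supp ?k w" for w
    by (rule mat_with_columns) (use C(2) cs that nth_mem in blast)+
  show ?thesis
  proof
    show "?B \<in> carrier_mat n ?k" by simp
  next
    fix w assume w: "supp ?k w" "mv ?B w = 0"
    let ?u = "\<lambda>c. w (inv_into {..<?k} (\<lambda>j. cs ! j) c)"
    have u: "?u (cs ! j) = w j" if "j < ?k" for j
      using bij that by (simp add: bij_betw_def inv_into_f_f)
    have "(\<Sum>c\<in>C. fscale (?u c) c) = (\<Sum>j<?k. fscale (?u (cs ! j)) (cs ! j))"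
      using sum.reindex_bij_betw[OF bij, of "\<lambda>c. fscale (?u c) c"] by simp
    also have "\<dots> = mv ?B w" using mvB[OF w(1)] u by simp
    finally have "(\<Sum>c\<in>C. fscale (?u c) c) = 0" using w by simp
    then have z: "(\<Sum>c\<in>C. fscale (?u c) c) = 0" .
    have "\<forall>c\<in>C. ?u c = 0"
    proof (rule ccontr)
      assume "\<not> (\<forall>c\<in>C. ?u c = 0)"
      then have "\<exists>u. (\<exists>v\<in>C. u v \<noteq> 0) \<and> (\<Sum>v\<in>C. fscale (u v) v) = 0"
        using z by (intro exI[of _ ?u]) blast
      then show False using C(3) by (simp only: fvs.dependent_finite[OF C(1)] not_True_eq_False)
    qed
    then have "w j = 0" if "j < ?k" for j using u[OF that] cs(1) that nth_mem by metis
    then show "w = 0" using w(1) by (intro ext) (metis supp_def zero_fun_def not_less)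
  next
    fix v :: "nat \<Rightarrow> 'k" assume v: "supp n v"
    show "mv A v = 0 \<longleftrightarrow> (\<exists>w. supp ?k w \<and> mv ?B w = v)"
    proof
      assume "mv A v = 0"
      then have "v \<in> fvs.span ((\<lambda>j. cs ! j) ` {..<?k})" using v C(4) bij by (auto simp: bij_betw_def)
      then obtain c where c: "v = (\<Sum>j<?k. fscale (c j) (cs ! j))" by (rule in_span_image[rotated]) auto
      have s: "supp ?k (\<lambda>j. if j < ?k then c j else 0)" by (auto simp: supp_def)
      have "mv ?B (\<lambda>j. if j < ?k then c j else 0) = v"
        unfolding mvB[OF s] c by (auto intro!: sum.cong)
      then show "\<exists>w. supp ?k w \<and> mv ?B w = v" using s by blast
    next
      assume "\<exists>w. supp ?k w \<and> mv ?B w = v"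
      then obtain w where "supp ?k w" "mv ?B w = v" by blast
      then have "v = (\<Sum>j<?k. fscale (w j) (cs ! j))" using mvB by simp
      also have "\<dots> \<in> ?V"
        by (rule fvs.subspace_sum[OF sub], rule fvs.subspace_scale[OF sub]) (use C(2) cs nth_mem in blast)
      finally show "mv A v = 0" by simp
    qed
  qed
qed

section \<open>Modules and homomorphisms\<close>

lemma pmod_carrier: "is_pmod M \<Longrightarrow> p \<le> q \<Longrightarrow> tmap M p q \<in> carrier_mat (vdim M q) (vdim M p)"
  unfolding is_pmod_def by blast

lemma pmod_comp: "is_pmod M \<Longrightarrow> p \<le> q \<Longrightarrow> q \<le> r \<Longrightarrow> tmap M p r = tmap M q r * tmap M p q"
  unfolding is_pmod_def by blast

lemma pmod_id: "is_pmod M \<Longrightarrow> tmap M p p = 1\<^sub>m (vdim M p)"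
  unfolding is_pmod_def by blast

lemma pmod_mv_trans:
  assumes "is_pmod M" "p \<le> q" "q \<le> r"
  shows "mv (tmap M q r) (mv (tmap M p q) v) = mv (tmap M p r) v"
  unfolding pmod_comp[OF assms]
  by (rule mv_mult[OF pmod_carrier pmod_carrier, symmetric]) (rule assms)+

lemma pmod_mv_id: "is_pmod M \<Longrightarrow> supp (vdim M p) v \<Longrightarrow> mv (tmap M p p) v = v"
  by (simp add: pmod_id mv_one)

lemma pm_hom_carrier: "f \<in> pm_hom M N \<Longrightarrow> f p \<in> carrier_mat (vdim N p) (vdim M p)"
  by (simp add: pm_hom_def)

lemma pm_hom_mv:
  assumes "is_pmod M" "is_pmod N" "f \<in> pm_hom M N" "p \<le> q"
  shows "mv (f q) (mv (tmap M p q) v) = mv (tmap N p q) (mv (f p) v)"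
  using assms mv_mult[OF pm_hom_carrier[OF assms(3)] pmod_carrier[OF assms(1,4)], of v]
    mv_mult[OF pmod_carrier[OF assms(2,4)] pm_hom_carrier[OF assms(3)], of v]
  by (simp add: pm_hom_def)

lemma pm_homI:
  assumes M: "is_pmod M" and N: "is_pmod N"
    and car: "\<And>p. f p \<in> carrier_mat (vdim N p) (vdim M p)"
    and nat: "\<And>p q v. p \<le> q \<Longrightarrow> supp (vdim M p) v \<Longrightarrow>
      mv (f q) (mv (tmap M p q) v) = mv (tmap N p q) (mv (f p) v)"
  shows "f \<in> pm_hom M N"
proof -
  have "f q * tmap M p q = tmap N p q * f p" if pq: "p \<le> q" for p q
  proof (rule mat_eq_by_mv)
    show "f q * tmap M p q \<in> carrier_mat (vdim N q) (vdim M p)"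
      using car pmod_carrier[OF M pq] by (rule mult_carrier_mat)
    show "tmap N p q * f p \<in> carrier_mat (vdim N q) (vdim M p)"
      using pmod_carrier[OF N pq] car by (rule mult_carrier_mat)
    show "mv (f q * tmap M p q) v = mv (tmap N p q * f p) v" if "supp (vdim M p) v" for v
      using nat[OF pq that] mv_mult[OF car pmod_carrier[OF M pq], of v]
        mv_mult[OF pmod_carrier[OF N pq] car, of v] by simp
  qed
  then show ?thesis using car by (auto simp: pm_hom_def)
qed

lemma pm_hom_ext:
  assumes "f \<in> pm_hom M N" "g \<in> pm_hom M N" "\<And>p v. supp (vdim M p) v \<Longrightarrow> mv (f p) v = mv (g p) v"
  shows "f = g"
  by (rule ext, rule mat_eq_by_mv) (use assms in \<open>auto intro: pm_hom_carrier\<close>)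

lemma mv_pm_comp:
  "g \<in> pm_hom N L \<Longrightarrow> f \<in> pm_hom M N \<Longrightarrow> mv (pm_comp g f p) v = mv (g p) (mv (f p) v)"
  unfolding pm_comp_def by (rule mv_mult[OF pm_hom_carrier pm_hom_carrier])

lemma pm_comp_hom:
  assumes "is_pmod M" "is_pmod N" "is_pmod L" "g \<in> pm_hom N L" "f \<in> pm_hom M N"
  shows "pm_comp g f \<in> pm_hom M L"
proof (rule pm_homI)
  show "pm_comp g f p \<in> carrier_mat (vdim L p) (vdim M p)" for p
    unfolding pm_comp_def using assms(4,5) by (intro mult_carrier_mat[OF pm_hom_carrier pm_hom_carrier])
qed (use assms in \<open>simp_all add: mv_pm_comp[OF assms(4,5)] pm_hom_mv[OF assms(1,2,5)] pm_hom_mv[OF assms(2,3,4)]\<close>)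

lemma pm_comp_assoc:
  assumes "f \<in> pm_hom A B" "g \<in> pm_hom B C" "h \<in> pm_hom C D"
  shows "pm_comp (pm_comp h g) f = pm_comp h (pm_comp g f)"
  unfolding pm_comp_def
  by (rule ext, rule assoc_mult_mat[OF pm_hom_carrier pm_hom_carrier pm_hom_carrier]) (rule assms)+

lemma pm_id_hom: "is_pmod M \<Longrightarrow> pm_id M \<in> pm_hom M M"
  by (rule pm_homI) (auto simp: pm_id_def mv_one pmod_carrier supp_mv[OF pmod_carrier])

lemma pm_id_left: "f \<in> pm_hom M N \<Longrightarrow> pm_comp (pm_id N) f = f"
  by (auto simp: pm_comp_def pm_id_def fun_eq_iff pm_hom_def intro!: left_mult_one_mat)

lemma pm_id_right: "f \<in> pm_hom M N \<Longrightarrow> pm_comp f (pm_id M) = f"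
  by (auto simp: pm_comp_def pm_id_def fun_eq_iff pm_hom_def intro!: right_mult_one_mat)

lemma pm_isomorphic_refl: "is_pmod M \<Longrightarrow> pm_isomorphic M M"
  unfolding pm_isomorphic_def pm_isomorphism_def using pm_id_hom pm_id_left by blast

lemma pm_isomorphic_sym: "pm_isomorphic M N \<Longrightarrow> pm_isomorphic N M"
  unfolding pm_isomorphic_def pm_isomorphism_def by blast

lemma pm_isomorphic_trans:
  assumes "is_pmod L" "is_pmod M" "is_pmod N" "pm_isomorphic L M" "pm_isomorphic M N"
  shows "pm_isomorphic L N"
proof -
  obtain f f' where f: "f \<in> pm_hom L M" "f' \<in> pm_hom M L" "pm_comp f' f = pm_id L" "pm_comp f f' = pm_id M"
    using assms(4) unfolding pm_isomorphic_def pm_isomorphism_def by blast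
  obtain g g' where g: "g \<in> pm_hom M N" "g' \<in> pm_hom N M" "pm_comp g' g = pm_id M" "pm_comp g g' = pm_id N"
    using assms(5) unfolding pm_isomorphic_def pm_isomorphism_def by blast
  have gf: "pm_comp g f \<in> pm_hom L N" and fg: "pm_comp f' g' \<in> pm_hom N L"
    using assms f g by (auto intro: pm_comp_hom)
  have "pm_comp (pm_comp f' g') (pm_comp g f) = pm_id L"
    using f g gf pm_comp_assoc[OF gf g(2) f(2)] pm_comp_assoc[OF f(1) g(1,2)] by (simp add: pm_id_left)
  moreover have "pm_comp (pm_comp g f) (pm_comp f' g') = pm_id N"
    using f g fg pm_comp_assoc[OF fg f(1) g(1)] pm_comp_assoc[OF g(2) f(2,1)] by (simp add: pm_id_left)
  ultimately show ?thesis unfolding pm_isomorphic_def pm_isomorphism_def using gf fg by blast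
qed

lemma iso_class_eq_iff:
  assumes "is_pmod M" "is_pmod N"
  shows "iso_class M = iso_class N \<longleftrightarrow> pm_isomorphic M N"
  unfolding iso_class_def using assms
  by (auto intro: pm_isomorphic_refl pm_isomorphic_sym pm_isomorphic_trans)

text \<open>Isomorphic modules have the same support, and the support tells spread modules apart.\<close>

lemma pm_isomorphic_vdim_eq_0:
  assumes "pm_isomorphic M N" "vdim N p = 0" shows "vdim M p = 0"
proof (rule ccontr)
  assume "vdim M p \<noteq> 0"
  then have s: "supp (vdim M p) (\<lambda>i. if i = 0 then 1 else 0 :: 'b)" (is "supp _ ?v") by (simp add: supp_def)
  obtain f g where fg: "f \<in> pm_hom M N" "g \<in> pm_hom N M" "pm_comp g f = pm_id M"
    using assms unfolding pm_isomorphic_def pm_isomorphism_def by blast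
  have "?v = mv (pm_id M p) ?v" using mv_one[OF s] by (simp add: pm_id_def)
  also have "\<dots> = mv (g p) (mv (f p) ?v)" using mv_pm_comp[OF fg(2,1)] fg(3) by metis
  also have "mv (f p) ?v = 0" using supp_mv[OF pm_hom_carrier[OF fg(1)], of p ?v] assms(2) by simp
  finally have "?v = 0" by (simp only: mv_0)
  then have "?v 0 = (0 :: nat \<Rightarrow> 'b) 0" by (rule fun_cong)
  then show False by simp
qed

section \<open>Monomorphisms, epimorphisms and kernels\<close>

lemma mult_mat_vec_via_mv:
  assumes "A \<in> carrier_mat m n" "v \<in> carrier_vec n"
  shows "A *\<^sub>v v = vec m (mv A (fun_of_vec v))"
  using assms by (auto simp: mv_def scalar_prod_def atLeast0LessThan)

lemma fun_of_vec_vec: "supp n v \<Longrightarrow> fun_of_vec (vec n v) = v"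
  by (auto simp: supp_def fun_eq_iff)

lemma supp_fun_of_vec: "v \<in> carrier_vec n \<Longrightarrow> supp n (fun_of_vec v)"
  by (auto simp: supp_def)

lemma mult_mat_vec_vec:
  assumes "A \<in> carrier_mat m n" "supp n w"
  shows "A *\<^sub>v vec n w = vec m (mv A w)"
proof -
  have "A *\<^sub>v vec n w = vec m (mv A (fun_of_vec (vec n w)))"
    by (rule mult_mat_vec_via_mv[OF assms(1) vec_carrier])
  then show ?thesis by (simp only: fun_of_vec_vec[OF assms(2)])
qed

lemma vec_fun_of_vec: "v \<in> carrier_vec n \<Longrightarrow> vec n (fun_of_vec v) = v"
  by auto

lemma vec_inj: "supp n u \<Longrightarrow> supp n v \<Longrightarrow> vec n u = vec n v \<Longrightarrow> u = v"
  by (metis fun_of_vec_vec)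

lemma mat_range_iff:
  assumes "A \<in> carrier_mat m n" "supp m v"
  shows "vec m v \<in> mat_range A \<longleftrightarrow> (\<exists>w. supp n w \<and> mv A w = v)"
proof
  assume "vec m v \<in> mat_range A"
  then obtain w where w: "w \<in> carrier_vec n" "vec m v = A *\<^sub>v w" using assms by (auto simp: mat_range_def)
  then have "vec m v = vec m (mv A (fun_of_vec w))" using assms(1) mult_mat_vec_via_mv by metis
  then have "v = mv A (fun_of_vec w)" using vec_inj assms supp_mv by blast
  then show "\<exists>w. supp n w \<and> mv A w = v" using supp_fun_of_vec[OF w(1)] by metis
next
  assume "\<exists>w. supp n w \<and> mv A w = v"
  then obtain w where w: "supp n w" "mv A w = v" by blast
  have "vec m v = A *\<^sub>v vec n w"
    using mult_mat_vec_vec[OF assms(1) w(1)] w by simp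
  then show "vec m v \<in> mat_range A" using assms(1) by (auto simp: mat_range_def)
qed

lemma mat_range_subset: "A \<in> carrier_mat m n \<Longrightarrow> mat_range A \<subseteq> carrier_vec m"
  by (auto simp: mat_range_def)

lemma mat_kernel_iff:
  assumes "A \<in> carrier_mat m n" "supp n v"
  shows "vec n v \<in> mat_kernel A \<longleftrightarrow> mv A v = 0"
proof -
  have "A *\<^sub>v vec n v = vec m (mv A v)"
    by (rule mult_mat_vec_vec[OF assms])
  moreover have "0\<^sub>v m = vec m (0 :: nat \<Rightarrow> 'a)" by (auto simp: zero_vec_def)
  ultimately show ?thesis
    using assms(1) vec_inj[OF supp_mv[OF assms(1)] supp_0, of v] by (auto simp: mat_kernel_def)
qed

lemma range_eq_kernel_iff:
  assumes "A \<in> carrier_mat m n" "G \<in> carrier_mat l m"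
  shows "mat_range A = mat_kernel G \<longleftrightarrow>
    (\<forall>v. supp m v \<longrightarrow> (mv G v = 0 \<longleftrightarrow> (\<exists>w. supp n w \<and> mv A w = v)))"
proof
  assume "mat_range A = mat_kernel G"
  then show "\<forall>v. supp m v \<longrightarrow> (mv G v = 0 \<longleftrightarrow> (\<exists>w. supp n w \<and> mv A w = v))"
    using mat_range_iff[OF assms(1)] mat_kernel_iff[OF assms(2)] by blast
next
  assume *: "\<forall>v. supp m v \<longrightarrow> (mv G v = 0 \<longleftrightarrow> (\<exists>w. supp n w \<and> mv A w = v))"
  have "v \<in> mat_range A \<longleftrightarrow> v \<in> mat_kernel G" if "v \<in> carrier_vec m" for v
    using mat_range_iff[OF assms(1) supp_fun_of_vec[OF that]] mat_kernel_iff[OF assms(2) supp_fun_of_vec[OF that]]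
      *[rule_format, OF supp_fun_of_vec[OF that]] unfolding vec_fun_of_vec[OF that] by blast
  moreover have "mat_range A \<subseteq> carrier_vec m" by (rule mat_range_subset[OF assms(1)])
  moreover have "mat_kernel G \<subseteq> carrier_vec m" using assms(2) by (auto simp: mat_kernel_def)
  ultimately show "mat_range A = mat_kernel G" by blast
qed

lemma mat_inj_iff:
  assumes A: "A \<in> carrier_mat m n"
  shows "inj_on (\<lambda>v. A *\<^sub>v v) (carrier_vec (dim_col A)) \<longleftrightarrow> (\<forall>w. supp n w \<longrightarrow> mv A w = 0 \<longrightarrow> w = 0)"
proof
  assume inj: "inj_on (\<lambda>v. A *\<^sub>v v) (carrier_vec (dim_col A))"
  show "\<forall>w. supp n w \<longrightarrow> mv A w = 0 \<longrightarrow> w = 0"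
  proof (intro allI impI)
    fix w assume w: "supp n w" "mv A w = 0"
    have "A *\<^sub>v vec n w = A *\<^sub>v vec n 0"
      using mult_mat_vec_vec[OF A w(1)] mult_mat_vec_vec[OF A supp_0] w(2) by simp
    then have "vec n w = vec n 0" using inj A by (auto dest!: inj_onD)
    then show "w = 0" using vec_inj w(1) supp_0 by blast
  qed
next
  assume *: "\<forall>w. supp n w \<longrightarrow> mv A w = 0 \<longrightarrow> w = 0"
  show "inj_on (\<lambda>v. A *\<^sub>v v) (carrier_vec (dim_col A))"
  proof (rule inj_onI)
    fix u v assume uv: "u \<in> carrier_vec (dim_col A)" "v \<in> carrier_vec (dim_col A)" "A *\<^sub>v u = A *\<^sub>v v"
    then have c: "u \<in> carrier_vec n" "v \<in> carrier_vec n" using A by auto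
    have "mv A (fun_of_vec u) = mv A (fun_of_vec v)"
      using uv(3) c vec_inj[OF supp_mv[OF A] supp_mv[OF A]] by (simp add: mult_mat_vec_via_mv[OF A])
    then have "mv A (fun_of_vec u - fun_of_vec v) = 0" by (simp add: mv_diff)
    moreover have "supp n (fun_of_vec u - fun_of_vec v)" using c by (auto simp: supp_def)
    ultimately have "fun_of_vec u - fun_of_vec v = 0" using * by blast
    then have "fun_of_vec u = fun_of_vec v" by simp
    then have "vec n (fun_of_vec u) = vec n (fun_of_vec v)" by (rule arg_cong)
    then show "u = v" unfolding vec_fun_of_vec[OF c(1)] vec_fun_of_vec[OF c(2)] .
  qed
qed

lemma mat_surj_iff:
  assumes "A \<in> carrier_mat m n"
  shows "mat_range A = carrier_vec (dim_row A) \<longleftrightarrow> (\<forall>v. supp m v \<longrightarrow> (\<exists>w. supp n w \<and> mv A w = v))"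
proof
  assume "mat_range A = carrier_vec (dim_row A)"
  then show "\<forall>v. supp m v \<longrightarrow> (\<exists>w. supp n w \<and> mv A w = v)"
    using mat_range_iff[OF assms] assms by auto
next
  assume *: "\<forall>v. supp m v \<longrightarrow> (\<exists>w. supp n w \<and> mv A w = v)"
  have "v \<in> mat_range A" if "v \<in> carrier_vec m" for v
    using mat_range_iff[OF assms supp_fun_of_vec[OF that]] *[rule_format, OF supp_fun_of_vec[OF that]]
    unfolding vec_fun_of_vec[OF that] by blast
  then show "mat_range A = carrier_vec (dim_row A)" using mat_range_subset[OF assms] assms by auto
qed

lemma pm_mono_iff:
  assumes "f \<in> pm_hom M N"
  shows "pm_mono f \<longleftrightarrow> (\<forall>p w. supp (vdim M p) w \<longrightarrow> mv (f p) w = 0 \<longrightarrow> w = 0)"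
  unfolding pm_mono_def using mat_inj_iff[OF pm_hom_carrier[OF assms]] by blast

lemma pm_epi_iff:
  assumes "f \<in> pm_hom M N"
  shows "pm_epi f \<longleftrightarrow> (\<forall>p v. supp (vdim N p) v \<longrightarrow> (\<exists>w. supp (vdim M p) w \<and> mv (f p) w = v))"
  unfolding pm_epi_def using mat_surj_iff[OF pm_hom_carrier[OF assms]] by blast

lemma is_kernel_iff:
  "is_kernel M f N g L \<longleftrightarrow> is_pmod M \<and> is_pmod N \<and> is_pmod L \<and> f \<in> pm_hom M N \<and> g \<in> pm_hom N L \<and>
     (\<forall>p w. supp (vdim M p) w \<longrightarrow> mv (f p) w = 0 \<longrightarrow> w = 0) \<and>
     (\<forall>p v. supp (vdim N p) v \<longrightarrow> (mv (g p) v = 0 \<longleftrightarrow> (\<exists>w. supp (vdim M p) w \<and> mv (f p) w = v)))"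
proof (cases "f \<in> pm_hom M N \<and> g \<in> pm_hom N L")
  case True
  then have f: "f \<in> pm_hom M N" and g: "g \<in> pm_hom N L" by auto
  show ?thesis
    unfolding is_kernel_def pm_mono_iff[OF f] range_eq_kernel_iff[OF pm_hom_carrier[OF f] pm_hom_carrier[OF g]]
    by blast
qed (auto simp: is_kernel_def)

text \<open>At each point the kernel is spanned by the columns of an injective matrix B p. The structure maps of
  the ambient module preserve these column spaces, which gives the structure maps of the kernel; since B is
  injective it can be cancelled, so they inherit functoriality.\<close>

lemma kernel_exists:
  fixes M N :: "('p::order, 'k::field) pmod"
  assumes M: "is_pmod M" and N: "is_pmod N" and g: "g \<in> pm_hom M N"
  obtains Z i where "is_kernel Z i M g N"
proof -
  have "\<exists>k B. B \<in> carrier_mat (vdim M p) k \<and> (\<forall>w. supp k w \<longrightarrow> mv B w = 0 \<longrightarrow> w = 0) \<and>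
      (\<forall>v. supp (vdim M p) v \<longrightarrow> (mv (g p) v = 0 \<longleftrightarrow> (\<exists>w. supp k w \<and> mv B w = v)))" for p
    using kernel_mat_exists[OF pm_hom_carrier[OF g]] by metis
  then obtain k B where B: "\<And>p. B p \<in> carrier_mat (vdim M p) (k p)"
    "\<And>p w. supp (k p) w \<Longrightarrow> mv (B p) w = 0 \<Longrightarrow> w = 0"
    "\<And>p v. supp (vdim M p) v \<Longrightarrow> (mv (g p) v = 0 \<longleftrightarrow> (\<exists>w. supp (k p) w \<and> mv (B p) w = v))" by metis
  have cancel: "T = T'" if "T \<in> carrier_mat (k p) n" "T' \<in> carrier_mat (k p) n" "B p * T = B p * T'" for p n and T T' :: "'k mat"
  proof (rule mat_eq_by_mv[OF that(1,2)])
    fix v :: "nat \<Rightarrow> 'k"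
    have "mv (B p) (mv T v) = mv (B p) (mv T' v)"
      using mv_mult[OF B(1) that(1), where v = v] mv_mult[OF B(1) that(2), where v = v] that(3) by simp
    then have "mv (B p) (mv T v - mv T' v) = 0" by (simp add: mv_diff)
    moreover have "supp (k p) (mv T v - mv T' v)"
      using supp_mv[OF that(1), where v = v] supp_mv[OF that(2), where v = v] by (auto simp: supp_def)
    ultimately have "mv T v - mv T' v = 0" using B(2) by blast
    then show "mv T v = mv T' v" by simp
  qed
  have factor: "\<exists>T. T \<in> carrier_mat (k q) (k p) \<and> B q * T = tmap M p q * B p" if pq: "p \<le> q" for p q
  proof -
    have c: "tmap M p q * B p \<in> carrier_mat (vdim M q) (k p)"
      using pmod_carrier[OF M pq] B(1) by (rule mult_carrier_mat)
    have "\<exists>w. supp (k q) w \<and> mv (B q) w = mv (tmap M p q * B p) v" if v: "supp (k p) v" for v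
    proof -
      have "mv (g p) (mv (B p) v) = 0"
        using B(3)[OF supp_mv[OF B(1)[of p], of v]] v by blast
      then have "mv (g q) (mv (tmap M p q) (mv (B p) v)) = 0"
        using pm_hom_mv[OF M N g pq] by simp
      then show ?thesis
        using B(3)[OF supp_mv[OF c], of v] mv_mult[OF pmod_carrier[OF M pq] B(1), where v = v] by simp
    qed
    then show ?thesis using mat_factor[OF B(1) c] by metis
  qed
  have "\<forall>p q. \<exists>T. p \<le> q \<longrightarrow> T \<in> carrier_mat (k q) (k p) \<and> B q * T = tmap M p q * B p"
    using factor by blast
  then have "\<exists>T. \<forall>p q. p \<le> q \<longrightarrow> T p q \<in> carrier_mat (k q) (k p) \<and> B q * T p q = tmap M p q * B p"
    unfolding choice_iff .
  then obtain T where T': "\<forall>p q. p \<le> q \<longrightarrow> T p q \<in> carrier_mat (k q) (k p) \<and> B q * T p q = tmap M p q * B p" ..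
  have T: "\<And>p q. p \<le> q \<Longrightarrow> T p q \<in> carrier_mat (k q) (k p)"
    "\<And>p q. p \<le> q \<Longrightarrow> B q * T p q = tmap M p q * B p"
    by (rule T'[rule_format, THEN conjunct1], assumption) (rule T'[rule_format, THEN conjunct2], assumption)
  let ?Z = "\<lparr>vdim = k, tmap = T\<rparr>"
  have Z: "is_pmod ?Z"
    unfolding is_pmod_def pmod.select_convs
  proof (intro conjI allI impI)
    show "T p p = 1\<^sub>m (k p)" for p
      using T[of p p] B(1)[of p] pmod_id[OF M, of p] by - (rule cancel, auto)
    show "T p r = T q r * T p q" if "p \<le> q" "q \<le> r" for p q r
    proof (rule cancel)
      have pr: "p \<le> r" using that by simp
      have "B r * (T q r * T p q) = tmap M q r * B q * T p q"
        using assoc_mult_mat[OF B(1) T(1)[OF that(2)] T(1)[OF that(1)]] T(2)[OF that(2)] by simp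
      also have "\<dots> = tmap M q r * (tmap M p q * B p)"
        using assoc_mult_mat[OF pmod_carrier[OF M that(2)] B(1) T(1)[OF that(1)]] T(2)[OF that(1)] by simp
      also have "\<dots> = tmap M p r * B p"
        using assoc_mult_mat[OF pmod_carrier[OF M that(2)] pmod_carrier[OF M that(1)] B(1)]
          pmod_comp[OF M that] by simp
      finally show "B r * T p r = B r * (T q r * T p q)" using T(2)[OF pr] by simp
    qed (use T(1)[OF order_trans[OF that]] mult_carrier_mat[OF T(1)[OF that(2)] T(1)[OF that(1)]] in auto)
  qed (use T(1) in auto)
  have "B \<in> pm_hom ?Z M"
    unfolding pm_hom_def using B(1) T(2) by auto
  then have "is_kernel ?Z B M g N"
    unfolding is_kernel_iff using Z M N g B by auto
  then show ?thesis by (rule that)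
qed

text \<open>A surjective square matrix is invertible, and the pointwise inverse of a natural family is
  natural.\<close>

lemma pm_isomorphism_if_surj:
  assumes M: "is_pmod M" and g: "g \<in> pm_hom M M" and epi: "pm_epi g"
  shows "pm_isomorphism M M g"
proof -
  note c = pm_hom_carrier[OF g]
  have "\<exists>B. B \<in> carrier_mat (vdim M p) (vdim M p) \<and> g p * B = 1\<^sub>m (vdim M p)" for p
  proof -
    have "\<exists>w. supp (vdim M p) w \<and> mv (g p) w = mv (1\<^sub>m (vdim M p)) v" if "supp (vdim M p) v" for v
      using epi that unfolding pm_epi_iff[OF g] by (simp add: mv_one)
    then show ?thesis using mat_factor[OF c one_carrier_mat] by metis
  qed
  then obtain h where h: "\<And>p. h p \<in> carrier_mat (vdim M p) (vdim M p)" "\<And>p. g p * h p = 1\<^sub>m (vdim M p)" by metis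
  have h': "h p * g p = 1\<^sub>m (vdim M p)" for p
    using mat_mult_left_right_inverse[OF c h(1) h(2)] .
  have "h q * tmap M p q = tmap M p q * h p" if pq: "p \<le> q" for p q
  proof -
    note t = pmod_carrier[OF M pq]
    have "h q * tmap M p q = h q * (tmap M p q * (g p * h p))" using h(2)[of p] t by simp
    also have "\<dots> = h q * ((tmap M p q * g p) * h p)" using assoc_mult_mat[OF t c h(1)] by simp
    also have "\<dots> = h q * ((g q * tmap M p q) * h p)" using g pq by (simp add: pm_hom_def)
    also have "\<dots> = h q * (g q * (tmap M p q * h p))" using assoc_mult_mat[OF c t h(1)] by simp
    also have "\<dots> = (h q * g q) * (tmap M p q * h p)"
      using assoc_mult_mat[OF h(1) c mult_carrier_mat[OF t h(1)]] by simp
    also have "\<dots> = tmap M p q * h p" using h' t h(1)[of p] by simp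
    finally show ?thesis .
  qed
  then have "h \<in> pm_hom M M" using h(1) by (auto simp: pm_hom_def)
  then show ?thesis unfolding pm_isomorphism_def
    using g h(2) h' by (auto simp: pm_comp_def pm_id_def fun_eq_iff intro!: bexI[of _ h])
qed

section \<open>Direct sums\<close>

lemma sum_lessThan_add: "(\<Sum>j<a + b. f j) = (\<Sum>j<a. f j) + (\<Sum>j<b. f (a + j :: nat))"
  for f :: "nat \<Rightarrow> 'c::comm_monoid_add"
  by (induction b) (auto simp: add.assoc)

definition dsum_inl :: "('p, 'k::field) pmod \<Rightarrow> ('p, 'k) pmod \<Rightarrow> 'p \<Rightarrow> 'k mat" where
  "dsum_inl M N p = mat (vdim M p + vdim N p) (vdim M p) (\<lambda>(i, j). if i = j then 1 else 0)"
definition dsum_inr :: "('p, 'k::field) pmod \<Rightarrow> ('p, 'k) pmod \<Rightarrow> 'p \<Rightarrow> 'k mat" where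
  "dsum_inr M N p = mat (vdim M p + vdim N p) (vdim N p) (\<lambda>(i, j). if i = vdim M p + j then 1 else 0)"
definition dsum_fst :: "('p, 'k::field) pmod \<Rightarrow> ('p, 'k) pmod \<Rightarrow> 'p \<Rightarrow> 'k mat" where
  "dsum_fst M N p = mat (vdim M p) (vdim M p + vdim N p) (\<lambda>(i, j). if i = j then 1 else 0)"
definition dsum_snd :: "('p, 'k::field) pmod \<Rightarrow> ('p, 'k) pmod \<Rightarrow> 'p \<Rightarrow> 'k mat" where
  "dsum_snd M N p = mat (vdim N p) (vdim M p + vdim N p) (\<lambda>(i, j). if j = vdim M p + i then 1 else 0)"
definition dsum_copair ::
  "('p, 'k::field) pmod \<Rightarrow> ('p, 'k) pmod \<Rightarrow> ('p \<Rightarrow> 'k mat) \<Rightarrow> ('p \<Rightarrow> 'k mat) \<Rightarrow> 'p \<Rightarrow> 'k mat" where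
  "dsum_copair M N f g p = mat (dim_row (f p)) (vdim M p + vdim N p)
     (\<lambda>(i, j). if j < vdim M p then f p $$ (i, j) else g p $$ (i, j - vdim M p))"

lemma vdim_dsum [simp]: "vdim (pm_dsum M N) p = vdim M p + vdim N p"
  by (simp add: pm_dsum_def)

lemma is_pmod_dsum:
  assumes M: "is_pmod M" and N: "is_pmod N" shows "is_pmod (pm_dsum M N)"
proof -
  have "four_block_mat (tmap M q r) (0\<^sub>m (vdim M r) (vdim N q)) (0\<^sub>m (vdim N r) (vdim M q)) (tmap N q r) *
    four_block_mat (tmap M p q) (0\<^sub>m (vdim M q) (vdim N p)) (0\<^sub>m (vdim N q) (vdim M p)) (tmap N p q) =
    four_block_mat (tmap M p r) (0\<^sub>m (vdim M r) (vdim N p)) (0\<^sub>m (vdim N r) (vdim M p)) (tmap N p r)"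
    if pq: "p \<le> q" and qr: "q \<le> r" for p q r
  proof -
    note c = pmod_carrier[OF M pq] pmod_carrier[OF M qr] pmod_carrier[OF N pq] pmod_carrier[OF N qr]
    have t: "tmap M p r = tmap M q r * tmap M p q" "tmap N p r = tmap N q r * tmap N p q"
      by (rule pmod_comp[OF M pq qr], rule pmod_comp[OF N pq qr])
    show ?thesis
      using c by (subst mult_four_block_mat[OF c(2) zero_carrier_mat zero_carrier_mat c(4) c(1) zero_carrier_mat zero_carrier_mat c(3)])
        (simp add: t)
  qed
  then show ?thesis
    using pmod_carrier[OF M] pmod_carrier[OF N] pmod_id[OF M] pmod_id[OF N]
    unfolding is_pmod_def pm_dsum_def pmod.select_convs by (intro conjI allI impI) (auto simp: four_block_one_mat)
qed

lemma mv_dsum_tmap: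
  assumes "tmap M p q \<in> carrier_mat (vdim M q) (vdim M p)" "tmap N p q \<in> carrier_mat (vdim N q) (vdim N p)"
  shows "mv (tmap (pm_dsum M N) p q) v =
    (\<lambda>i. if i < vdim M q then mv (tmap M p q) v i
         else mv (tmap N p q) (\<lambda>j. v (vdim M p + j)) (i - vdim M q))"
  using assms by (auto simp: fun_eq_iff pm_dsum_def mv_def sum_lessThan_add)

lemma mv_dsum_inl: "supp (vdim M p) v \<Longrightarrow> mv (dsum_inl M N p) v = v"
  by (auto simp: dsum_inl_def mv_def fun_eq_iff supp_def if_distrib[of "\<lambda>t. t * _"] cong: if_cong)

lemma mv_dsum_inr:
  "supp (vdim N p) v \<Longrightarrow> mv (dsum_inr M N p) v = (\<lambda>i. if i < vdim M p then 0 else v (i - vdim M p))"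
proof -
  assume v: "supp (vdim N p) v"
  have "(\<Sum>j<vdim N p. (if i = vdim M p + j then 1 else 0) * v j) = v (i - vdim M p)"
    if "\<not> i < vdim M p" "i < vdim M p + vdim N p" for i
  proof -
    have "(\<Sum>j<vdim N p. (if i = vdim M p + j then 1 else 0) * v j) = (\<Sum>j<vdim N p. if j = i - vdim M p then v j else 0)"
      using that by (intro sum.cong) auto
    then show ?thesis using that by simp
  qed
  then show ?thesis using v
    by (auto simp: dsum_inr_def mv_def fun_eq_iff supp_def)
qed

lemma mv_dsum_fst: "mv (dsum_fst M N p) v = (\<lambda>i. if i < vdim M p then v i else 0)"
  by (auto simp: dsum_fst_def mv_def fun_eq_iff if_distrib[of "\<lambda>t. t * _"] cong: if_cong)

lemma mv_dsum_snd: "mv (dsum_snd M N p) v = (\<lambda>i. if i < vdim N p then v (vdim M p + i) else 0)"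
  by (auto simp: dsum_snd_def mv_def fun_eq_iff if_distrib[of "\<lambda>t. t * _"] cong: if_cong)

lemma mv_cong: "A \<in> carrier_mat m n \<Longrightarrow> (\<And>j. j < n \<Longrightarrow> u j = v j) \<Longrightarrow> mv A u = mv A v"
  by (auto simp: mv_def)

lemma mv_outside: "A \<in> carrier_mat m n \<Longrightarrow> \<not> i < m \<Longrightarrow> mv A u i = 0"
  by (auto simp: mv_def)

lemma mv_dsum_copair:
  assumes "f \<in> pm_hom M L" "g \<in> pm_hom N L"
  shows "mv (dsum_copair M N f g p) v = mv (f p) (mv (dsum_fst M N p) v) + mv (g p) (mv (dsum_snd M N p) v)"
  using pm_hom_carrier[OF assms(1), of p] pm_hom_carrier[OF assms(2), of p]
  by (auto simp: fun_eq_iff dsum_copair_def mv_def[of "mat _ _ _"] mv_def[of "f p"] mv_def[of "g p"] mv_dsum_fst mv_dsum_snd sum_lessThan_add)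

lemma dsum_decompose:
  assumes "supp (vdim M p + vdim N p) v"
  shows "mv (dsum_inl M N p) (mv (dsum_fst M N p) v) + mv (dsum_inr M N p) (mv (dsum_snd M N p) v) = v"
proof -
  have "supp (vdim M p) (mv (dsum_fst M N p) v)" "supp (vdim N p) (mv (dsum_snd M N p) v)"
    by (auto simp: supp_def mv_dsum_fst mv_dsum_snd)
  then show ?thesis using assms
    by (auto simp: fun_eq_iff mv_dsum_inl mv_dsum_inr mv_dsum_fst mv_dsum_snd supp_def)
qed

lemma dsum_relations:
  "supp (vdim M p) v \<Longrightarrow> mv (dsum_fst M N p) (mv (dsum_inl M N p) v) = v"
  "supp (vdim M p) v \<Longrightarrow> mv (dsum_snd M N p) (mv (dsum_inl M N p) v) = 0"
  "supp (vdim N p) w \<Longrightarrow> mv (dsum_fst M N p) (mv (dsum_inr M N p) w) = 0"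
  "supp (vdim N p) w \<Longrightarrow> mv (dsum_snd M N p) (mv (dsum_inr M N p) w) = w"
  by (auto simp: fun_eq_iff mv_dsum_inl mv_dsum_inr mv_dsum_fst mv_dsum_snd supp_def)

context
  fixes M N :: "('p::order, 'k::field) pmod"
  assumes M: "is_pmod M" and N: "is_pmod N"
begin

lemma dsum_inl_hom: "dsum_inl M N \<in> pm_hom M (pm_dsum M N)"
proof (rule pm_homI[OF M is_pmod_dsum[OF M N]])
  fix p q :: 'p and v :: "nat \<Rightarrow> 'k" assume pq: "p \<le> q" and v: "supp (vdim M p) v"
  have "mv (tmap N p q) (\<lambda>j. v (vdim M p + j)) = 0"
    using v pmod_carrier[OF N pq] by (auto simp: supp_def mv_def fun_eq_iff)
  then show "mv (dsum_inl M N q) (mv (tmap M p q) v) = mv (tmap (pm_dsum M N) p q) (mv (dsum_inl M N p) v)"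
    using v pq pmod_carrier[OF M pq] supp_mv[OF pmod_carrier[OF M pq]]
    by (auto simp: mv_dsum_inl mv_dsum_tmap pmod_carrier[OF M] pmod_carrier[OF N] fun_eq_iff supp_def)
qed (auto simp: dsum_inl_def)

lemma dsum_inr_hom: "dsum_inr M N \<in> pm_hom N (pm_dsum M N)"
proof (rule pm_homI[OF N is_pmod_dsum[OF M N]])
  fix p q :: 'p and v :: "nat \<Rightarrow> 'k" assume pq: "p \<le> q" and v: "supp (vdim N p) v"
  have "mv (tmap M p q) (\<lambda>i. if i < vdim M p then 0 else v (i - vdim M p)) = 0"
    using pmod_carrier[OF M pq] by (auto simp: mv_def fun_eq_iff)
  then show "mv (dsum_inr M N q) (mv (tmap N p q) v) = mv (tmap (pm_dsum M N) p q) (mv (dsum_inr M N p) v)"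
    using v pq supp_mv[OF pmod_carrier[OF N pq]]
    by (auto simp: mv_dsum_inr mv_dsum_tmap pmod_carrier[OF M] pmod_carrier[OF N] fun_eq_iff)
qed (auto simp: dsum_inr_def)

lemma dsum_fst_hom: "dsum_fst M N \<in> pm_hom (pm_dsum M N) M"
proof (rule pm_homI[OF is_pmod_dsum[OF M N] M])
  fix p q :: 'p and v :: "nat \<Rightarrow> 'k" assume pq: "p \<le> q"
  have "mv (tmap M p q) (\<lambda>i. if i < vdim M p then v i else 0) = mv (tmap M p q) v"
    by (rule mv_cong[OF pmod_carrier[OF M pq]]) auto
  then show "mv (dsum_fst M N q) (mv (tmap (pm_dsum M N) p q) v) = mv (tmap M p q) (mv (dsum_fst M N p) v)"
    using mv_outside[OF pmod_carrier[OF M pq]]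
    by (auto simp: mv_dsum_fst mv_dsum_tmap pmod_carrier[OF M pq] pmod_carrier[OF N pq] fun_eq_iff)
qed (auto simp: dsum_fst_def)

lemma dsum_snd_hom: "dsum_snd M N \<in> pm_hom (pm_dsum M N) N"
proof (rule pm_homI[OF is_pmod_dsum[OF M N] N])
  fix p q :: 'p and v :: "nat \<Rightarrow> 'k" assume pq: "p \<le> q"
  have "mv (tmap N p q) (\<lambda>i. if i < vdim N p then v (vdim M p + i) else 0) = mv (tmap N p q) (\<lambda>i. v (vdim M p + i))"
    by (rule mv_cong[OF pmod_carrier[OF N pq]]) auto
  then show "mv (dsum_snd M N q) (mv (tmap (pm_dsum M N) p q) v) = mv (tmap N p q) (mv (dsum_snd M N p) v)"
    using mv_outside[OF pmod_carrier[OF N pq]]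
    by (auto simp: mv_dsum_snd mv_dsum_tmap pmod_carrier[OF M pq] pmod_carrier[OF N pq] fun_eq_iff)
qed (auto simp: dsum_snd_def)

lemma dsum_copair_hom:
  assumes L: "is_pmod L" and f: "f \<in> pm_hom M L" and g: "g \<in> pm_hom N L"
  shows "dsum_copair M N f g \<in> pm_hom (pm_dsum M N) L"
proof (rule pm_homI[OF is_pmod_dsum[OF M N] L])
  show "dsum_copair M N f g p \<in> carrier_mat (vdim L p) (vdim (pm_dsum M N) p)" for p
    using pm_hom_carrier[OF f, of p] by (simp add: dsum_copair_def)
  fix p q :: 'p and v :: "nat \<Rightarrow> 'k" assume pq: "p \<le> q"
  show "mv (dsum_copair M N f g q) (mv (tmap (pm_dsum M N) p q) v) = mv (tmap L p q) (mv (dsum_copair M N f g p) v)"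
    by (simp add: mv_dsum_copair[OF f g] mv_add pm_hom_mv[OF is_pmod_dsum[OF M N] M dsum_fst_hom pq]
        pm_hom_mv[OF is_pmod_dsum[OF M N] N dsum_snd_hom pq] pm_hom_mv[OF M L f pq] pm_hom_mv[OF N L g pq])
qed

end

lemma is_pmod_zero [simp]: "is_pmod zero_pmod"
  by (auto simp: is_pmod_def zero_pmod_def intro!: eq_matI)

lemma is_pmod_foldr_dsum: "(\<And>Y. Y \<in> set Ys \<Longrightarrow> is_pmod Y) \<Longrightarrow> is_pmod (foldr pm_dsum Ys zero_pmod)"
  by (induction Ys) (auto intro: is_pmod_dsum)

section \<open>Morphisms out of spread modules as sections\<close>

lemma curry_add [simp]: "curry (s + t) p = curry s p + curry t p"
  by (auto simp: fun_eq_iff)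
lemma curry_diff [simp]: "curry (s - t) p = curry s p - curry t p"
  by (auto simp: fun_eq_iff)
lemma curry_fscale [simp]: "curry (fscale c s) p = fscale c (curry s p)"
  by (auto simp: fun_eq_iff)
lemma curry_0 [simp]: "curry 0 p = 0"
  by (auto simp: fun_eq_iff)

lemma eq_by_curry: "(\<And>p. curry s p = curry t p) \<Longrightarrow> s = t"
  by (metis (no_types, lifting) curry_conv ext surj_pair)

text \<open>The action of a morphism on families of vectors, one at each point of the poset; the pair (p, i) stands
  for the i-th coordinate at p.\<close>

definition act :: "('p \<Rightarrow> 'k::field mat) \<Rightarrow> ('p \<times> nat \<Rightarrow> 'k) \<Rightarrow> 'p \<times> nat \<Rightarrow> 'k" where
  "act g s = (\<lambda>(p, i). mv (g p) (curry s p) i)"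

lemma curry_act [simp]: "curry (act g s) p = mv (g p) (curry s p)"
  by (auto simp: act_def fun_eq_iff)

lemma act_linear: "flinear (act g)"
  by (rule flinearI) (auto intro!: eq_by_curry simp: mv_add mv_scale simp del: curry_conv)

lemmas act_diff = fvp.linear_diff[OF act_linear]
  and act_scale = fvp.linear_scale[OF act_linear]
  and act_0 = fvp.linear_0[OF act_linear]
  and act_sum = fvp.linear_sum[OF act_linear]

definition restr :: "'p set \<Rightarrow> ('p \<times> nat \<Rightarrow> 'k::field) \<Rightarrow> 'p \<times> nat \<Rightarrow> 'k" where
  "restr S s = (\<lambda>(p, i). if p \<in> S then s (p, i) else 0)"

lemma curry_restr [simp]: "curry (restr S s) p = (if p \<in> S then curry s p else 0)"
  by (auto simp: restr_def fun_eq_iff)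

lemma restr_linear: "flinear (restr S)"
  by (rule flinearI) (auto simp: restr_def fun_eq_iff)

lemma act_restr: "act g (restr S s) = restr S (act g s)"
  by (rule eq_by_curry) simp

text \<open>The generator of the spread module on S, which at every point of S is the basis vector.\<close>

definition unit_sec :: "'p set \<Rightarrow> 'p \<times> nat \<Rightarrow> 'k::field" where
  "unit_sec S = (\<lambda>(p, i). if p \<in> S \<and> i = 0 then 1 else 0)"

lemma curry_unit_sec: "curry (unit_sec S) p = (\<lambda>i. if p \<in> S \<and> i = 0 then 1 else 0)"
  by (auto simp: unit_sec_def fun_eq_iff)

lemma restr_unit_sec: "restr S (unit_sec T) = unit_sec (S \<inter> T)"
  by (auto simp: restr_def unit_sec_def fun_eq_iff)

text \<open>These families are the morphisms from the spread module on S to M, recorded by the image of the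
  generator: a vector of M at each point of S, transported along the structure maps inside S and killed by the
  structure maps that leave S. All Hom spaces out of spread modules are handled in this form.\<close>

definition sections :: "'p::order set \<Rightarrow> ('p, 'k::field) pmod \<Rightarrow> ('p \<times> nat \<Rightarrow> 'k) set" where
  "sections S M = {s. (\<forall>p. supp (vdim M p) (curry s p)) \<and> (\<forall>p. p \<notin> S \<longrightarrow> curry s p = 0) \<and>
     (\<forall>p q. p \<in> S \<longrightarrow> p \<le> q \<longrightarrow> mv (tmap M p q) (curry s p) = curry s q)}"

lemma sectionsI:
  assumes "\<And>p. supp (vdim M p) (curry s p)" "\<And>p. p \<notin> S \<Longrightarrow> curry s p = 0"
    "\<And>p q. p \<in> S \<Longrightarrow> p \<le> q \<Longrightarrow> mv (tmap M p q) (curry s p) = curry s q"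
  shows "s \<in> sections S M"
  using assms unfolding sections_def by blast

lemma sectionsD:
  assumes "s \<in> sections S M"
  shows "supp (vdim M p) (curry s p)" "p \<notin> S \<Longrightarrow> curry s p = 0"
    "p \<in> S \<Longrightarrow> p \<le> q \<Longrightarrow> mv (tmap M p q) (curry s p) = curry s q"
  using assms unfolding sections_def by blast+

lemma subspace_sections: "fvs.subspace (sections S M)"
proof (rule fvs.subspaceI)
  show "0 \<in> sections S M" by (rule sectionsI) (simp_all del: curry_conv)
next
  fix s t assume s: "s \<in> sections S M" and t: "t \<in> sections S M"
  show "s + t \<in> sections S M"
  proof (rule sectionsI)
    show "supp (vdim M p) (curry (s + t) p)" for p
      using sectionsD(1)[OF s, of p] sectionsD(1)[OF t, of p] by (simp add: supp_def)
  qed (simp_all add: sectionsD[OF s] sectionsD[OF t] mv_add del: curry_conv)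
next
  fix c s assume s: "s \<in> sections S M"
  show "fscale c s \<in> sections S M"
  proof (rule sectionsI)
    show "supp (vdim M p) (curry (fscale c s) p)" for p
      using sectionsD(1)[OF s, of p] by (simp add: supp_def)
  qed (simp_all add: sectionsD[OF s] mv_scale del: curry_conv)
qed

lemma sections_zero: "0 \<in> sections S M"
  by (rule fvs.subspace_0[OF subspace_sections])

lemma sections_support:
  fixes M :: "('p::{finite, order}, 'k::field) pmod"
  shows "finite (Sigma UNIV (\<lambda>p. {..<vdim M p}))"
    "s \<in> sections S M \<Longrightarrow> x \<notin> Sigma UNIV (\<lambda>p. {..<vdim M p}) \<Longrightarrow> s x = 0"
proof -
  show "s \<in> sections S M \<Longrightarrow> x \<notin> Sigma UNIV (\<lambda>p. {..<vdim M p}) \<Longrightarrow> s x = 0"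
    using sectionsD(1)[of s S M "fst x"] by (cases x) (auto simp: supp_def)
qed simp

lemma act_sections:
  assumes "is_pmod M" "is_pmod N" "f \<in> pm_hom M N" "s \<in> sections S M"
  shows "act f s \<in> sections S N"
  by (rule sectionsI)
    (simp_all add: sectionsD[OF assms(4)] supp_mv[OF pm_hom_carrier[OF assms(3)]] pm_hom_mv[OF assms(1-3), symmetric]
      del: curry_conv)

lemma act_pm_comp:
  "g \<in> pm_hom N L \<Longrightarrow> f \<in> pm_hom M N \<Longrightarrow> act (pm_comp g f) s = act g (act f s)"
  by (rule eq_by_curry) (simp add: mv_pm_comp del: curry_conv)

lemma act_pm_id: "s \<in> sections S M \<Longrightarrow> act (pm_id M) s = s"
  by (rule eq_by_curry) (simp add: pm_id_def mv_one sectionsD del: curry_conv)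

definition order_convex :: "'p::order set \<Rightarrow> bool" where
  "order_convex S \<longleftrightarrow> (\<forall>p\<in>S. \<forall>r\<in>S. \<forall>q. p \<le> q \<longrightarrow> q \<le> r \<longrightarrow> q \<in> S)"

lemma vdim_spread [simp]: "vdim (spread_module S) p = (if p \<in> S then 1 else 0)"
  by (simp add: spread_module_def)

lemma mv_spread_tmap:
  "mv (tmap (spread_module S) p q) v = (\<lambda>i. if p \<in> S \<and> q \<in> S \<and> i = 0 then v 0 else 0)"
  by (auto simp: spread_module_def mv_def fun_eq_iff)

lemma spread_tmap_carrier:
  "tmap (spread_module S) p q \<in> carrier_mat (vdim (spread_module S) q) (vdim (spread_module S) p)"
  by (simp add: spread_module_def)

text \<open>Convexity is what makes composition work: otherwise a composite through a point outside S would
  vanish while the direct structure map is the identity.\<close>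

lemma is_pmod_spread:
  assumes "order_convex S" shows "is_pmod (spread_module S :: ('p::order, 'k::field) pmod)"
proof -
  let ?M = "spread_module S :: ('p::order, 'k::field) pmod"
  have "tmap ?M p r = tmap ?M q r * tmap ?M p q" if "p \<le> q" "q \<le> r" for p q r
  proof (rule mat_eq_by_mv)
    have q: "q \<in> S" if "p \<in> S" "r \<in> S"
      using assms \<open>p \<le> q\<close> \<open>q \<le> r\<close> that unfolding order_convex_def by blast
    show "tmap ?M p r \<in> carrier_mat (vdim ?M r) (vdim ?M p)"
      "tmap ?M q r * tmap ?M p q \<in> carrier_mat (vdim ?M r) (vdim ?M p)"
      by (rule spread_tmap_carrier, rule mult_carrier_mat, rule spread_tmap_carrier, rule spread_tmap_carrier)
    fix v :: "nat \<Rightarrow> 'k"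
    have "mv (tmap ?M q r * tmap ?M p q) v = mv (tmap ?M q r) (mv (tmap ?M p q) v)"
      by (rule mv_mult[OF spread_tmap_carrier spread_tmap_carrier])
    then show "mv (tmap ?M p r) v = mv (tmap ?M q r * tmap ?M p q) v"
      using q by (simp only: mv_spread_tmap fun_eq_iff) auto
  qed
  note comp = this
  have id: "tmap ?M p p = 1\<^sub>m (vdim ?M p)" for p by (auto simp: spread_module_def)
  show ?thesis unfolding is_pmod_def
    by (intro conjI allI impI) (rule spread_tmap_carrier, rule id, rule comp)
qed

lemma unit_sec_sections: "unit_sec S \<in> sections S (spread_module S)"
  by (rule sectionsI) (auto simp: curry_unit_sec mv_spread_tmap supp_def fun_eq_iff simp del: curry_conv)

definition hom_of :: "'p::order set \<Rightarrow> ('p, 'k::field) pmod \<Rightarrow> ('p \<times> nat \<Rightarrow> 'k) \<Rightarrow> 'p \<Rightarrow> 'k mat" where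
  "hom_of S M s p = mat (vdim M p) (if p \<in> S then 1 else 0) (\<lambda>(i, j). s (p, i))"

lemma mv_hom_of:
  assumes "s \<in> sections S M" "p \<in> S \<or> v 0 = 0"
  shows "mv (hom_of S M s p) v = fscale (v 0) (curry s p)"
proof (cases "p \<in> S")
  case True
  then show ?thesis using sectionsD(1)[OF assms(1), of p]
    by (auto simp: hom_of_def mv_def fun_eq_iff supp_def)
next
  case False
  then show ?thesis using assms(2) by (auto simp: hom_of_def mv_def fun_eq_iff)
qed

lemma hom_of_hom:
  assumes S: "order_convex S" and M: "is_pmod M" and s: "s \<in> sections S M"
  shows "hom_of S M s \<in> pm_hom (spread_module S) M"
proof (rule pm_homI[OF is_pmod_spread[OF S] M])
  fix p q and v :: "nat \<Rightarrow> 'b" assume pq: "p \<le> q" and v: "supp (vdim (spread_module S :: ('a, 'b) pmod) p) v"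
  show "mv (hom_of S M s q) (mv (tmap (spread_module S) p q) v) = mv (tmap M p q) (mv (hom_of S M s p) v)"
  proof (cases "p \<in> S")
    case True
    then show ?thesis
      using sectionsD(2,3)[OF s] pq by (cases "q \<in> S") (simp_all add: mv_spread_tmap mv_hom_of[OF s] mv_scale del: curry_conv)
  next
    case False
    then have "v = 0" using v by simp
    then show ?thesis by simp
  qed
qed (simp add: hom_of_def)

lemma act_hom_of:
  assumes s: "s \<in> sections S M" shows "act (hom_of S M s) (unit_sec S) = s"
proof (rule eq_by_curry)
  fix p
  show "curry (act (hom_of S M s) (unit_sec S)) p = curry s p"
    using sectionsD(2)[OF s, of p] by (cases "p \<in> S") (simp_all add: mv_hom_of[OF s] curry_unit_sec fun_eq_iff)
qed

lemma spread_hom_ext: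
  assumes "f \<in> pm_hom (spread_module S) M" "g \<in> pm_hom (spread_module S) M"
    and "act f (unit_sec S) = act g (unit_sec S)"
  shows "f = g"
proof (rule pm_hom_ext[OF assms(1,2)])
  fix p and v :: "nat \<Rightarrow> 'b" assume v: "supp (vdim (spread_module S :: ('a, 'b) pmod) p) v"
  have vv: "v = fscale (v 0) (curry (unit_sec S) p)"
    using v by (auto simp: fun_eq_iff curry_unit_sec supp_def simp del: curry_conv split: if_splits)
  have "mv (f p) (curry (unit_sec S) p) = mv (g p) (curry (unit_sec S) p)"
    using arg_cong[OF assms(3), of "\<lambda>s. curry s p"] by (simp del: curry_conv)
  then show "mv (f p) v = mv (g p) v" by (subst (1 2) vv) (simp only: mv_scale)
qed

text \<open>Lifting morphisms out of a spread module through g is surjectivity of g on sections. This turns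
  relative exactness and approximations into linear algebra.\<close>

lemma lift_spread_iff:
  assumes S: "order_convex S" and N: "is_pmod N" and L: "is_pmod L" and g: "g \<in> pm_hom N L"
  shows "(\<forall>h\<in>pm_hom (spread_module S) L. \<exists>k\<in>pm_hom (spread_module S) N. pm_comp g k = h) \<longleftrightarrow>
    sections S L \<subseteq> act g ` sections S N"
proof
  assume *: "\<forall>h\<in>pm_hom (spread_module S) L. \<exists>k\<in>pm_hom (spread_module S) N. pm_comp g k = h"
  show "sections S L \<subseteq> act g ` sections S N"
  proof
    fix s assume s: "s \<in> sections S L"
    obtain k where k: "k \<in> pm_hom (spread_module S) N" "pm_comp g k = hom_of S L s"
      using * hom_of_hom[OF S L s] by blast
    have "act g (act k (unit_sec S)) = s"
      using act_pm_comp[OF g k(1), of "unit_sec S"] k(2) act_hom_of[OF s] by simp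
    moreover have "act k (unit_sec S) \<in> sections S N"
      using act_sections[OF is_pmod_spread[OF S] N k(1) unit_sec_sections] .
    ultimately show "s \<in> act g ` sections S N" by blast
  qed
next
  assume *: "sections S L \<subseteq> act g ` sections S N"
  show "\<forall>h\<in>pm_hom (spread_module S) L. \<exists>k\<in>pm_hom (spread_module S) N. pm_comp g k = h"
  proof
    fix h assume h: "h \<in> pm_hom (spread_module S) L"
    have "act h (unit_sec S) \<in> sections S L" by (rule act_sections[OF is_pmod_spread[OF S] L h unit_sec_sections])
    then obtain t where t: "t \<in> sections S N" "act g t = act h (unit_sec S)" using * by (metis imageE subsetD)
    note k = hom_of_hom[OF S N t(1)]
    have "pm_comp g (hom_of S N t) = h"
      by (rule spread_hom_ext[OF pm_comp_hom[OF is_pmod_spread[OF S] N L g k] h])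
        (simp add: act_pm_comp[OF g k] act_hom_of[OF t(1)] t(2))
    then show "\<exists>k\<in>pm_hom (spread_module S) N. pm_comp g k = h" using k by blast
  qed
qed

section \<open>Principal filters and projectives\<close>

text \<open>Yoneda: a vector at a extends to the principal filter of a by transport. Together with the next
  lemma, the sections over the principal filter are the vectors at a.\<close>

lemma principal_section:
  fixes M :: "('p::order, 'k::field) pmod"
  assumes M: "is_pmod M" and v: "supp (vdim M a) v"
  obtains s where "s \<in> sections {x. a \<le> x} M" "curry s a = v"
proof
  let ?s = "\<lambda>(p, i). if a \<le> p then mv (tmap M a p) v i else 0"
  have c: "curry ?s p = (if a \<le> p then mv (tmap M a p) v else 0)" for p by (auto simp: fun_eq_iff)
  show "curry ?s a = v" using pmod_mv_id[OF M v] by (simp add: c del: curry_conv)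
  show "?s \<in> sections {x. a \<le> x} M"
  proof (rule sectionsI)
    show "supp (vdim M p) (curry ?s p)" for p
      unfolding c using supp_mv[OF pmod_carrier[OF M]] by simp
    show "mv (tmap M p q) (curry ?s p) = curry ?s q" if "p \<in> {x. a \<le> x}" "p \<le> q" for p q
      unfolding c using that pmod_mv_trans[OF M, of a p q v] by auto
    show "curry ?s p = 0" if "p \<notin> {x. a \<le> x}" for p unfolding c using that by simp
  qed
qed

lemma principal_sections_determined:
  assumes "s \<in> sections {x. a \<le> x} M" "curry s a = 0"
  shows "s = 0"
proof (rule eq_by_curry)
  fix p
  have "curry s p = 0"
  proof (cases "a \<le> p")
    case True
    then show ?thesis using sectionsD(3)[OF assms(1), of a p] assms(2) by (simp del: curry_conv)
  next
    case False
    then show ?thesis using sectionsD(2)[OF assms(1), of p] by blast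
  qed
  then show "curry s p = curry 0 p" by (simp del: curry_conv)
qed

lemma zero_if_no_principal_sections:
  assumes M: "is_pmod M" and z: "\<And>a. sections {x. a \<le> x} M \<subseteq> {0}"
  shows "is_zero_pmod M"
  unfolding is_zero_pmod_def
proof (intro allI, rule ccontr)
  fix a assume "vdim M a \<noteq> 0"
  then have "supp (vdim M a) (\<lambda>i. if i = 0 then 1 else 0 :: 'b)" (is "supp _ ?v") by (simp add: supp_def)
  then obtain s where s: "s \<in> sections {x. a \<le> x} M" "curry s a = ?v" using principal_section[OF M] by metis
  then have "s = 0" using z by blast
  then have "?v 0 = curry (0 :: 'a \<times> nat \<Rightarrow> 'b) a 0" using s(2) by metis
  then show False by simp
qed

lemma epi_if_principal_lift:
  fixes N L :: "('p::order, 'k::field) pmod"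
  assumes N: "is_pmod N" and L: "is_pmod L" and g: "g \<in> pm_hom N L"
    and lift: "\<And>a. sections {x. a \<le> x} L \<subseteq> act g ` sections {x. a \<le> x} N"
  shows "pm_epi g"
  unfolding pm_epi_iff[OF g]
proof (intro allI impI)
  fix p and v :: "nat \<Rightarrow> 'k" assume v: "supp (vdim L p) v"
  obtain s where s: "s \<in> sections {x. p \<le> x} L" "curry s p = v" using principal_section[OF L v] .
  then obtain t where t: "t \<in> sections {x. p \<le> x} N" "s = act g t" using lift by blast
  have "mv (g p) (curry t p) = v" using s(2) t(2) by (simp del: curry_conv)
  then show "\<exists>w. supp (vdim N p) w \<and> mv (g p) w = v" using sectionsD(1)[OF t(1)] by blast
qed

lemma order_convex_principal: "order_convex {x. a \<le> x}"
  by (auto simp: order_convex_def)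

lemma projective_principal: "projective_pmod (spread_module {x. a \<le> x} :: ('p::order, 'k::field) pmod)"
  unfolding projective_pmod_def
proof (intro conjI allI impI)
  let ?P = "spread_module {x. a \<le> x} :: ('p::order, 'k::field) pmod"
  show "is_pmod ?P" by (rule is_pmod_spread[OF order_convex_principal])
  fix N L g h
  assume *: "is_pmod N \<and> is_pmod L \<and> g \<in> pm_hom N L \<and> pm_epi g \<and> h \<in> pm_hom ?P L"
  then have N: "is_pmod N" and L: "is_pmod L" and g: "g \<in> pm_hom N L" and epi: "pm_epi g" and h: "h \<in> pm_hom ?P L"
    by auto
  have "sections {x. a \<le> x} L \<subseteq> act g ` sections {x. a \<le> x} N"
  proof
    fix s assume s: "s \<in> sections {x. a \<le> x} L"
    obtain w where w: "supp (vdim N a) w" "mv (g a) w = curry s a"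
      using epi sectionsD(1)[OF s] unfolding pm_epi_iff[OF g] by blast
    obtain t where t: "t \<in> sections {x. a \<le> x} N" "curry t a = w" using principal_section[OF N w(1)] .
    have "act g t - s = 0"
    proof (rule principal_sections_determined)
      show "act g t - s \<in> sections {x. a \<le> x} L"
        by (rule fvs.subspace_diff[OF subspace_sections act_sections[OF N L g t(1)] s])
      show "curry (act g t - s) a = 0" using t(2) w(2) by (simp del: curry_conv)
    qed
    then have "s = act g t" by simp
    then show "s \<in> act g ` sections {x. a \<le> x} N" using t(1) by blast
  qed
  then show "\<exists>k\<in>pm_hom ?P N. pm_comp g k = h"
    using lift_spread_iff[OF order_convex_principal N L g] h by blast
qed

section \<open>Canonical maps between spread modules\<close>

text \<open>The combinatorial condition for the canonical map, which is the identity on the intersection of S and T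
  and zero elsewhere, to be a nonzero morphism from the spread module on S to the one on T.\<close>

definition leads :: "'p::order set \<Rightarrow> 'p set \<Rightarrow> bool" where
  "leads S T \<longleftrightarrow> S \<inter> T \<noteq> {} \<and>
     (\<forall>p q. p \<le> q \<longrightarrow> (p \<in> S \<inter> T \<and> q \<in> T \<longrightarrow> q \<in> S) \<and> (p \<in> S \<and> q \<in> S \<inter> T \<longrightarrow> p \<in> T))"

lemma leads_refl: "S \<noteq> {} \<Longrightarrow> leads S S"
  by (auto simp: leads_def)

lemma leads_if_unit_sec_sections:
  assumes s: "unit_sec (S \<inter> T) \<in> sections S (spread_module T :: ('p::order, 'k::field) pmod)" and ne: "S \<inter> T \<noteq> {}"
  shows "leads S T"
  unfolding leads_def
proof (intro conjI allI impI ne)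
  fix p q :: 'p assume pq: "p \<le> q"
  have *: "(if p \<in> T \<and> q \<in> T then (if p \<in> S \<inter> T then 1 else 0) else 0 :: 'k) =
      (if q \<in> S \<inter> T then 1 else 0)" if "p \<in> S"
    using fun_cong[OF sectionsD(3)[OF s that pq], of 0] unfolding mv_spread_tmap curry_unit_sec by (auto split: if_splits)
  show "q \<in> S" if "p \<in> S \<inter> T \<and> q \<in> T"
    using * that by (auto split: if_splits)
  show "p \<in> T" if "p \<in> S \<and> q \<in> S \<inter> T"
    using * that by (auto split: if_splits)
qed

text \<open>Restriction to S is composition with the canonical map from S to T.\<close>

lemma restr_sections:
  assumes l: "leads S T" and f: "f \<in> sections T M"
  shows "restr S f \<in> sections S M"
proof (rule sectionsI)
  show "supp (vdim M p) (curry (restr S f) p)" for p using sectionsD(1)[OF f] by (simp del: curry_conv)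
  show "mv (tmap M p q) (curry (restr S f) p) = curry (restr S f) q" if p: "p \<in> S" and pq: "p \<le> q" for p q
  proof (cases "p \<in> T")
    case True
    then have "mv (tmap M p q) (curry f p) = curry f q" using sectionsD(3)[OF f _ pq] by blast
    moreover have "q \<in> S \<or> curry f q = 0"
      using l p pq True sectionsD(2)[OF f, of q] unfolding leads_def by blast
    ultimately show ?thesis using p by (auto simp del: curry_conv)
  next
    case False
    then have "curry f p = 0" using sectionsD(2)[OF f] by blast
    moreover have "q \<notin> S \<or> curry f q = 0"
      using l p pq False sectionsD(2)[OF f, of q] unfolding leads_def by blast
    ultimately show ?thesis by (auto simp del: curry_conv)
  qed
qed (simp del: curry_conv)

lemma restr_sections_self: "f \<in> sections S M \<Longrightarrow> restr S f = f"
  by (rule eq_by_curry) (use sectionsD(2) in \<open>fastforce simp del: curry_conv\<close>)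

section \<open>Directed families of spreads\<close>

text \<open>A family of spreads whose spread modules form a directed system of bricks: every morphism
  between them is a multiple of the canonical map, and a nonzero morphism between different ones increases a rank. The
  principal filters give the indecomposable projectives. The two parts of the theorem are two ways to obtain
  such a family. The last parameter fixes the field.\<close>

locale directed_spreads =
  fixes SS :: "'p::{finite, order} set set" and rk :: "'p set \<Rightarrow> nat" and ty :: "'k::field itself"
  assumes convex: "S \<in> SS \<Longrightarrow> order_convex S"
    and nonempty: "S \<in> SS \<Longrightarrow> S \<noteq> {}"
    and principal: "{x. a \<le> x} \<in> SS"
    and scalar: "S \<in> SS \<Longrightarrow> T \<in> SS \<Longrightarrow> s \<in> sections S (spread_module T :: ('p, 'k) pmod) \<Longrightarrow>
      \<exists>c. s = fscale c (unit_sec (S \<inter> T))"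
    and directed: "S \<in> SS \<Longrightarrow> T \<in> SS \<Longrightarrow> S \<noteq> T \<Longrightarrow> leads S T \<Longrightarrow> rk S < rk T"
begin

abbreviation spm :: "'p set \<Rightarrow> ('p, 'k) pmod" where
  "spm \<equiv> spread_module"

abbreviation spm_classes :: "('p, 'k) pmod set set" where
  "spm_classes \<equiv> (\<lambda>S. iso_class (spm S)) ` SS"

lemma is_pmod_spm: "S \<in> SS \<Longrightarrow> is_pmod (spm S)"
  by (rule is_pmod_spread[OF convex])

lemma sections_spm:
  assumes "S \<in> SS" "T \<in> SS" "s \<in> sections S (spm T)"
  obtains "s = 0" | c where "leads S T" "s = fscale c (unit_sec (S \<inter> T))"
proof -
  obtain c where c: "s = fscale c (unit_sec (S \<inter> T))" using scalar assms by blast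
  show ?thesis
  proof (cases "S \<inter> T = {} \<or> c = 0")
    case True
    then have "s = 0" unfolding c by (auto simp: unit_sec_def fun_eq_iff)
    then show ?thesis using that by blast
  next
    case False
    have "fscale (inverse c) s \<in> sections S (spm T)" by (rule fvs.subspace_scale[OF subspace_sections assms(3)])
    moreover have "fscale (inverse c) s = unit_sec (S \<inter> T)" unfolding c using False by (auto simp: fun_eq_iff)
    ultimately show ?thesis using that c leads_if_unit_sec_sections False by metis
  qed
qed

text \<open>The composite of two canonical maps is a morphism, hence a multiple of the canonical map. So it
  is either zero or itself canonical, and in the latter case the larger intersection is already contained in
  the middle spread.\<close>

lemma leads_trans:
  assumes "S \<in> SS" "T \<in> SS" "U \<in> SS" "leads S T" "leads T U" and ne: "S \<inter> T \<inter> U \<noteq> {}"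
  shows "leads S U" "S \<inter> U \<subseteq> T"
proof -
  let ?u = "restr S (restr T (unit_sec U)) :: 'p \<times> nat \<Rightarrow> 'k"
  have "?u \<in> sections S (spm U)"
    by (rule restr_sections[OF assms(4) restr_sections[OF assms(5) unit_sec_sections]])
  then obtain c where c0: "?u = fscale c (unit_sec (S \<inter> U))" using scalar assms by blast
  have u: "?u = unit_sec (S \<inter> (T \<inter> U))" by (simp only: restr_unit_sec)
  have c: "unit_sec (S \<inter> (T \<inter> U)) = fscale c (unit_sec (S \<inter> U))" using c0 u by simp
  obtain p where p: "p \<in> S \<inter> T \<inter> U" using ne by blast
  have "c = 1" using fun_cong[OF c, of "(p, 0)"] p by (simp add: unit_sec_def)
  have "q \<in> T" if "q \<in> S \<inter> U" for q
    using fun_cong[OF c, of "(q, 0)"] that \<open>c = 1\<close> by (auto simp: unit_sec_def split: if_splits)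
  then show sub: "S \<inter> U \<subseteq> T" by blast
  have "?u = unit_sec (S \<inter> U)" using c0 \<open>c = 1\<close> by (simp add: fscale_def)
  then show "leads S U" using \<open>?u \<in> sections S (spm U)\<close> leads_if_unit_sec_sections p by fastforce
qed

lemma restr_restr_sections:
  assumes "S \<in> SS" "T \<in> SS" "U \<in> SS" "leads S T" "leads T U" and f: "f \<in> sections U M"
  obtains "restr S (restr T f) = 0" | "leads S U" "restr S (restr T f) = restr S f"
proof (cases "S \<inter> T \<inter> U = {}")
  case True
  have "restr S (restr T f) = 0"
  proof (rule eq_by_curry)
    fix p show "curry (restr S (restr T f)) p = curry 0 p"
      using True sectionsD(2)[OF f, of p] by (auto simp del: curry_conv)
  qed
  then show ?thesis using that by blast
next
  case False
  note l = leads_trans[OF assms(1-5) False]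
  have "restr S (restr T f) = restr S f"
  proof (rule eq_by_curry)
    fix p show "curry (restr S (restr T f)) p = curry (restr S f) p"
      using l(2) sectionsD(2)[OF f, of p] by (auto simp del: curry_conv)
  qed
  then show ?thesis using that l(1) by blast
qed

text \<open>The morphisms from the spread module on S that factor through the family f, whose member f i
  is a morphism from the spread module on T i: each component of such a factorisation is a scalar multiple of a
  canonical map.\<close>

definition restr_span :: "'p set \<Rightarrow> 'i set \<Rightarrow> ('i \<Rightarrow> 'p set) \<Rightarrow> ('i \<Rightarrow> 'p \<times> nat \<Rightarrow> 'k) \<Rightarrow> ('p \<times> nat \<Rightarrow> 'k) set" where
  "restr_span S I T f = fvs.span ((\<lambda>i. restr S (f i)) ` {i \<in> I. leads S (T i)})"

lemma subspace_restr_span: "fvs.subspace (restr_span S I T f)"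
  unfolding restr_span_def by (rule fvs.subspace_span)

lemma restr_span_base: "i \<in> I \<Longrightarrow> leads S (T i) \<Longrightarrow> restr S (f i) \<in> restr_span S I T f"
  unfolding restr_span_def by (rule fvs.span_base) auto

lemma restr_span_cong: "(\<And>i. i \<in> I \<Longrightarrow> f i = g i) \<Longrightarrow> restr_span S I T f = restr_span S I T g"
  unfolding restr_span_def by (rule arg_cong[of _ _ fvs.span], rule image_cong) auto

lemma restr_span_mono: "I \<subseteq> J \<Longrightarrow> restr_span S I T f \<subseteq> restr_span S J T f"
  unfolding restr_span_def by (rule fvs.span_mono) auto

lemma restr_span_sections:
  assumes "\<And>i. i \<in> I \<Longrightarrow> f i \<in> sections (T i) M"
  shows "restr_span S I T f \<subseteq> sections S M"
  unfolding restr_span_def using assms by (intro fvs.span_minimal subspace_sections) (auto intro: restr_sections)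

lemma act_restr_span: "act g ` restr_span S I T f = restr_span S I T (\<lambda>i. act g (f i))"
  unfolding restr_span_def fvp.linear_span_image[OF act_linear, symmetric] image_image act_restr ..

text \<open>The direct sum of spread modules is freely generated by the inclusions e of the summands: every
  morphism into it is a combination of canonical maps followed by the inclusions, and morphisms out of it can be
  prescribed on the e i.\<close>

lemma free_sum:
  fixes T :: "'i \<Rightarrow> 'p set"
  assumes "distinct is" "\<And>i. i \<in> set is \<Longrightarrow> T i \<in> SS"
  defines "R \<equiv> foldr pm_dsum (map (\<lambda>i. spm (T i)) is) zero_pmod"
  shows "\<exists>e. (\<forall>i\<in>set is. e i \<in> sections (T i) R) \<and> (\<forall>S\<in>SS. sections S R \<subseteq> restr_span S (set is) T e) \<and>
    (\<forall>M f. is_pmod M \<longrightarrow> (\<forall>i\<in>set is. f i \<in> sections (T i) M) \<longrightarrow>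
      (\<exists>r\<in>pm_hom R M. \<forall>i\<in>set is. act r (e i) = f i))"
  using assms(1,2) unfolding R_def
proof (induction "is")
  case Nil
  have "sections S zero_pmod \<subseteq> restr_span S {} T (\<lambda>_. 0)" for S
  proof
    fix s :: "'p \<times> nat \<Rightarrow> 'k" assume s: "s \<in> sections S zero_pmod"
    have "s = 0" by (rule eq_by_curry) (use sectionsD(1)[OF s] in \<open>simp add: zero_pmod_def del: curry_conv\<close>)
    then show "s \<in> restr_span S {} T (\<lambda>_. 0)" by (simp add: restr_span_def)
  qed
  moreover have "(\<lambda>p. 0\<^sub>m (vdim M p) 0) \<in> pm_hom zero_pmod M" if "is_pmod M" for M :: "('p, 'k) pmod"
    by (rule pm_homI) (simp_all add: that, simp add: zero_pmod_def)
  ultimately show ?case by auto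
next
  case (Cons i "is")
  let ?A = "spm (T i)" and ?R = "foldr pm_dsum (map (\<lambda>i. spm (T i)) is) zero_pmod"
  have A: "is_pmod ?A" using Cons.prems by (simp add: is_pmod_spm)
  have R: "is_pmod ?R" by (rule is_pmod_foldr_dsum) (use Cons.prems is_pmod_spm in auto)
  let ?D = "pm_dsum ?A ?R"
  have D: "is_pmod ?D" by (rule is_pmod_dsum[OF A R])
  obtain e where e: "\<And>j. j \<in> set is \<Longrightarrow> e j \<in> sections (T j) ?R"
    "\<And>S. S \<in> SS \<Longrightarrow> sections S ?R \<subseteq> restr_span S (set is) T e"
    and ext: "\<And>M f. is_pmod M \<Longrightarrow> (\<forall>j\<in>set is. f j \<in> sections (T j) M) \<Longrightarrow>
      (\<exists>r\<in>pm_hom ?R M. \<forall>j\<in>set is. act r (e j) = f j)"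
  proof -
    have "distinct is" "\<And>j. j \<in> set is \<Longrightarrow> T j \<in> SS" using Cons.prems by auto
    then obtain e where E: "(\<forall>i\<in>set is. e i \<in> sections (T i) ?R) \<and> (\<forall>S\<in>SS. sections S ?R \<subseteq> restr_span S (set is) T e) \<and>
      (\<forall>M f. is_pmod M \<longrightarrow> (\<forall>i\<in>set is. f i \<in> sections (T i) M) \<longrightarrow>
        (\<exists>r\<in>pm_hom ?R M. \<forall>i\<in>set is. act r (e i) = f i))"
      using Cons.IH by blast
    show ?thesis by (rule that[of e]) (use E in blast)+
  qed
  note inl = dsum_inl_hom[OF A R] and inr = dsum_inr_hom[OF A R]
    and fst = dsum_fst_hom[OF A R] and snd = dsum_snd_hom[OF A R]
  let ?l = "act (dsum_inl ?A ?R)" and ?r = "act (dsum_inr ?A ?R)"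
  define e' where "e' = (\<lambda>j. if j = i then ?l (unit_sec (T i)) else ?r (e j))"
  have i: "i \<notin> set is" using Cons.prems by simp
  have e'i: "e' i = ?l (unit_sec (T i))" by (simp add: e'_def)
  have e'j: "e' j = ?r (e j)" if "j \<in> set is" for j using i that by (auto simp: e'_def)
  have 1: "\<forall>j\<in>set (i # is). e' j \<in> sections (T j) ?D"
    using act_sections[OF A D inl unit_sec_sections] act_sections[OF R D inr e(1)] e'i e'j by simp
  have 2: "sections S ?D \<subseteq> restr_span S (set (i # is)) T e'" if S: "S \<in> SS" for S
  proof
    fix s assume s: "s \<in> sections S ?D"
    let ?s1 = "act (dsum_fst ?A ?R) s" and ?s2 = "act (dsum_snd ?A ?R) s"
    have dec: "?l ?s1 + ?r ?s2 = s"
    proof (rule eq_by_curry)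
      fix p have "supp (vdim ?A p + vdim ?R p) (curry s p)" using sectionsD(1)[OF s, of p] by simp
      from dsum_decompose[OF this] show "curry (?l ?s1 + ?r ?s2) p = curry s p"
        by (simp only: curry_add curry_act)
    qed
    have s1: "?s1 \<in> sections S ?A" and s2: "?s2 \<in> sections S ?R"
      using act_sections[OF D A fst s] act_sections[OF D R snd s] by auto
    have "?l ?s1 \<in> restr_span S (set (i # is)) T e'"
    proof (cases rule: sections_spm[OF S _ s1])
      case 1 then show ?case using Cons.prems by simp
    next
      case 2 then show ?thesis by (simp add: act_0 fvs.subspace_0[OF subspace_restr_span])
    next
      case (3 c)
      then have "?l ?s1 = fscale c (restr S (e' i))" by (simp add: e'i act_scale act_restr[symmetric] restr_unit_sec)
      moreover have "restr S (e' i) \<in> restr_span S (set (i # is)) T e'"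
        by (rule restr_span_base) (use 3 in simp_all)
      ultimately show ?thesis using fvs.subspace_scale[OF subspace_restr_span] by simp
    qed
    moreover have "?r ?s2 \<in> restr_span S (set (i # is)) T e'"
    proof -
      have "?r ?s2 \<in> restr_span S (set is) T (\<lambda>j. ?r (e j))"
        using e(2)[OF S] s2 unfolding act_restr_span[symmetric] by blast
      moreover have "restr_span S (set is) T (\<lambda>j. ?r (e j)) \<subseteq> restr_span S (set (i # is)) T e'"
      proof -
        have "restr_span S (set is) T (\<lambda>j. ?r (e j)) = restr_span S (set is) T e'"
          by (rule restr_span_cong) (simp add: e'j)
        then show ?thesis using restr_span_mono[of "set is" "set (i # is)" S T e'] by auto
      qed
      ultimately show ?thesis by blast
    qed
    ultimately show "s \<in> restr_span S (set (i # is)) T e'"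
      using fvs.subspace_add[OF subspace_restr_span] dec by metis
  qed
  have 3: "\<exists>r\<in>pm_hom ?D M. \<forall>j\<in>set (i # is). act r (e' j) = f j"
    if M: "is_pmod M" and f: "\<forall>j\<in>set (i # is). f j \<in> sections (T j) M" for M and f :: "'i \<Rightarrow> 'p \<times> nat \<Rightarrow> 'k"
  proof -
    obtain r where r: "r \<in> pm_hom ?R M" "\<forall>j\<in>set is. act r (e j) = f j" using ext[OF M, of f] f by auto
    have fi: "f i \<in> sections (T i) M" using f by simp
    have h: "hom_of (T i) M (f i) \<in> pm_hom ?A M" 
      by (rule hom_of_hom[OF convex M fi]) (use Cons.prems in simp)
    let ?c = "dsum_copair ?A ?R (hom_of (T i) M (f i)) r"
    have c: "?c \<in> pm_hom ?D M" by (rule dsum_copair_hom[OF A R M h r(1)])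
    have l: "act ?c (?l s) = act (hom_of (T i) M (f i)) s" if s: "s \<in> sections (T i) ?A" for s
      by (rule eq_by_curry) (simp add: mv_dsum_copair[OF h r(1)] dsum_relations sectionsD(1)[OF s] del: curry_conv vdim_spread)
    have rr: "act ?c (?r s) = act r s" if s: "s \<in> sections U ?R" for s U
      by (rule eq_by_curry) (simp add: mv_dsum_copair[OF h r(1)] dsum_relations sectionsD(1)[OF s] del: curry_conv vdim_spread)
    have "act ?c (e' j) = f j" if j: "j \<in> set (i # is)" for j
    proof (cases "j = i")
      case True then show ?thesis using l[OF unit_sec_sections] act_hom_of[OF fi] e'i by simp
    next
      case False
      then have "j \<in> set is" using j by simp
      then show ?thesis using rr[OF e(1)] r(2) e'j by simp
    qed
    then show ?thesis using c by blast
  qed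
  show ?case
    using 1 2 3 by (intro exI[of _ e']) simp
qed

text \<open>A finite set of morphisms from spread modules to M through which all such morphisms factor.\<close>

definition generates :: "('p set \<times> ('p \<times> nat \<Rightarrow> 'k)) set \<Rightarrow> ('p, 'k) pmod \<Rightarrow> bool" where
  "generates G M \<longleftrightarrow> finite G \<and> (\<forall>x\<in>G. fst x \<in> SS \<and> snd x \<in> sections (fst x) M) \<and>
     (\<forall>S\<in>SS. sections S M \<subseteq> restr_span S G fst snd)"

lemma generates_exists: "\<exists>G. generates G M"
proof -
  have "\<exists>B. finite B \<and> B \<subseteq> sections S M \<and> sections S M \<subseteq> fvs.span B" for S
    using finite_basis[OF sections_support(1), of "sections S M" M] sections_support(2) by metis
  then obtain B where B: "\<And>S. finite (B S)" "\<And>S. B S \<subseteq> sections S M" "\<And>S. sections S M \<subseteq> fvs.span (B S)" by metis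
  let ?G = "Sigma SS B"
  have "sections S M \<subseteq> restr_span S ?G fst snd" if S: "S \<in> SS" for S
  proof -
    have "B S \<subseteq> (\<lambda>i. restr S (snd i)) ` {i \<in> ?G. leads S (fst i)}"
    proof
      fix b assume b: "b \<in> B S"
      have "b = restr S (snd (S, b))" using restr_sections_self[OF subsetD[OF B(2) b]] by simp
      moreover have "(S, b) \<in> {i \<in> ?G. leads S (fst i)}" using S b leads_refl[OF nonempty[OF S]] by simp
      ultimately show "b \<in> (\<lambda>i. restr S (snd i)) ` {i \<in> ?G. leads S (fst i)}" by (rule image_eqI)
    qed
    then show ?thesis unfolding restr_span_def using B(3)[of S] fvs.span_mono by blast
  qed
  then have "generates ?G M" unfolding generates_def using B(1) subsetD[OF B(2)] by auto
  then show ?thesis by blast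
qed

definition irredundant :: "('p set \<times> ('p \<times> nat \<Rightarrow> 'k)) set \<Rightarrow> bool" where
  "irredundant G \<longleftrightarrow> (\<forall>x\<in>G. snd x \<notin> restr_span (fst x) (G - {x}) fst snd)"

text \<open>A generator that factors through the others can be eliminated, since canonical maps compose to zero or to a
  canonical map.\<close>

lemma generates_drop:
  assumes G: "generates G M" and x: "x \<in> G" and red: "snd x \<in> restr_span (fst x) (G - {x}) fst snd"
  shows "generates (G - {x}) M"
proof -
  have "restr_span S G fst snd \<subseteq> restr_span S (G - {x}) fst snd" if S: "S \<in> SS" for S
    unfolding restr_span_def[of S G]
  proof (rule fvs.span_minimal)
    show "fvs.subspace (restr_span S (G - {x}) fst snd)" unfolding restr_span_def by (rule fvs.subspace_span)
    show "(\<lambda>i. restr S (snd i)) ` {i \<in> G. leads S (fst i)} \<subseteq> restr_span S (G - {x}) fst snd"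
    proof
      fix f assume "f \<in> (\<lambda>i. restr S (snd i)) ` {i \<in> G. leads S (fst i)}"
      then obtain y where y: "y \<in> G" "leads S (fst y)" "f = restr S (snd y)" by blast
      show "f \<in> restr_span S (G - {x}) fst snd"
      proof (cases "y = x")
        case False
        then show ?thesis unfolding restr_span_def using y by (intro fvs.span_base) auto
      next
        case True
        have "restr S (snd x) \<in> restr S ` fvs.span ((\<lambda>i. restr (fst x) (snd i)) ` {i \<in> G - {x}. leads (fst x) (fst i)})"
          using red unfolding restr_span_def by (rule imageI)
        also have "\<dots> = fvs.span (restr S ` (\<lambda>i. restr (fst x) (snd i)) ` {i \<in> G - {x}. leads (fst x) (fst i)})"
          by (rule fvp.linear_span_image[OF restr_linear, symmetric])
        also have "\<dots> \<subseteq> restr_span S (G - {x}) fst snd"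
        proof (rule fvs.span_minimal)
          show "fvs.subspace (restr_span S (G - {x}) fst snd)" unfolding restr_span_def by (rule fvs.subspace_span)
          show "restr S ` (\<lambda>i. restr (fst x) (snd i)) ` {i \<in> G - {x}. leads (fst x) (fst i)} \<subseteq> restr_span S (G - {x}) fst snd"
          proof (rule subsetI, elim imageE)
            fix v w z assume "v = restr S w" "w = restr (fst x) (snd z)" and z: "z \<in> {i \<in> G - {x}. leads (fst x) (fst i)}"
            then have v: "v = restr S (restr (fst x) (snd z))" by simp
            have "fst x \<in> SS" "fst z \<in> SS" "snd z \<in> sections (fst z) M" using G x z unfolding generates_def by auto
            moreover have "leads S (fst x)" "leads (fst x) (fst z)" using y True z by auto
            ultimately consider "v = 0" | "leads S (fst z)" "v = restr S (snd z)"
              using restr_restr_sections[OF S, of "fst x" "fst z" "snd z" M] v by metis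
            then show "v \<in> restr_span S (G - {x}) fst snd"
            proof cases
              case 1 then show ?thesis by (simp add: restr_span_def fvs.span_zero)
            next
              case 2 then show ?thesis unfolding restr_span_def using z by (intro fvs.span_base) auto
            qed
          qed
        qed
        finally show ?thesis using y(3) True by simp
      qed
    qed
  qed
  then show ?thesis using G unfolding generates_def by blast
qed

text \<open>A generating set with the least number of elements will do.\<close>

lemma irredundant_exists: "\<exists>G. generates G M \<and> irredundant G"
proof -
  obtain G where G: "generates G M" "\<And>H. generates H M \<Longrightarrow> card G \<le> card H"
    using ex_has_least_nat[of "\<lambda>G. generates G M" _ card] generates_exists by metis
  have "irredundant G"
    unfolding irredundant_def
  proof (intro ballI notI)
    fix x assume x: "x \<in> G" and "snd x \<in> restr_span (fst x) (G - {x}) fst snd"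
    then have "generates (G - {x}) M" using generates_drop G(1) by blast
    then have "card G \<le> card (G - {x})" by (rule G(2))
    then show False using x G(1) unfolding generates_def by (metis card_Diff1_less leD)
  qed
  then show ?thesis using G(1) by blast
qed

end

section \<open>Minimal approximations and resolutions\<close>

context directed_spreads
begin

definition lifts :: "('p, 'k) pmod \<Rightarrow> ('p \<Rightarrow> 'k mat) \<Rightarrow> ('p, 'k) pmod \<Rightarrow> ('p, 'k) pmod \<Rightarrow> bool" where
  "lifts R r M A \<longleftrightarrow> (\<forall>h\<in>pm_hom A M. \<exists>k\<in>pm_hom A R. pm_comp r k = h)"

lemma lifts_iso:
  assumes "is_pmod A" "is_pmod B" "is_pmod R" "is_pmod M" and r: "r \<in> pm_hom R M"
    and iso: "pm_isomorphic A B" and l: "lifts R r M B"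
  shows "lifts R r M A"
  unfolding lifts_def
proof
  fix h assume h: "h \<in> pm_hom A M"
  obtain f g where fg: "f \<in> pm_hom A B" "g \<in> pm_hom B A" "pm_comp g f = pm_id A"
    using iso unfolding pm_isomorphic_def pm_isomorphism_def by blast
  obtain k where k: "k \<in> pm_hom B R" "pm_comp r k = pm_comp h g"
    using l pm_comp_hom[OF assms(2,1,4) h fg(2)] unfolding lifts_def by blast
  have "pm_comp r (pm_comp k f) = pm_comp (pm_comp h g) f"
    using pm_comp_assoc[OF fg(1) k(1) r] k(2) by simp
  also have "\<dots> = h" using pm_comp_assoc[OF fg(1,2) h] fg(3) pm_id_right[OF h] by simp
  finally show "\<exists>k\<in>pm_hom A R. pm_comp r k = h" using pm_comp_hom[OF assms(1-3) k(1) fg(1)] by blast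
qed

lemma lifts_dsum:
  assumes A: "is_pmod A" and B: "is_pmod B" and R: "is_pmod R" and M: "is_pmod M" and r: "r \<in> pm_hom R M"
    and l: "lifts R r M A" "lifts R r M B"
  shows "lifts R r M (pm_dsum A B)"
  unfolding lifts_def
proof
  note D = is_pmod_dsum[OF A B] and inl = dsum_inl_hom[OF A B] and inr = dsum_inr_hom[OF A B]
  fix h assume h: "h \<in> pm_hom (pm_dsum A B) M"
  obtain k1 where k1: "k1 \<in> pm_hom A R" "pm_comp r k1 = pm_comp h (dsum_inl A B)"
    using l(1) pm_comp_hom[OF A D M h inl] unfolding lifts_def by blast
  obtain k2 where k2: "k2 \<in> pm_hom B R" "pm_comp r k2 = pm_comp h (dsum_inr A B)"
    using l(2) pm_comp_hom[OF B D M h inr] unfolding lifts_def by blast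
  let ?k = "dsum_copair A B k1 k2"
  have k: "?k \<in> pm_hom (pm_dsum A B) R" by (rule dsum_copair_hom[OF A B R k1(1) k2(1)])
  have "pm_comp r ?k = h"
  proof (rule pm_hom_ext[OF pm_comp_hom[OF D R M r k] h])
    fix p and v :: "nat \<Rightarrow> 'k" assume v: "supp (vdim (pm_dsum A B) p) v"
    let ?v1 = "mv (dsum_fst A B p) v" and ?v2 = "mv (dsum_snd A B p) v"
    have 1: "mv (r p) (mv (k1 p) ?v1) = mv (h p) (mv (dsum_inl A B p) ?v1)"
      using mv_pm_comp[OF r k1(1), of p ?v1] mv_pm_comp[OF h inl, of p ?v1] k1(2) by simp
    have 2: "mv (r p) (mv (k2 p) ?v2) = mv (h p) (mv (dsum_inr A B p) ?v2)"
      using mv_pm_comp[OF r k2(1), of p ?v2] mv_pm_comp[OF h inr, of p ?v2] k2(2) by simp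
    have "mv (pm_comp r ?k p) v = mv (r p) (mv (k1 p) ?v1) + mv (r p) (mv (k2 p) ?v2)"
      unfolding mv_pm_comp[OF r k] mv_dsum_copair[OF k1(1) k2(1)] mv_add ..
    also have "\<dots> = mv (h p) (mv (dsum_inl A B p) ?v1 + mv (dsum_inr A B p) ?v2)"
      unfolding 1 2 mv_add ..
    also have "mv (dsum_inl A B p) ?v1 + mv (dsum_inr A B p) ?v2 = v"
      by (rule dsum_decompose) (use v in simp)
    finally show "mv (pm_comp r ?k p) v = mv (h p) v" .
  qed
  then show "\<exists>k\<in>pm_hom (pm_dsum A B) R. pm_comp r k = h" using k by blast
qed

lemma zero_hom: "is_pmod A \<Longrightarrow> is_pmod B \<Longrightarrow> (\<lambda>p. 0\<^sub>m (vdim B p) (vdim A p)) \<in> pm_hom A B"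
  by (rule pm_homI) simp_all

lemma lifts_zero:
  assumes "is_pmod R" "is_pmod M" "r \<in> pm_hom R M"
  shows "lifts R r M zero_pmod"
  unfolding lifts_def
proof
  fix h assume h: "h \<in> pm_hom zero_pmod M"
  note k = zero_hom[OF is_pmod_zero assms(1)]
  have "pm_comp r (\<lambda>p. 0\<^sub>m (vdim R p) (vdim (zero_pmod :: ('p, 'k) pmod) p)) = h"
    by (rule pm_hom_ext[OF pm_comp_hom[OF is_pmod_zero assms(1,2,3) k] h]) (simp add: zero_pmod_def)
  then show "\<exists>k\<in>pm_hom zero_pmod R. pm_comp r k = h" using k by blast
qed

lemma lifts_in_spm_classes:
  assumes R: "is_pmod R" and M: "is_pmod M" and r: "r \<in> pm_hom R M"
    and lift: "\<And>S. S \<in> SS \<Longrightarrow> sections S M \<subseteq> act r ` sections S R"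
    and A: "is_pmod A" "iso_class A \<in> spm_classes"
  shows "lifts R r M A"
proof -
  obtain S where S: "S \<in> SS" "iso_class A = iso_class (spm S)" using A(2) by blast
  have "pm_isomorphic A (spm S)" using iso_class_eq_iff[OF A(1) is_pmod_spm[OF S(1)]] S(2) by blast
  moreover have "lifts R r M (spm S)"
    unfolding lifts_def using lift_spread_iff[OF convex[OF S(1)] R M r] lift[OF S(1)] by blast
  ultimately show ?thesis by (rule lifts_iso[OF A(1) is_pmod_spm[OF S(1)] R M r])
qed

text \<open>An approximation only has to be tested on the spread modules themselves, because liftability is
  inherited by direct sums and by isomorphic modules.\<close>

lemma lifts_in_add:
  assumes R: "is_pmod R" and M: "is_pmod M" and r: "r \<in> pm_hom R M"
    and lift: "\<And>S. S \<in> SS \<Longrightarrow> sections S M \<subseteq> act r ` sections S R"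
    and A: "in_add spm_classes A"
  shows "lifts R r M A"
proof -
  obtain Ys where Ys: "\<forall>Y\<in>set Ys. is_pmod Y \<and> iso_class Y \<in> spm_classes"
    and iso: "pm_isomorphic A (foldr pm_dsum Ys zero_pmod)" and A': "is_pmod A"
    using A unfolding in_add_def by blast
  have F: "is_pmod (foldr pm_dsum Ys zero_pmod)" by (rule is_pmod_foldr_dsum) (use Ys in blast)
  have "lifts R r M (foldr pm_dsum Ys zero_pmod)"
    using Ys
  proof (induction Ys)
    case Nil
    then show ?case using lifts_zero[OF R M r] by simp
  next
    case (Cons Y Ys)
    then have Y: "is_pmod Y" "iso_class Y \<in> spm_classes" by simp_all
    have "lifts R r M Y" by (rule lifts_in_spm_classes[OF R M r lift Y])
    moreover have "lifts R r M (foldr pm_dsum Ys zero_pmod)" using Cons by simp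
    moreover have "is_pmod (foldr pm_dsum Ys zero_pmod)" by (rule is_pmod_foldr_dsum) (use Cons.prems in simp)
    ultimately show ?case using lifts_dsum[OF Y(1) _ R M r] by simp
  qed
  then show ?thesis by (rule lifts_iso[OF A' F R M r iso])
qed

text \<open>A measure for the length of a resolution: no spread module of rank t or more has a nonzero morphism to
  M.\<close>

definition below :: "nat \<Rightarrow> ('p, 'k) pmod \<Rightarrow> bool" where
  "below t M \<longleftrightarrow> (\<forall>S\<in>SS. t \<le> rk S \<longrightarrow> sections S M \<subseteq> {0})"

lemma rk_bounded: "\<exists>N. \<forall>S\<in>SS. rk S < N"
  using finite_nat_set_iff_bounded[of "rk ` SS"] by auto

lemma below_exists: "\<exists>t. \<forall>M. below t M"
  using rk_bounded unfolding below_def by (meson leD)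

lemma below_0_iff:
  assumes "is_pmod M" shows "below 0 M \<longleftrightarrow> is_zero_pmod M"
proof
  assume "below 0 M"
  then show "is_zero_pmod M" using zero_if_no_principal_sections[OF assms] principal unfolding below_def by blast
next
  assume z: "is_zero_pmod M"
  have "s = 0" if "s \<in> sections S M" for S s
    by (rule eq_by_curry) (use sectionsD(1)[OF that] z in \<open>simp add: is_zero_pmod_def del: curry_conv\<close>)
  then show "below 0 M" unfolding below_def by blast
qed

text \<open>The key to directedness: a morphism from the spread module on S that is killed by the
  approximation has no component in the summands isomorphic to its source. A nonzero coefficient there would
  express that generator through the others, against irredundancy.\<close>

lemma approximation_kernel_sections:
  assumes G: "generates G M" and irr: "irredundant G"
    and e: "\<And>x. x \<in> G \<Longrightarrow> e x \<in> sections (fst x) R" and S: "S \<in> SS"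
    and r: "\<And>x. x \<in> G \<Longrightarrow> act r (e x) = snd x"
    and d: "d \<in> restr_span S G fst e" "act r d = 0"
  shows "d \<in> restr_span S {x \<in> G. fst x \<noteq> S} fst e"
proof -
  let ?I = "{x \<in> G. leads S (fst x)}"
  have fin: "finite ?I" using G unfolding generates_def by simp
  obtain c where c: "d = (\<Sum>x\<in>?I. fscale (c x) (restr S (e x)))"
    by (rule in_span_image[OF fin d(1)[unfolded restr_span_def]])
  have "(\<Sum>x\<in>?I. fscale (c x) (restr S (snd x))) = act r d"
    unfolding c act_sum act_scale act_restr by (rule sum.cong) (simp_all add: r)
  then have rel: "(\<Sum>x\<in>?I. fscale (c x) (restr S (snd x))) = 0" using d(2) by simp
  have zero: "c x = 0" if x: "x \<in> G" "fst x = S" for x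
  proof (rule ccontr)
    assume cx: "c x \<noteq> 0"
    have xI: "x \<in> ?I" using x leads_refl[OF nonempty[OF S]] by simp
    let ?t = "\<Sum>y\<in>?I - {x}. fscale (c y) (restr S (snd y))"
    have "fscale (c x) (restr S (snd x)) + ?t = 0"
      using rel sum.remove[OF fin xI, of "\<lambda>y. fscale (c y) (restr S (snd y))"] by simp
    moreover have "restr S (snd x) = snd x"
      using G x unfolding generates_def by (auto intro: restr_sections_self)
    ultimately have eq: "fscale (c x) (snd x) = - ?t" by (simp add: eq_neg_iff_add_eq_0)
    have "?t \<in> restr_span S (G - {x}) fst snd"
      by (intro fvs.subspace_sum[OF subspace_restr_span] fvs.subspace_scale[OF subspace_restr_span] restr_span_base) auto
    then have "fscale (c x) (snd x) \<in> restr_span S (G - {x}) fst snd"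
      unfolding eq by (rule fvs.subspace_neg[OF subspace_restr_span])
    then have "fscale (inverse (c x)) (fscale (c x) (snd x)) \<in> restr_span S (G - {x}) fst snd"
      by (rule fvs.subspace_scale[OF subspace_restr_span])
    moreover have "fscale (inverse (c x)) (fscale (c x) (snd x)) = snd x" using cx by (simp add: fun_eq_iff)
    ultimately show False using irr x unfolding irredundant_def by auto
  qed
  have "fscale (c x) (restr S (e x)) \<in> restr_span S {x \<in> G. fst x \<noteq> S} fst e" if "x \<in> ?I" for x
  proof (cases "fst x = S")
    case True
    then have "c x = 0" using zero that by simp
    then show ?thesis by (simp add: fvs.subspace_0[OF subspace_restr_span])
  next
    case False
    then show ?thesis using that by (intro fvs.subspace_scale[OF subspace_restr_span] restr_span_base) auto
  qed
  then show ?thesis unfolding c by (rule fvs.subspace_sum[OF subspace_restr_span])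
qed

text \<open>Minimality. If g fixes the approximation then g and the identity differ by components that strictly
  increase the rank, so g is unitriangular. Concretely, g is shown to be surjective on sections over S by
  induction from the highest rank downwards.\<close>

lemma approximation_endo_iso:
  assumes G: "generates G M" and irr: "irredundant G" and R: "is_pmod R"
    and e: "\<And>x. x \<in> G \<Longrightarrow> e x \<in> sections (fst x) R" 
    and span: "\<And>S. S \<in> SS \<Longrightarrow> sections S R \<subseteq> restr_span S G fst e"
    and rh: "r \<in> pm_hom R M" and r: "\<And>x. x \<in> G \<Longrightarrow> act r (e x) = snd x"
    and g: "g \<in> pm_hom R R" "pm_comp r g = r"
  shows "pm_isomorphism R R g"
proof -
  obtain N where N: "\<And>S. S \<in> SS \<Longrightarrow> rk S < N" using rk_bounded by blast
  have "sections S R \<subseteq> act g ` sections S R" if "S \<in> SS" for S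
    using that
  proof (induction "N - rk S" arbitrary: S rule: less_induct)
    case less
    have sub: "fvs.subspace (act g ` sections S R)"
      by (rule fvp.linear_subspace_image[OF act_linear subspace_sections])
    show ?case
    proof
      fix k assume k: "k \<in> sections S R"
      \<comment> \<open>the error of g against the identity is killed by r, so it only involves summands of higher rank\<close>
      let ?d = "act g k - k"
      have gk: "act g k \<in> sections S R" by (rule act_sections[OF R R g(1) k])
      have d: "?d \<in> sections S R" by (rule fvs.subspace_diff[OF subspace_sections gk k])
      have "act r ?d = 0" using act_pm_comp[OF rh g(1), of k] g(2) by (simp add: act_diff)
      then have "?d \<in> restr_span S {x \<in> G. fst x \<noteq> S} fst e"
        using approximation_kernel_sections[OF G irr e less.prems r] span[OF less.prems] d by blast
      also have "\<dots> \<subseteq> act g ` sections S R"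
        unfolding restr_span_def
      proof (rule fvs.span_minimal[OF _ sub], rule image_subsetI)
        fix x assume x: "x \<in> {x \<in> {x \<in> G. fst x \<noteq> S}. leads S (fst x)}"
        then have T: "fst x \<in> SS" using G unfolding generates_def by auto
        have "rk S < rk (fst x)" using directed[OF less.prems T] x by auto
        then have "N - rk (fst x) < N - rk S" using N[OF T] by simp
        then have "e x \<in> act g ` sections (fst x) R" using less.hyps[OF _ T] e[of x] x by blast
        then obtain e' where e': "e' \<in> sections (fst x) R" "e x = act g e'" by blast
        have "restr S (e x) = act g (restr S e')" unfolding e'(2) act_restr ..
        moreover have "restr S e' \<in> sections S R" using restr_sections[OF _ e'(1)] x by blast
        ultimately show "restr S (e x) \<in> act g ` sections S R" by blast
      qed
      finally have "act g k - ?d \<in> act g ` sections S R" using fvs.subspace_diff[OF sub imageI[OF k]] by blast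
      then show "k \<in> act g ` sections S R" by simp
    qed
  qed
  then have "pm_epi g" using epi_if_principal_lift[OF R R g(1)] principal by blast
  then show ?thesis by (rule pm_isomorphism_if_surj[OF R g(1)])
qed

text \<open>The last two conclusions make resolutions finite: the top rank of M does not occur in the kernel,
  because there a morphism into the approximation would only have components in summands of still higher rank,
  and those have no nonzero morphism to M.\<close>

theorem minimal_approximation_step:
  assumes M: "is_pmod M"
  obtains Ts R r Z i where "set Ts \<subseteq> SS" "R = foldr pm_dsum (map spm Ts) zero_pmod"
    "minimal_approximation spm_classes R r M" "is_kernel Z i R r M" "pm_epi r"
    "\<And>S. S \<in> SS \<Longrightarrow> sections S M \<subseteq> act r ` sections S R"
    "\<And>t. below (Suc t) M \<Longrightarrow> below t Z" "is_zero_pmod M \<Longrightarrow> is_zero_pmod R \<and> is_zero_pmod Z"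
proof -
  obtain G where G: "generates G M" and irr: "irredundant G" using irredundant_exists by blast
  have "finite G" using G unfolding generates_def by (rule conjunct1)
  then obtain xs where xs: "set xs = G" "distinct xs" using finite_distinct_list by blast
  have GS: "\<And>x. x \<in> G \<Longrightarrow> fst x \<in> SS" and GM: "\<And>x. x \<in> G \<Longrightarrow> snd x \<in> sections (fst x) M"
    and Gspan: "\<And>S. S \<in> SS \<Longrightarrow> sections S M \<subseteq> restr_span S G fst snd"
    using G unfolding generates_def by auto
  have Gne: "snd x \<noteq> 0" if "x \<in> G" for x
    using irr that fvs.subspace_0[OF subspace_restr_span] unfolding irredundant_def by metis
  define R where "R = foldr pm_dsum (map spm (map fst xs)) zero_pmod"
  have R: "is_pmod R" unfolding R_def by (rule is_pmod_foldr_dsum) (use xs GS is_pmod_spm in auto)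
  obtain e where e: "\<And>x. x \<in> G \<Longrightarrow> e x \<in> sections (fst x) R" 
    and span: "\<And>S. S \<in> SS \<Longrightarrow> sections S R \<subseteq> restr_span S G fst e"
    and ext: "\<And>f. (\<forall>x\<in>G. f x \<in> sections (fst x) M) \<Longrightarrow> (\<exists>r\<in>pm_hom R M. \<forall>x\<in>G. act r (e x) = f x)"
  proof -
    have "\<exists>e. (\<forall>x\<in>G. e x \<in> sections (fst x) R) \<and> (\<forall>S\<in>SS. sections S R \<subseteq> restr_span S G fst e) \<and>
      (\<forall>M f. is_pmod M \<longrightarrow> (\<forall>x\<in>G. f x \<in> sections (fst x) M) \<longrightarrow>
        (\<exists>r\<in>pm_hom R M. \<forall>x\<in>G. act r (e x) = f x))"
      using free_sum[OF xs(2), of fst] GS unfolding R_def xs(1) by (simp add: comp_def)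
    then obtain e where E: "(\<forall>x\<in>G. e x \<in> sections (fst x) R) \<and> (\<forall>S\<in>SS. sections S R \<subseteq> restr_span S G fst e) \<and>
      (\<forall>M f. is_pmod M \<longrightarrow> (\<forall>x\<in>G. f x \<in> sections (fst x) M) \<longrightarrow>
        (\<exists>r\<in>pm_hom R M. \<forall>x\<in>G. act r (e x) = f x))" ..
    show ?thesis by (rule that[of e]) (use E M in blast)+
  qed
  obtain r where r: "r \<in> pm_hom R M" and re: "\<And>x. x \<in> G \<Longrightarrow> act r (e x) = snd x"
    using ext[of snd] GM by blast
  have lift: "sections S M \<subseteq> act r ` sections S R" if S: "S \<in> SS" for S
  proof -
    have "restr_span S G fst snd = restr_span S G fst (\<lambda>x. act r (e x))" by (rule restr_span_cong) (simp add: re)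
    also have "\<dots> = act r ` restr_span S G fst e" by (rule act_restr_span[symmetric])
    also have "\<dots> \<subseteq> act r ` sections S R" by (rule image_mono, rule restr_span_sections, rule e)
    finally show ?thesis using Gspan[OF S] by blast
  qed
  have addR: "in_add spm_classes R"
    unfolding in_add_def using R xs GS is_pmod_spm pm_isomorphic_refl[OF R]
    by (intro conjI exI[of _ "map spm (map fst xs)"]) (auto simp: R_def)
  have minapp: "minimal_approximation spm_classes R r M"
    unfolding minimal_approximation_def approximation_def
    using addR r lifts_in_add[OF R M r lift, unfolded lifts_def] approximation_endo_iso[OF G irr R e span r re]
    by blast
  obtain Z i where Z: "is_kernel Z i R r M" using kernel_exists[OF R M r] .
  have epi: "pm_epi r" by (rule epi_if_principal_lift[OF R M r lift[OF principal]])
  have lower: "below t Z" if t: "below (Suc t) M" for t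
    unfolding below_def
  proof (intro ballI impI subsetI)
    fix S z assume S: "S \<in> SS" "t \<le> rk S" and z: "z \<in> sections S Z"
    have i: "i \<in> pm_hom Z R" and Zp: "is_pmod Z" and mono: "\<And>p w. supp (vdim Z p) w \<Longrightarrow> mv (i p) w = 0 \<Longrightarrow> w = 0"
      and ker: "\<And>p v. supp (vdim R p) v \<Longrightarrow> (mv (r p) v = 0) = (\<exists>w. supp (vdim Z p) w \<and> mv (i p) w = v)"
      using Z unfolding is_kernel_iff by auto
    let ?d = "act i z"
    have d: "?d \<in> sections S R" by (rule act_sections[OF Zp R i z])
    have "act r ?d = 0"
    proof (rule eq_by_curry)
      fix p
      have "mv (r p) (mv (i p) (curry z p)) = 0"
        using ker[OF supp_mv[OF pm_hom_carrier[OF i]]] sectionsD(1)[OF z, of p] by blast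
      then show "curry (act r ?d) p = curry 0 p" by (simp del: curry_conv)
    qed
    then have "?d \<in> restr_span S {x \<in> G. fst x \<noteq> S} fst e"
      using approximation_kernel_sections[OF G irr e S(1) re] span[OF S(1)] d by blast
    moreover have empty: "{x \<in> {x \<in> G. fst x \<noteq> S}. leads S (fst x)} = {}"
    proof (rule ccontr)
      assume "{x \<in> {x \<in> G. fst x \<noteq> S}. leads S (fst x)} \<noteq> {}"
      then obtain x where x: "x \<in> G" "fst x \<noteq> S" "leads S (fst x)" by blast
      then have "Suc t \<le> rk (fst x)" using directed[OF S(1) GS[OF x(1)]] S(2) by fastforce
      then have "snd x = 0" using t GS[OF x(1)] GM[OF x(1)] unfolding below_def by blast
      then show False using Gne x(1) by blast
    qed
    ultimately have "?d = 0" unfolding restr_span_def empty image_empty fvs.span_empty by blast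
    then have "mv (i p) (curry z p) = 0" for p using curry_act[of i z p] by (simp del: curry_conv curry_act)
    then have "curry z p = 0" for p using mono sectionsD(1)[OF z, of p] by blast
    then have "z = 0" by (intro eq_by_curry) (simp del: curry_conv)
    then show "z \<in> {0}" by simp
  qed
  have zero: "is_zero_pmod R \<and> is_zero_pmod Z" if "is_zero_pmod M"
  proof -
    have "x \<notin> G" for x
    proof
      assume x: "x \<in> G"
      have "below 0 M" using that below_0_iff[OF M] by blast
      then have "snd x = 0" using GS[OF x] GM[OF x] unfolding below_def by blast
      then show False using Gne x by blast
    qed
    then have "G = {}" by blast
    then have "xs = []" using xs(1) by simp
    then have zR: "is_zero_pmod R" unfolding R_def by (simp add: is_zero_pmod_def zero_pmod_def)
    have "is_zero_pmod Z"
      unfolding is_zero_pmod_def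
    proof (intro allI, rule ccontr)
      fix p assume "vdim Z p \<noteq> 0"
      then have s: "supp (vdim Z p) (\<lambda>i. if i = 0 then 1 else 0 :: 'k)" (is "supp _ ?v") by (simp add: supp_def)
      have i: "i \<in> pm_hom Z R" using Z unfolding is_kernel_iff by auto
      have "mv (i p) ?v = 0" using supp_mv[OF pm_hom_carrier[OF i], of p ?v] zR by (simp add: is_zero_pmod_def)
      then have "?v = 0" using Z s unfolding is_kernel_iff by blast
      then have "?v 0 = (0 :: nat \<Rightarrow> 'k) 0" by (rule fun_cong)
      then show False by simp
    qed
    then show ?thesis using zR by simp
  qed
  have "set (map fst xs) \<subseteq> SS" using xs GS by auto
  from that[OF this R_def minapp Z epi lift lower zero] show ?thesis .
qed

text \<open>Iterating the previous step gives a minimal resolution. Each syzygy lowers the rank bound, so after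
  finitely many steps the syzygies and then the terms of the resolution vanish.\<close>

theorem finite_dimension:
  assumes M: "is_pmod M" shows "rel_dim spm_classes M \<noteq> \<infinity>"
proof -
  define P where "P = (\<lambda>M (R, r, Z, i). minimal_approximation spm_classes R r M \<and> is_kernel Z i R r M \<and>
    (\<forall>t. below (Suc t) M \<longrightarrow> below t Z) \<and> (is_zero_pmod M \<longrightarrow> is_zero_pmod R \<and> is_zero_pmod Z))"
  have ex: "\<exists>q. P N q" if N: "is_pmod N" for N
  proof -
    from minimal_approximation_step[OF N] show ?thesis
    proof cases
      case (1 Ts R r Z i)
      then have "P N (R, r, Z, i)" unfolding P_def by simp
      then show ?thesis ..
    qed
  qed
  define q where "q = (\<lambda>N. SOME q. P N q)"
  have q: "P N (q N)" if "is_pmod N" for N unfolding q_def using someI_ex[OF ex[OF that]] .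
  define nxt where "nxt = (\<lambda>N. fst (snd (snd (q N))))"
  define Z where "Z = (\<lambda>n. (nxt ^^ n) M)"
  have step: "minimal_approximation spm_classes (fst (q N)) (fst (snd (q N))) N"
    "is_kernel (nxt N) (snd (snd (snd (q N)))) (fst (q N)) (fst (snd (q N))) N"
    "\<And>t. below (Suc t) N \<Longrightarrow> below t (nxt N)" "is_zero_pmod N \<Longrightarrow> is_zero_pmod (fst (q N)) \<and> is_zero_pmod (nxt N)"
    if "is_pmod N" for N
    using q[OF that] unfolding P_def nxt_def by (auto split: prod.splits)
  have Zp: "is_pmod (Z n)" for n
  proof (induction n)
    case (Suc n)
    then show ?case using step(2)[OF Suc] unfolding Z_def is_kernel_def by simp
  qed (simp add: Z_def M)
  have ZS: "Z (Suc n) = nxt (Z n)" for n by (simp add: Z_def)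
  let ?R = "\<lambda>n. fst (q (Z n))"
  have "minimal_resolution spm_classes M ?R"
    unfolding minimal_resolution_def
    by (rule exI[of _ Z], rule exI[of _ "\<lambda>n. fst (snd (q (Z n)))"], rule exI[of _ "\<lambda>n. snd (snd (snd (q (Z n))))"])
      (use step[OF Zp] ZS in \<open>simp add: Z_def\<close>)
  moreover obtain t where t: "\<forall>M. below t M" using below_exists by blast
  have "below (t - n) (Z n)" if "n \<le> t" for n
    using that
  proof (induction n)
    case (Suc n)
    then show ?case using step(3)[OF Zp, of "t - Suc n" n] by (simp add: ZS Suc_diff_Suc)
  qed (use t in simp)
  then have "below 0 (Z t)" by fastforce
  then have "is_zero_pmod (Z t)" using below_0_iff[OF Zp] by blast
  then have "is_zero_pmod (Z (Suc t))" using step(4)[OF Zp] ZS by simp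
  then have "is_zero_pmod (?R (Suc t))" using step(4)[OF Zp] by blast
  ultimately have "rel_dim spm_classes M \<le> enat t" unfolding rel_dim_def by (intro Inf_lower) blast
  then show ?thesis by (cases "rel_dim spm_classes M") simp_all
qed

lemma not_properly_infinite: "\<not> properly_infinite spm_classes"
  unfolding properly_infinite_def using finite_dimension by blast

end

section \<open>The relative Grothendieck group\<close>

lemma keys_cls: "is_pmod M \<Longrightarrow> Poly_Mapping.keys (frag_of (iso_class M)) \<subseteq> iso_classes"
  by (auto simp: iso_classes_def)

lemma rel_exact_pmods:
  assumes "rel_exact Y M f N g L"
  shows "is_pmod M" "is_pmod N" "is_pmod L" "f \<in> pm_hom M N" "g \<in> pm_hom N L"
  using assms unfolding rel_exact_def short_exact_def is_kernel_def by blast+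

lemma exact_rel_subgroup: "subgroup (exact_rel Y) free_iso"
  unfolding exact_rel_def
proof (rule group.generate_is_subgroup[OF group_free_Abelian_group], clarify)
  fix M N L :: "('a::order, 'b::field) pmod" and f g
  assume "rel_exact Y M f N g L"
  note p = rel_exact_pmods[OF this]
  have "Poly_Mapping.keys (frag_of (iso_class M) - frag_of (iso_class N) + frag_of (iso_class L)) \<subseteq> iso_classes"
    using keys_cls[OF p(1)] keys_cls[OF p(2)] keys_cls[OF p(3)]
      keys_add[of "frag_of (iso_class M) - frag_of (iso_class N)" "frag_of (iso_class L)"]
      keys_diff[of "frag_of (iso_class M)" "frag_of (iso_class N)"] by blast
  then show "frag_of (iso_class M) - frag_of (iso_class N) + frag_of (iso_class L) \<in> carrier free_iso"
    by simp
qed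

lemma exact_rel_keys: "c \<in> exact_rel Y \<Longrightarrow> Poly_Mapping.keys c \<subseteq> iso_classes"
  using subgroup.mem_carrier[OF exact_rel_subgroup] by fastforce

lemma exact_rel_0: "0 \<in> exact_rel Y"
  using subgroup.one_closed[OF exact_rel_subgroup] by simp

lemma exact_rel_add: "c \<in> exact_rel Y \<Longrightarrow> d \<in> exact_rel Y \<Longrightarrow> c + d \<in> exact_rel Y"
  using subgroup.m_closed[OF exact_rel_subgroup] by simp

lemma exact_rel_minus: "c \<in> exact_rel Y \<Longrightarrow> - c \<in> exact_rel Y"
  using subgroup.m_inv_closed[OF exact_rel_subgroup, of c] exact_rel_keys[of c] by simp

lemma exact_rel_diff: "c \<in> exact_rel Y \<Longrightarrow> d \<in> exact_rel Y \<Longrightarrow> c - d \<in> exact_rel Y"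
  using exact_rel_add[OF _ exact_rel_minus] by force

lemma exact_rel_gen:
  "rel_exact Y M f N g L \<Longrightarrow> frag_of (iso_class M) - frag_of (iso_class N) + frag_of (iso_class L) \<in> exact_rel Y"
  unfolding exact_rel_def by (rule generate.incl) blast

text \<open>Split sequences are exact relative to every class of modules.\<close>

lemma rel_exact_dsum:
  fixes M N :: "('p::order, 'k::field) pmod"
  assumes M: "is_pmod M" and N: "is_pmod N"
  shows "rel_exact Y M (dsum_inl M N) (pm_dsum M N) (dsum_snd M N) N"
proof -
  note D = is_pmod_dsum[OF M N] and inl = dsum_inl_hom[OF M N] and inr = dsum_inr_hom[OF M N]
    and fst = dsum_fst_hom[OF M N] and snd = dsum_snd_hom[OF M N]
  have "is_kernel M (dsum_inl M N) (pm_dsum M N) (dsum_snd M N) N"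
    unfolding is_kernel_iff
  proof (intro conjI allI impI M N D inl snd)
    show "w = 0" if "supp (vdim M p) w" "mv (dsum_inl M N p) w = 0" for p w
      using mv_dsum_inl[OF that(1)] that(2) by simp
    show "(mv (dsum_snd M N p) v = 0) = (\<exists>w. supp (vdim M p) w \<and> mv (dsum_inl M N p) w = v)"
      if v: "supp (vdim (pm_dsum M N) p) v" for p v
    proof
      assume z: "mv (dsum_snd M N p) v = 0"
      have "supp (vdim M p + vdim N p) v" using v by simp
      from dsum_decompose[OF this] z have "mv (dsum_inl M N p) (mv (dsum_fst M N p) v) = v" by simp
      moreover have "supp (vdim M p) (mv (dsum_fst M N p) v)" by (rule supp_mv[OF pm_hom_carrier[OF fst]])
      ultimately show "\<exists>w. supp (vdim M p) w \<and> mv (dsum_inl M N p) w = v" by blast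
    next
      assume "\<exists>w. supp (vdim M p) w \<and> mv (dsum_inl M N p) w = v"
      then obtain w where w: "supp (vdim M p) w" "v = mv (dsum_inl M N p) w" by blast
      show "mv (dsum_snd M N p) v = 0" unfolding w(2) by (rule dsum_relations(2)[OF w(1)])
    qed
  qed
  moreover have "pm_epi (dsum_snd M N)"
    unfolding pm_epi_iff[OF snd]
  proof (intro allI impI)
    fix p and v :: "nat \<Rightarrow> 'k" assume v: "supp (vdim N p) v"
    show "\<exists>w. supp (vdim (pm_dsum M N) p) w \<and> mv (dsum_snd M N p) w = v"
      using dsum_relations(4)[OF v] supp_mv[OF pm_hom_carrier[OF inr]] by blast
  qed
  moreover have "\<exists>k\<in>pm_hom R (pm_dsum M N). pm_comp (dsum_snd M N) k = h"
    if R: "is_pmod R" and h: "h \<in> pm_hom R N" for R h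
  proof (rule bexI)
    show k: "pm_comp (dsum_inr M N) h \<in> pm_hom R (pm_dsum M N)" by (rule pm_comp_hom[OF R N D inr h])
    show "pm_comp (dsum_snd M N) (pm_comp (dsum_inr M N) h) = h"
      by (rule pm_hom_ext[OF pm_comp_hom[OF R D N snd k] h])
        (simp add: mv_pm_comp[OF snd k] mv_pm_comp[OF inr h] dsum_relations supp_mv[OF pm_hom_carrier[OF h]])
  qed
  ultimately show ?thesis unfolding rel_exact_def short_exact_def by blast
qed

text \<open>For a zero module the constant sequence is exact; its relation says that the class of a zero module is zero.\<close>

lemma rel_exact_zero:
  fixes M :: "('p::order, 'k::field) pmod"
  assumes M: "is_pmod M" and z: "is_zero_pmod M"
  shows "rel_exact Y M (pm_id M) M (pm_id M) M"
proof -
  note id = pm_id_hom[OF M]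
  have v0: "v = 0" if "supp (vdim M p) v" for p and v :: "nat \<Rightarrow> 'k"
    using z that by (simp add: is_zero_pmod_def)
  have ex: "\<exists>w. supp (vdim M p) w \<and> mv (pm_id M p) w = v" if "supp (vdim M p) v" for p and v :: "nat \<Rightarrow> 'k"
    using v0[OF that] by (intro exI[of _ 0]) simp
  have "is_kernel M (pm_id M) M (pm_id M) M"
    unfolding is_kernel_iff
  proof (intro conjI allI impI M id)
    show "w = 0" if "supp (vdim M p) w" for p and w :: "nat \<Rightarrow> 'k" by (rule v0[OF that])
    show "(mv (pm_id M p) v = 0) = (\<exists>w. supp (vdim M p) w \<and> mv (pm_id M p) w = v)"
      if "supp (vdim M p) v" for p and v :: "nat \<Rightarrow> 'k" using ex[OF that] v0[OF that] by simp
  qed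
  moreover have "pm_epi (pm_id M)" unfolding pm_epi_iff[OF id] using ex by blast
  ultimately show ?thesis
    unfolding rel_exact_def short_exact_def using pm_id_left by blast
qed

lemma dim_sections_exact:
  fixes M :: "('p::{finite, order}, 'k::field) pmod"
  shows "fvs.dim (sections S M) = fvs.dim {s \<in> sections S M. act f s = 0} + fvs.dim (act f ` sections S M)"
  by (rule dim_exact[OF act_linear subspace_sections refl refl sections_support(1)]) (rule sections_support(2))

context directed_spreads
begin

definition hom_dim :: "'p set \<Rightarrow> ('p, 'k) pmod \<Rightarrow> nat" where
  "hom_dim S M = fvs.dim (sections S M)"

lemma dim_zero_space: "fvs.dim {0 :: 'p \<times> nat \<Rightarrow> 'k} = 0"
  using fvs.dim_eq_card[of "{}" "{0}"] by (simp add: fvs.span_zero fvs.independent_empty)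

lemma hom_dim_inj_image:
  assumes "is_pmod M" "is_pmod N" "f \<in> pm_hom M N" 
    and inj: "\<And>s. s \<in> sections S M \<Longrightarrow> act f s = 0 \<Longrightarrow> s = 0"
  shows "fvs.dim (act f ` sections S M) = hom_dim S M"
proof -
  have "{s \<in> sections S M. act f s = 0} = {0}" using inj sections_zero act_0 by auto
  then show ?thesis
    using dim_sections_exact[of S M f] by (simp add: dim_zero_space hom_dim_def)
qed

text \<open>Relative exactness says precisely that Hom from the spread module on S stays exact, so its
  dimension is additive.\<close>

lemma hom_dim_exact:
  assumes ex: "rel_exact spm_classes M f N g L" and S: "S \<in> SS"
  shows "hom_dim S N = hom_dim S M + hom_dim S L"
proof -
  note p = rel_exact_pmods[OF ex]
  have mono: "\<And>p w. supp (vdim M p) w \<Longrightarrow> mv (f p) w = 0 \<Longrightarrow> w = 0"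
    and ker: "\<And>p v. supp (vdim N p) v \<Longrightarrow> (mv (g p) v = 0) = (\<exists>w. supp (vdim M p) w \<and> mv (f p) w = v)"
    using ex unfolding rel_exact_def short_exact_def is_kernel_iff by auto
  have inj: "s = 0" if s: "s \<in> sections S M" "act f s = 0" for s
  proof (rule eq_by_curry)
    fix p
    have "mv (f p) (curry s p) = 0" using s(2) curry_act[of f s p] by (simp del: curry_conv curry_act)
    then have "curry s p = 0" using mono[OF sectionsD(1)[OF s(1)]] by blast
    then show "curry s p = curry 0 p" by (simp del: curry_conv)
  qed
  have image: "act f ` sections S M = {s \<in> sections S N. act g s = 0}"
  proof (intro equalityI subsetI)
    fix t assume "t \<in> act f ` sections S M"
    then obtain s where s: "s \<in> sections S M" "t = act f s" by blast
    have "act g t = 0"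
    proof (rule eq_by_curry)
      fix p
      have "mv (g p) (mv (f p) (curry s p)) = 0"
        using ker[OF supp_mv[OF pm_hom_carrier[OF p(4)]]] sectionsD(1)[OF s(1), of p] by blast
      then show "curry (act g t) p = curry 0 p" by (simp add: s(2) del: curry_conv)
    qed
    then show "t \<in> {s \<in> sections S N. act g s = 0}" using act_sections[OF p(1,2,4) s(1)] s(2) by simp
  next
    fix t assume "t \<in> {s \<in> sections S N. act g s = 0}"
    then have t: "t \<in> sections S N" "act g t = 0" by auto
    have "\<exists>w. supp (vdim M p) w \<and> mv (f p) w = curry t p" for p
    proof -
      have "mv (g p) (curry t p) = 0" using t(2) curry_act[of g t p] by (simp del: curry_conv curry_act)
      then show ?thesis using ker[OF sectionsD(1)[OF t(1)]] by blast
    qed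
    then obtain w where w: "\<And>p. supp (vdim M p) (w p)" "\<And>p. mv (f p) (w p) = curry t p" by metis
    let ?s = "\<lambda>(p, i). w p i"
    have c: "curry ?s p = w p" for p by (simp add: fun_eq_iff)
    have "?s \<in> sections S M"
    proof (rule sectionsI)
      show "supp (vdim M p) (curry ?s p)" for p unfolding c by (rule w(1))
      show "curry ?s p = 0" if "p \<notin> S" for p
        unfolding c using mono[OF w(1)] w(2)[of p] sectionsD(2)[OF t(1) that] by simp
      show "mv (tmap M q r) (curry ?s q) = curry ?s r" if "q \<in> S" "q \<le> r" for q r
      proof -
        have "mv (f r) (mv (tmap M q r) (w q)) = mv (f r) (w r)"
          using pm_hom_mv[OF p(1,2,4) that(2), of "w q"] sectionsD(3)[OF t(1) that] by (simp add: w(2))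
        then have "mv (f r) (mv (tmap M q r) (w q) - w r) = 0" by (simp add: mv_diff)
        moreover have "supp (vdim M r) (mv (tmap M q r) (w q) - w r)"
          using supp_mv[OF pmod_carrier[OF p(1) that(2)], of "w q"] w(1)[of r] by (simp add: supp_def)
        ultimately have "mv (tmap M q r) (w q) - w r = 0" using mono by blast
        then show ?thesis unfolding c by simp
      qed
    qed
    moreover have "act f ?s = t" by (rule eq_by_curry) (simp only: curry_act c w(2))
    ultimately show "t \<in> act f ` sections S M" by blast
  qed
  have onto: "act g ` sections S N = sections S L"
  proof
    show "act g ` sections S N \<subseteq> sections S L" using act_sections[OF p(2,3,5)] by blast
    have "iso_class (spm S) \<in> spm_classes" using S by blast
    then show "sections S L \<subseteq> act g ` sections S N"
      using ex is_pmod_spm[OF S] lift_spread_iff[OF convex[OF S] p(2,3,5)] unfolding rel_exact_def by blast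
  qed
  have "hom_dim S N = fvs.dim {s \<in> sections S N. act g s = 0} + hom_dim S L"
    unfolding hom_dim_def onto[symmetric] by (rule dim_sections_exact)
  moreover have "fvs.dim (act f ` sections S M) = hom_dim S M"
    by (rule hom_dim_inj_image[OF p(1,2,4)]) (rule inj)
  ultimately show ?thesis using image by simp
qed

lemma hom_dim_iso:
  assumes M: "is_pmod M" and N: "is_pmod N" and iso: "pm_isomorphic M N"
  shows "hom_dim S M = hom_dim S N"
proof -
  obtain f g where fg: "f \<in> pm_hom M N" "g \<in> pm_hom N M" "pm_comp g f = pm_id M" "pm_comp f g = pm_id N"
    using iso unfolding pm_isomorphic_def pm_isomorphism_def by blast
  have gf: "act g (act f s) = s" if "s \<in> sections S M" for s
    using act_pm_comp[OF fg(2,1), of s] fg(3) act_pm_id[OF that] by simp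
  have fg': "act f (act g s) = s" if "s \<in> sections S N" for s
    using act_pm_comp[OF fg(1,2), of s] fg(4) act_pm_id[OF that] by simp
  have "act f ` sections S M = sections S N"
  proof (intro equalityI subsetI)
    fix s assume "s \<in> act f ` sections S M"
    then show "s \<in> sections S N" using act_sections[OF M N fg(1)] by blast
  next
    fix s assume s: "s \<in> sections S N"
    show "s \<in> act f ` sections S M"
      using imageI[OF act_sections[OF N M fg(2) s], of "act f"] unfolding fg'[OF s] .
  qed
  moreover have "fvs.dim (act f ` sections S M) = hom_dim S M"
  proof (rule hom_dim_inj_image[OF M N fg(1)])
    fix s assume "s \<in> sections S M" "act f s = 0"
    then show "s = 0" using gf[of s] by (simp add: act_0)
  qed
  ultimately show ?thesis by (simp add: hom_dim_def)
qed

text \<open>Together with the next lemma: the matrix of the dimensions of Hom between the spread modules of the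
  family is unitriangular with respect to the rank.\<close>

lemma hom_dim_spm_self:
  assumes S: "S \<in> SS" shows "hom_dim S (spm S) = 1"
proof -
  have ne: "unit_sec S \<noteq> (0 :: 'p \<times> nat \<Rightarrow> 'k)"
  proof
    assume z: "unit_sec S = (0 :: 'p \<times> nat \<Rightarrow> 'k)"
    obtain p where "p \<in> S" using nonempty[OF S] by blast
    then show False using fun_cong[OF z, of "(p, 0)"] by (simp add: unit_sec_def)
  qed
  have "sections S (spm S) = fvs.span {unit_sec S}"
  proof
    show "sections S (spm S) \<subseteq> fvs.span {unit_sec S}"
      using scalar[OF S S] by (auto intro: fvs.span_scale fvs.span_base)
    show "fvs.span {unit_sec S} \<subseteq> sections S (spm S)"
      by (rule fvs.span_minimal[OF _ subspace_sections]) (simp add: unit_sec_sections)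
  qed
  then show ?thesis
    unfolding hom_dim_def using fvs.dim_eq_card[of "{unit_sec S}" "sections S (spm S)"] ne
    by (simp add: fvs.dependent_single fvs.span_span)
qed

lemma hom_dim_spm_nonzero:
  assumes "S \<in> SS" "T \<in> SS" "hom_dim S (spm T) \<noteq> 0"
  shows "S = T \<or> rk S < rk T"
proof (rule ccontr)
  assume "\<not> ?thesis"
  then have "\<not> leads S T" using directed assms by blast
  then have "sections S (spm T) = {0}" using sections_spm[OF assms(1,2)] sections_zero by blast
  then show False using assms(3) dim_zero_space by (simp add: hom_dim_def)
qed

definition hom_dim_class :: "'p set \<Rightarrow> ('p, 'k) pmod set \<Rightarrow> nat" where
  "hom_dim_class S c = hom_dim S (SOME M. is_pmod M \<and> iso_class M = c)"

lemma hom_dim_class_iso_class: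
  assumes M: "is_pmod M" shows "hom_dim_class S (iso_class M) = hom_dim S M"
proof -
  let ?N = "SOME N. is_pmod N \<and> iso_class N = iso_class M"
  have N: "is_pmod ?N \<and> iso_class ?N = iso_class M" by (rule someI[of _ M]) (use M in simp)
  then have "pm_isomorphic ?N M" using iso_class_eq_iff M by blast
  then show ?thesis unfolding hom_dim_class_def using hom_dim_iso N M by blast
qed

text \<open>The linear extension to formal sums of modules of the vector of the dimensions of the Hom spaces from the
  spread modules of the family.\<close>

definition dimvec :: "(('p, 'k) pmod set \<Rightarrow>\<^sub>0 int) \<Rightarrow> ('p set \<Rightarrow>\<^sub>0 int)" where
  "dimvec = frag_extend (\<lambda>c. \<Sum>S\<in>SS. frag_cmul (int (hom_dim_class S c)) (frag_of S))"

lemma finite_SS: "finite SS"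
  by simp

lemma lookup_comb:
  assumes "finite I" "S \<in> I"
  shows "Poly_Mapping.lookup (\<Sum>T\<in>I. frag_cmul (a T) (frag_of T)) S = a S"
proof -
  have "Poly_Mapping.lookup (\<Sum>T\<in>I. frag_cmul (a T) (frag_of T)) S = (\<Sum>T\<in>I. a T * (if T = S then 1 else 0))"
    unfolding lookup_sum lookup_frag_cmul by (rule sum.cong) (auto simp: lookup_single when_def)
  also have "\<dots> = a S" using assms by (simp add: if_distrib[of "\<lambda>t. _ * t"] cong: if_cong)
  finally show ?thesis .
qed

lemma lookup_dimvec:
  assumes "is_pmod M" "S \<in> SS"
  shows "Poly_Mapping.lookup (dimvec (frag_of (iso_class M))) S = int (hom_dim S M)"
  unfolding dimvec_def frag_extend_of using lookup_comb[OF finite_SS assms(2)] hom_dim_class_iso_class[OF assms(1)] by simp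

lemma dimvec_add: "dimvec (c + d) = dimvec c + dimvec d"
  unfolding dimvec_def by (rule frag_extend_add)
lemma dimvec_diff: "dimvec (c - d) = dimvec c - dimvec d"
  unfolding dimvec_def by (rule frag_extend_diff)
lemma dimvec_minus: "dimvec (- c) = - dimvec c"
  unfolding dimvec_def by (rule frag_extend_minus)
lemma dimvec_0: "dimvec 0 = 0"
  unfolding dimvec_def by (rule frag_extend_0)

lemma dimvec_exact_rel:
  assumes "c \<in> exact_rel spm_classes" "S \<in> SS"
  shows "Poly_Mapping.lookup (dimvec c) S = 0"
proof -
  have gen: "Poly_Mapping.lookup (dimvec h) S = 0 \<and> Poly_Mapping.keys h \<subseteq> iso_classes"
    if h: "h \<in> {frag_of (iso_class M) - frag_of (iso_class N) + frag_of (iso_class L) | M N L.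
      \<exists>f g. rel_exact spm_classes M f N g L}" for h
  proof -
    obtain M N L f g where e: "rel_exact spm_classes M f N g L"
      and h': "h = frag_of (iso_class M) - frag_of (iso_class N) + frag_of (iso_class L)" using h by blast
    note p = rel_exact_pmods[OF e]
    have "h \<in> exact_rel spm_classes" unfolding h' by (rule exact_rel_gen[OF e])
    then have "Poly_Mapping.keys h \<subseteq> iso_classes" by (rule exact_rel_keys)
    moreover have "Poly_Mapping.lookup (dimvec h) S = 0"
      unfolding h' dimvec_add dimvec_diff lookup_add lookup_minus
      using lookup_dimvec[OF p(1) assms(2)] lookup_dimvec[OF p(2) assms(2)] lookup_dimvec[OF p(3) assms(2)]
        hom_dim_exact[OF e assms(2)] by simp
    ultimately show ?thesis by simp
  qed
  show ?thesis
    using assms(1) unfolding exact_rel_def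
  proof (induction rule: generate.induct)
    case one
    then show ?case by (simp add: dimvec_0)
  next
    case (incl h)
    then show ?case using gen by blast
  next
    case (inv h)
    then show ?case using gen[of h] by (simp add: dimvec_minus)
  next
    case (eng h1 h2)
    then show ?case by (simp add: dimvec_add lookup_add)
  qed
qed

definition comb :: "('p set \<Rightarrow> int) \<Rightarrow> (('p, 'k) pmod set \<Rightarrow>\<^sub>0 int)" where
  "comb a = (\<Sum>T\<in>SS. frag_cmul (a T) (frag_of (iso_class (spm T))))"

lemma comb_diff: "comb (\<lambda>T. a T - b T) = comb a - comb b"
  unfolding comb_def by (simp add: frag_cmul_diff_distrib sum_subtractf)

lemma comb_0: "comb (\<lambda>_. 0) = 0"
  unfolding comb_def by simp

lemma comb_single: "S \<in> SS \<Longrightarrow> comb (\<lambda>T. if T = S then 1 else 0) = frag_of (iso_class (spm S))"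
  unfolding comb_def by (simp add: if_distrib[of "\<lambda>t. frag_cmul t _"] cong: if_cong)

lemma keys_comb: "Poly_Mapping.keys (comb a) \<subseteq> iso_classes"
proof -
  have "comb a \<in> carrier free_iso"
    unfolding comb_def
    by (rule sum_closed_free_Abelian_group) (use is_pmod_spm in \<open>auto simp: iso_classes_def\<close>)
  then show ?thesis by simp
qed

lemma lookup_dimvec_comb:
  assumes "S \<in> SS"
  shows "Poly_Mapping.lookup (dimvec (comb a)) S = (\<Sum>T\<in>SS. a T * int (hom_dim S (spm T)))"
proof -
  have "dimvec (comb a) = (\<Sum>T\<in>SS. frag_cmul (a T) (dimvec (frag_of (iso_class (spm T)))))"
    unfolding comb_def dimvec_def by (simp add: frag_extend_sum[OF finite_SS] frag_extend_cmul)
  then show ?thesis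
    using assms by (simp add: lookup_sum lookup_dimvec is_pmod_spm)
qed

text \<open>Formal sums that the exact relations reduce to a combination of the spread modules of the family.\<close>

definition reducible :: "(('p, 'k) pmod set \<Rightarrow>\<^sub>0 int) \<Rightarrow> bool" where
  "reducible c \<longleftrightarrow> (\<exists>a. c - comb a \<in> exact_rel spm_classes)"

lemma reducible_diff: "reducible c \<Longrightarrow> reducible d \<Longrightarrow> reducible (c - d)"
proof -
  assume "reducible c" "reducible d"
  then obtain a b where "c - comb a \<in> exact_rel spm_classes" "d - comb b \<in> exact_rel spm_classes" unfolding reducible_def by blast
  then have "(c - comb a) - (d - comb b) \<in> exact_rel spm_classes" by (rule exact_rel_diff)
  then have "c - d - comb (\<lambda>T. a T - b T) \<in> exact_rel spm_classes" by (simp add: comb_diff algebra_simps)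
  then show ?thesis unfolding reducible_def by blast
qed

lemma reducible_exact: "c \<in> exact_rel spm_classes \<Longrightarrow> reducible c"
  unfolding reducible_def using comb_0 by (metis diff_zero)

lemma reducible_0: "reducible 0"
  by (rule reducible_exact[OF exact_rel_0])

lemma reducible_add: "reducible c \<Longrightarrow> reducible d \<Longrightarrow> reducible (c + d)"
  using reducible_diff[of c "0 - d"] reducible_diff[OF reducible_0, of d] by simp

lemma reducible_spm: "S \<in> SS \<Longrightarrow> reducible (frag_of (iso_class (spm S)))"
  unfolding reducible_def using comb_single[of S] exact_rel_0 by (metis cancel_comm_monoid_add_class.diff_cancel)

lemma reducible_zero: "is_pmod M \<Longrightarrow> is_zero_pmod M \<Longrightarrow> reducible (frag_of (iso_class M))"
  using reducible_exact[OF exact_rel_gen[OF rel_exact_zero]] by simp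

lemma reducible_sum: "set Ts \<subseteq> SS \<Longrightarrow> reducible (frag_of (iso_class (foldr pm_dsum (map spm Ts) zero_pmod)))"
proof (induction Ts)
  case Nil
  have "is_zero_pmod (zero_pmod :: ('p, 'k) pmod)" by (simp add: is_zero_pmod_def zero_pmod_def)
  then show ?case using reducible_zero[OF is_pmod_zero] by simp
next
  case (Cons T Ts)
  let ?R = "foldr pm_dsum (map spm Ts) zero_pmod"
  have T: "is_pmod (spm T)" using Cons.prems is_pmod_spm by simp
  have R: "is_pmod ?R" by (rule is_pmod_foldr_dsum) (use Cons.prems is_pmod_spm in auto)
  let ?t = "frag_of (iso_class (spm T))" and ?r = "frag_of (iso_class ?R)" and ?d = "frag_of (iso_class (pm_dsum (spm T) ?R))"
  have "reducible (?t - ?d + ?r)" by (rule reducible_exact[OF exact_rel_gen[OF rel_exact_dsum[OF T R]]])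
  moreover have "reducible (?t + ?r)" using Cons reducible_add reducible_spm by simp
  ultimately have "reducible ((?t + ?r) - (?t - ?d + ?r))" by (rule reducible_diff[rotated])
  then show ?case by simp
qed

text \<open>Induction along a resolution: the approximation is a direct sum of spread modules, and the syzygy has a smaller
  rank bound.\<close>

lemma reducible_module:
  assumes "is_pmod M" shows "reducible (frag_of (iso_class M))"
proof -
  have "reducible (frag_of (iso_class M))" if "below t M" "is_pmod M" for t
    using that
  proof (induction t arbitrary: M)
    case 0
    then show ?case using below_0_iff reducible_zero by blast
  next
    case (Suc t)
    from minimal_approximation_step[OF Suc.prems(2)] show ?case
    proof cases
      case (1 Ts R r Z i)
      have r: "r \<in> pm_hom R M" and Z: "is_pmod Z" and R: "is_pmod R" using 1(4) unfolding is_kernel_def by auto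
      have "lifts R r M A" if A: "is_pmod A" "iso_class A \<in> spm_classes" for A
        by (rule lifts_in_spm_classes[OF R Suc.prems(2) r 1(6) A])
      then have "rel_exact spm_classes Z i R r M"
        unfolding rel_exact_def short_exact_def lifts_def using 1(4,5) by blast
      then have e: "reducible (frag_of (iso_class Z) - frag_of (iso_class R) + frag_of (iso_class M))"
        by (rule reducible_exact[OF exact_rel_gen])
      have "reducible (frag_of (iso_class R))" unfolding 1(2) by (rule reducible_sum[OF 1(1)])
      moreover have "reducible (frag_of (iso_class Z))" using Suc.IH[OF 1(7)[OF Suc.prems(1)] Z] .
      ultimately have "reducible (frag_of (iso_class Z) - frag_of (iso_class R) + frag_of (iso_class M)
          - (frag_of (iso_class Z) - frag_of (iso_class R)))"
        using e reducible_diff by blast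
      then show ?thesis by simp
    qed
  qed
  then show ?thesis using below_exists assms by blast
qed

lemma reducible_all:
  assumes "Poly_Mapping.keys c \<subseteq> iso_classes" shows "reducible c"
  using assms
  by (induction rule: frag_induction)
    (auto simp: reducible_0 reducible_diff iso_classes_def intro: reducible_module)

text \<open>Unitriangularity over the integers: at a spread of maximal rank with nonzero coefficient only that
  coefficient contributes.\<close>

lemma comb_zero_if_dimvec_zero:
  assumes z: "\<And>S. S \<in> SS \<Longrightarrow> Poly_Mapping.lookup (dimvec (comb a)) S = 0"
  shows "comb a = 0"
proof -
  have "a T = 0" if "T \<in> SS" for T
  proof (rule ccontr)
    assume "a T \<noteq> 0"
    then have "{T \<in> SS. a T \<noteq> 0} \<noteq> {}" using that by blast
    then obtain U where U: "U \<in> SS" "a U \<noteq> 0" and max: "\<And>T. T \<in> SS \<Longrightarrow> a T \<noteq> 0 \<Longrightarrow> rk T \<le> rk U"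
    proof -
      let ?A = "{T \<in> SS. a T \<noteq> 0}"
      have "Max (rk ` ?A) \<in> rk ` ?A" using \<open>?A \<noteq> {}\<close> by (intro Max_in) auto
      then obtain U where U: "U \<in> ?A" "rk U = Max (rk ` ?A)" by auto
      then have "rk T \<le> rk U" if "T \<in> ?A" for T using that by simp
      with U(1) that show ?thesis by blast
    qed
    have "(\<Sum>T\<in>SS. a T * int (hom_dim U (spm T))) = (\<Sum>T\<in>SS. if T = U then a U else 0)"
    proof (rule sum.cong[OF refl])
      fix T assume T: "T \<in> SS"
      show "a T * int (hom_dim U (spm T)) = (if T = U then a U else 0)"
        using hom_dim_spm_nonzero[OF U(1) T] max[OF T] hom_dim_spm_self[OF U(1)] by (cases "T = U") force+
    qed
    also have "\<dots> = a U" using U(1) by simp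
    finally show False using z[OF U(1)] U lookup_dimvec_comb[OF U(1), of a] by simp
  qed
  then show ?thesis unfolding comb_def by simp
qed

text \<open>The triangular system is solved from the highest rank downwards, one rank at a time.\<close>

lemma comb_dimvec_onto:
  "\<exists>a. \<forall>S\<in>SS. Poly_Mapping.lookup (dimvec (comb a)) S = b S"
proof -
  obtain N where N: "\<And>S. S \<in> SS \<Longrightarrow> rk S < N" using rk_bounded by blast
  have "\<exists>a. \<forall>S\<in>SS. N - t \<le> rk S \<longrightarrow> (\<Sum>T\<in>SS. a T * int (hom_dim S (spm T))) = b S" for t
  proof (induction t)
    case 0
    then show ?case using N by force
  next
    case (Suc t)
    then obtain a where a: "\<And>S. S \<in> SS \<Longrightarrow> N - t \<le> rk S \<Longrightarrow> (\<Sum>T\<in>SS. a T * int (hom_dim S (spm T))) = b S" by blast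
    show ?case
    proof (cases "t < N")
      case False
      then show ?thesis using a by (intro exI[of _ a]) auto
    next
      case True
      let ?m = "N - Suc t"
      let ?old = "\<lambda>S. \<Sum>T\<in>SS. a T * int (hom_dim S (spm T))"
      \<comment> \<open>correcting the coefficients of rank m does not disturb the equations of higher rank\<close>
      let ?a = "\<lambda>T. a T + (if rk T = ?m then b T - ?old T else 0)"
      have "(\<Sum>T\<in>SS. ?a T * int (hom_dim S (spm T))) = b S" if S: "S \<in> SS" "?m \<le> rk S" for S
      proof -
        have "(\<Sum>T\<in>SS. ?a T * int (hom_dim S (spm T)))
          = ?old S + (\<Sum>T\<in>SS. (if rk T = ?m then b T - ?old T else 0) * int (hom_dim S (spm T)))"
          by (simp add: distrib_right sum.distrib)
        also have "(\<Sum>T\<in>SS. (if rk T = ?m then b T - ?old T else 0) * int (hom_dim S (spm T)))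
          = (\<Sum>T\<in>SS. if T = S then (if rk S = ?m then b S - ?old S else 0) else 0)"
        proof (rule sum.cong[OF refl])
          fix T assume T: "T \<in> SS"
          show "(if rk T = ?m then b T - ?old T else 0) * int (hom_dim S (spm T))
            = (if T = S then (if rk S = ?m then b S - ?old S else 0) else 0)"
          proof (cases "T = S")
            case True
            then show ?thesis using hom_dim_spm_self[OF S(1)] by simp
          next
            case False
            then have "rk T \<noteq> ?m \<or> hom_dim S (spm T) = 0" using hom_dim_spm_nonzero[OF S(1) T] S(2) by fastforce
            then show ?thesis using False by auto
          qed
        qed
        also have "\<dots> = (if rk S = ?m then b S - ?old S else 0)" using S(1) by simp
        also have "?old S + \<dots> = b S" using a[OF S(1)] S(2) True by (cases "rk S = ?m") auto
        finally show ?thesis .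
      qed
      then show ?thesis by (intro exI[of _ ?a]) blast
    qed
  qed
  from this[of N] obtain a where "\<forall>S\<in>SS. (\<Sum>T\<in>SS. a T * int (hom_dim S (spm T))) = b S" by auto
  then show ?thesis by (intro exI[of _ a]) (simp add: lookup_dimvec_comb)
qed

text \<open>The exact relations are all the relations that the dimension vector satisfies: a formal sum reduces
  to a combination of spread modules with the same dimension vector, and such a combination is determined by it.\<close>

lemma exact_rel_eq: "exact_rel spm_classes = {c. Poly_Mapping.keys c \<subseteq> iso_classes \<and> (\<forall>S\<in>SS. Poly_Mapping.lookup (dimvec c) S = 0)}"
proof (intro equalityI subsetI)
  fix c assume "c \<in> exact_rel spm_classes"
  then show "c \<in> {c. Poly_Mapping.keys c \<subseteq> iso_classes \<and> (\<forall>S\<in>SS. Poly_Mapping.lookup (dimvec c) S = 0)}"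
    using exact_rel_keys dimvec_exact_rel by blast
next
  fix c assume "c \<in> {c. Poly_Mapping.keys c \<subseteq> iso_classes \<and> (\<forall>S\<in>SS. Poly_Mapping.lookup (dimvec c) S = 0)}"
  then have c: "Poly_Mapping.keys c \<subseteq> iso_classes" "\<And>S. S \<in> SS \<Longrightarrow> Poly_Mapping.lookup (dimvec c) S = 0" by auto
  obtain a where a: "c - comb a \<in> exact_rel spm_classes" using reducible_all[OF c(1)] unfolding reducible_def by blast
  have "comb a = 0"
  proof (rule comb_zero_if_dimvec_zero)
    fix S assume S: "S \<in> SS"
    show "Poly_Mapping.lookup (dimvec (comb a)) S = 0"
      using dimvec_exact_rel[OF a S] c(2)[OF S] by (simp add: dimvec_diff lookup_minus)
  qed
  then show "c \<in> exact_rel spm_classes" using a by simp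
qed

lemma inj_iso_class_spm: "inj_on (\<lambda>S. iso_class (spm S)) SS"
proof (rule inj_onI)
  fix S T assume S: "S \<in> SS" and T: "T \<in> SS" and eq: "iso_class (spm S) = iso_class (spm T)"
  have iso: "pm_isomorphic (spm S) (spm T)" using eq iso_class_eq_iff is_pmod_spm S T by blast
  have "p \<in> S \<longleftrightarrow> p \<in> T" for p
    using pm_isomorphic_vdim_eq_0[OF iso, of p] pm_isomorphic_vdim_eq_0[OF pm_isomorphic_sym[OF iso], of p]
    by (cases "p \<in> S"; cases "p \<in> T") simp_all
  then show "S = T" by blast
qed

theorem K0_rel_iso: "K0_rel spm_classes \<cong> Z_pow (card spm_classes)"
proof -
  let ?n = "card spm_classes"
  have "card SS = ?n" using card_image[OF inj_iso_class_spm] by simp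
  then obtain h where h: "bij_betw h {..<?n} SS"
    using ex_bij_betw_nat_finite[OF finite_SS] by (auto simp: atLeast0LessThan)
  have hS: "h i \<in> SS" if "i < ?n" for i using h that by (auto simp: bij_betw_def)
  define \<Phi> where "\<Phi> = (\<lambda>c. \<lambda>i\<in>{..<?n}. Poly_Mapping.lookup (dimvec c) (h i))"
  have carZ: "carrier (Z_pow ?n) = (\<Pi>\<^sub>E i\<in>{..<?n}. UNIV)" "\<one>\<^bsub>Z_pow ?n\<^esub> = (\<lambda>i\<in>{..<?n}. 0)"
    by (simp_all add: Z_pow_def)
  have gZ: "group (Z_pow ?n)" unfolding Z_pow_def by simp
  have hom: "\<Phi> \<in> hom free_iso (Z_pow ?n)"
  proof (rule homI)
    fix c d :: "('p, 'k) pmod set \<Rightarrow>\<^sub>0 int"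
    show "\<Phi> c \<in> carrier (Z_pow ?n)" unfolding carZ \<Phi>_def by simp
    show "\<Phi> (c \<otimes>\<^bsub>free_iso\<^esub> d) = \<Phi> c \<otimes>\<^bsub>Z_pow ?n\<^esub> \<Phi> d"
      by (auto simp: \<Phi>_def Z_pow_def dimvec_add lookup_add fun_eq_iff)
  qed
  have gh: "group_hom free_iso (Z_pow ?n) \<Phi>"
    unfolding group_hom_def group_hom_axioms_def by (intro conjI group_free_Abelian_group gZ hom)
  have ker: "Coset.kernel free_iso (Z_pow ?n) \<Phi> = exact_rel spm_classes"
  proof -
    have img: "SS = h ` {..<?n}" using h by (simp add: bij_betw_def)
    have "(\<forall>i<?n. Poly_Mapping.lookup (dimvec c) (h i) = 0) \<longleftrightarrow> (\<forall>S\<in>SS. Poly_Mapping.lookup (dimvec c) S = 0)" for c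
      by (subst img) auto
    moreover have "\<Phi> c = \<one>\<^bsub>Z_pow ?n\<^esub> \<longleftrightarrow> (\<forall>i<?n. Poly_Mapping.lookup (dimvec c) (h i) = 0)" for c
      unfolding carZ \<Phi>_def fun_eq_iff restrict_def by auto
    ultimately show ?thesis
      unfolding exact_rel_eq Coset.kernel_def by simp
  qed
  have onto: "\<Phi> ` carrier free_iso = carrier (Z_pow ?n)"
  proof
    show "\<Phi> ` carrier free_iso \<subseteq> carrier (Z_pow ?n)" unfolding carZ \<Phi>_def by (intro image_subsetI restrict_PiE_iff[THEN iffD2]) simp
    show "carrier (Z_pow ?n) \<subseteq> \<Phi> ` carrier free_iso"
    proof
      fix x assume x: "x \<in> carrier (Z_pow ?n)"
      obtain a where a: "\<forall>S\<in>SS. Poly_Mapping.lookup (dimvec (comb a)) S = x (inv_into {..<?n} h S)"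
        using comb_dimvec_onto[of "\<lambda>S. x (inv_into {..<?n} h S)"] by blast
      have "\<Phi> (comb a) = x"
      proof
        fix i
        show "\<Phi> (comb a) i = x i"
          using a hS h x unfolding carZ \<Phi>_def
          by (cases "i < ?n") (auto simp: bij_betw_def inv_into_f_f PiE_def extensional_def)
      qed
      then show "x \<in> \<Phi> ` carrier free_iso" using keys_comb by (metis carrier_free_Abelian_group_iff image_eqI)
    qed
  qed
  show ?thesis using group_hom.FactGroup_iso[OF gh onto] unfolding ker K0_rel_def .
qed

end

section \<open>The quotient map as a homological invariant\<close>

lemma split_rel_subset: "split_rel \<subseteq> exact_rel Y"
  unfolding split_rel_def
proof (rule group.generate_subgroup_incl[OF group_free_Abelian_group _ exact_rel_subgroup], rule subsetI)
  fix c :: "('a, 'b) pmod set \<Rightarrow>\<^sub>0 int"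
  assume "c \<in> {frag_of (iso_class (pm_dsum M N)) - frag_of (iso_class M) - frag_of (iso_class N) | M N.
    is_pmod M \<and> is_pmod N}"
  then obtain M N where M: "is_pmod M" and N: "is_pmod N"
    and c: "c = frag_of (iso_class (pm_dsum M N)) - frag_of (iso_class M) - frag_of (iso_class N)" by blast
  have "- (frag_of (iso_class M) - frag_of (iso_class (pm_dsum M N)) + frag_of (iso_class N)) \<in> exact_rel Y"
    by (rule exact_rel_minus[OF exact_rel_gen[OF rel_exact_dsum[OF M N]]])
  then show "c \<in> exact_rel Y" unfolding c by (simp add: algebra_simps)
qed

lemma split_rel_subgroup: "subgroup split_rel free_iso"
  unfolding split_rel_def
proof (rule group.generate_is_subgroup[OF group_free_Abelian_group])
  have "split_rel \<subseteq> carrier free_iso"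
    using split_rel_subset subgroup.subset[OF exact_rel_subgroup] by blast
  then show "{frag_of (iso_class (pm_dsum M N)) - frag_of (iso_class M) - frag_of (iso_class N) | M N.
    is_pmod M \<and> is_pmod N} \<subseteq> carrier free_iso"
    unfolding split_rel_def by (rule subset_trans[rotated]) (rule subsetI, rule generate.incl)
qed

lemma normal_free_iso: "subgroup H free_iso \<Longrightarrow> normal H free_iso"
  using comm_group.normal_iff_subgroup[OF abelian_free_Abelian_group] by blast

lemma K0_quot_coset:
  assumes a: "a \<in> carrier free_iso"
  shows "K0_quot Y (split_rel #>\<^bsub>free_iso\<^esub> a) = exact_rel Y #>\<^bsub>free_iso\<^esub> a"
proof -
  have "exact_rel Y <#>\<^bsub>free_iso\<^esub> split_rel = exact_rel Y"
  proof
    show "exact_rel Y <#>\<^bsub>free_iso\<^esub> split_rel \<subseteq> exact_rel Y"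
      using split_rel_subset exact_rel_add by (force simp: set_mult_def)
    show "exact_rel Y \<subseteq> exact_rel Y <#>\<^bsub>free_iso\<^esub> split_rel"
      using subgroup.one_closed[OF split_rel_subgroup] by (force simp: set_mult_def)
  qed
  then show ?thesis
    unfolding K0_quot_def
    using group.setmult_rcos_assoc[OF group_free_Abelian_group subgroup.subset[OF exact_rel_subgroup]
      subgroup.subset[OF split_rel_subgroup] a, of Y] by simp
qed

lemma K0_quot_epi: "K0_quot Y \<in> epi K0_split (K0_rel Y)"
proof -
  have cs: "carrier K0_split = (\<lambda>a. split_rel #>\<^bsub>free_iso\<^esub> a) ` carrier free_iso"
    by (auto simp: K0_split_def FactGroup_def RCOSETS_def)
  have ce: "carrier (K0_rel Y) = (\<lambda>a. exact_rel Y #>\<^bsub>free_iso\<^esub> a) ` carrier free_iso"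
    by (auto simp: K0_rel_def FactGroup_def RCOSETS_def)
  have img: "K0_quot Y ` carrier K0_split = carrier (K0_rel Y)"
    unfolding cs ce image_image by (rule image_cong[OF refl K0_quot_coset])
  have "K0_quot Y \<in> hom K0_split (K0_rel Y)"
  proof (rule homI)
    show "K0_quot Y C \<in> carrier (K0_rel Y)" if "C \<in> carrier K0_split" for C
      using that img by blast
    fix C D assume "C \<in> carrier (K0_split :: (('a, 'b) pmod set \<Rightarrow>\<^sub>0 int) set monoid)" "D \<in> carrier (K0_split :: (('a, 'b) pmod set \<Rightarrow>\<^sub>0 int) set monoid)"
    then obtain a b where a: "a \<in> carrier free_iso" "C = split_rel #>\<^bsub>free_iso\<^esub> a"
      and b: "b \<in> carrier free_iso" "D = split_rel #>\<^bsub>free_iso\<^esub> b" unfolding cs by blast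
    have ab: "a \<otimes>\<^bsub>free_iso\<^esub> b \<in> carrier free_iso"
      by (rule monoid.m_closed[OF group.is_monoid[OF group_free_Abelian_group] a(1) b(1)])
    have "C \<otimes>\<^bsub>K0_split\<^esub> D = split_rel #>\<^bsub>free_iso\<^esub> (a \<otimes>\<^bsub>free_iso\<^esub> b)"
      unfolding a(2) b(2) K0_split_def FactGroup_def
      using normal.rcos_sum[OF normal_free_iso[OF split_rel_subgroup] a(1) b(1)] by simp
    then have "K0_quot Y (C \<otimes>\<^bsub>K0_split\<^esub> D) = exact_rel Y #>\<^bsub>free_iso\<^esub> (a \<otimes>\<^bsub>free_iso\<^esub> b)"
      using K0_quot_coset[OF ab] by simp
    also have "\<dots> = (exact_rel Y #>\<^bsub>free_iso\<^esub> a) <#>\<^bsub>free_iso\<^esub> (exact_rel Y #>\<^bsub>free_iso\<^esub> b)"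
      using normal.rcos_sum[OF normal_free_iso[OF exact_rel_subgroup] a(1) b(1)] by simp
    also have "\<dots> = K0_quot Y C \<otimes>\<^bsub>K0_rel Y\<^esub> K0_quot Y D"
      unfolding a(2) b(2) K0_quot_coset[OF a(1)] K0_quot_coset[OF b(1)] by (simp add: K0_rel_def FactGroup_def)
    finally show "K0_quot Y (C \<otimes>\<^bsub>K0_split\<^esub> D) = K0_quot Y C \<otimes>\<^bsub>K0_rel Y\<^esub> K0_quot Y D" .
  qed
  then show ?thesis using img by (simp add: epi_def)
qed

text \<open>The projection onto a direct summand is an idempotent endomorphism, hence a scalar c times the
  identity. If c is zero the first summand vanishes, otherwise the second one does.\<close>

lemma indecomposable_spread:
  fixes S :: "'p::order set"
  assumes S: "order_convex S" and ne: "S \<noteq> {}"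
    and scalar: "\<And>s. s \<in> sections S (spread_module S :: ('p, 'k::field) pmod) \<Longrightarrow> \<exists>c. s = fscale c (unit_sec S)"
  shows "indecomposable_pmod (spread_module S :: ('p, 'k) pmod)"
  unfolding indecomposable_pmod_def
proof (intro conjI allI impI)
  let ?M = "spread_module S :: ('p, 'k) pmod"
  show M: "is_pmod ?M" by (rule is_pmod_spread[OF S])
  show "\<not> is_zero_pmod ?M" using ne by (auto simp: is_zero_pmod_def)
  fix A B :: "('p, 'k) pmod"
  assume "is_pmod A \<and> is_pmod B \<and> pm_isomorphic ?M (pm_dsum A B)"
  then have A: "is_pmod A" and B: "is_pmod B" and iso: "pm_isomorphic ?M (pm_dsum A B)" by auto
  note D = is_pmod_dsum[OF A B] and inl = dsum_inl_hom[OF A B] and inr = dsum_inr_hom[OF A B]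
    and fst = dsum_fst_hom[OF A B] and snd = dsum_snd_hom[OF A B]
  obtain f g where f: "f \<in> pm_hom ?M (pm_dsum A B)" and g: "g \<in> pm_hom (pm_dsum A B) ?M"
    and fg: "pm_comp f g = pm_id (pm_dsum A B)"
    using iso unfolding pm_isomorphic_def pm_isomorphism_def by blast
  define u where "u = act f (unit_sec S)"
  have u: "u \<in> sections S (pm_dsum A B)" unfolding u_def by (rule act_sections[OF M D f unit_sec_sections])
  have fg_act: "act f (act g s) = s" if "s \<in> sections S (pm_dsum A B)" for s
    using act_pm_comp[OF f g, of s] fg act_pm_id[OF that] by simp
  have u1: "act (dsum_fst A B) u \<in> sections S A" by (rule act_sections[OF D A fst u])
  define v where "v = act (dsum_inl A B) (act (dsum_fst A B) u)"
  have v: "v \<in> sections S (pm_dsum A B)" unfolding v_def by (rule act_sections[OF A D inl u1])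
  obtain c where c: "act g v = fscale c (unit_sec S)" using scalar[OF act_sections[OF D M g v]] by blast
  have vu: "v = fscale c u" using fg_act[OF v] unfolding c act_scale u_def by simp
  have fst_v: "act (dsum_fst A B) v = act (dsum_fst A B) u"
    unfolding v_def by (rule eq_by_curry) (simp only: curry_act dsum_relations(1)[OF sectionsD(1)[OF u1, unfolded curry_act]])
  have snd_v: "act (dsum_snd A B) v = 0"
    unfolding v_def
    by (rule eq_by_curry) (simp only: curry_act curry_0 dsum_relations(2)[OF sectionsD(1)[OF u1, unfolded curry_act]])
  have gen: "\<exists>k. y = fscale k (curry u p)" if y: "supp (vdim (pm_dsum A B) p) y" for p y
  proof -
    have "mv (f p) (mv (g p) y) = mv (pm_id (pm_dsum A B) p) y" using mv_pm_comp[OF f g, of p y] fg by simp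
    then have 1: "mv (f p) (mv (g p) y) = y" using mv_one[OF y] by (simp add: pm_id_def)
    have "supp (if p \<in> S then 1 else 0) (mv (g p) y)" using supp_mv[OF pm_hom_carrier[OF g], of p y] by simp
    then have "mv (g p) y = fscale (mv (g p) y 0) (curry (unit_sec S) p)"
      unfolding curry_unit_sec by (auto simp: fun_eq_iff supp_def split: if_splits)
    then have "mv (f p) (mv (g p) y) = fscale (mv (g p) y 0) (curry u p)"
      unfolding u_def curry_act by (metis mv_scale)
    then show ?thesis using 1 by metis
  qed
  have vanish: "vdim C p = 0"
    if i: "i \<in> pm_hom C (pm_dsum A B)" and z: "act q u = 0"
      and qi: "\<And>w. supp (vdim C p) w \<Longrightarrow> mv (q p) (mv (i p) w) = w" for C i q p
  proof (rule ccontr)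
    assume "vdim C p \<noteq> 0"
    then have w: "supp (vdim C p) (\<lambda>i. if i = 0 then 1 else 0 :: 'k)" (is "supp _ ?w") by (simp add: supp_def)
    obtain k where k: "mv (i p) ?w = fscale k (curry u p)" using gen[OF supp_mv[OF pm_hom_carrier[OF i]]] by blast
    have "mv (q p) (curry u p) = 0" using arg_cong[OF z, of "\<lambda>s. curry s p"] by (simp only: curry_act curry_0)
    then have "mv (q p) (mv (i p) ?w) = fscale k 0" unfolding k mv_scale by simp
    then have "?w = fscale k 0" using qi[OF w] by simp
    then have "?w 0 = fscale k (0 :: nat \<Rightarrow> 'k) 0" by (rule fun_cong)
    then show False by simp
  qed
  show "is_zero_pmod A \<or> is_zero_pmod B"
  proof (cases "c = 0")
    case True
    then have "v = 0" using vu by (simp add: fun_eq_iff)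
    then have z: "act (dsum_fst A B) u = 0" using fst_v by (simp add: act_0)
    have "is_zero_pmod A"
      unfolding is_zero_pmod_def by (intro allI vanish[OF inl z] dsum_relations(1))
    then show ?thesis ..
  next
    case False
    have "fscale c (act (dsum_snd A B) u) = 0" using snd_v unfolding vu act_scale .
    then have "fscale (inverse c) (fscale c (act (dsum_snd A B) u)) = fscale (inverse c) 0" by simp
    then have z: "act (dsum_snd A B) u = 0" using False by (simp add: fun_eq_iff)
    have "is_zero_pmod B"
      unfolding is_zero_pmod_def by (intro allI vanish[OF inr z] dsum_relations(4))
    then show ?thesis ..
  qed
qed

context directed_spreads
begin

theorem homological:
  assumes "\<forall>Q :: ('p, 'k) pmod. projective_pmod Q \<and> indecomposable_pmod Q \<longrightarrow> iso_class Q \<in> spm_classes"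
  shows "homological_invariant spm_classes (K0_rel spm_classes) (K0_quot spm_classes)"
  unfolding homological_invariant_def is_invariant_def
proof (intro conjI)
  show "\<forall>c\<in>spm_classes. \<exists>M. indecomposable_pmod M \<and> c = iso_class M"
    using indecomposable_spread[OF convex nonempty] scalar by fastforce
qed (use assms K0_quot_epi K0_rel_iso not_properly_infinite in auto)

end

section \<open>Spreads with one source and connected upsets\<close>

text \<open>If S has a least element a, a section over S is determined by its value at a by transport; in a spread
  module this value is a scalar.\<close>

lemma scalar_if_least:
  assumes a: "a \<in> S" "\<And>x. x \<in> S \<Longrightarrow> a \<le> x" and s: "s \<in> sections S (spread_module T :: ('p::order, 'k::field) pmod)"
  shows "\<exists>c. s = fscale c (unit_sec (S \<inter> T))"
proof -
  have eq: "s (p, i) = s (a, 0) * unit_sec (S \<inter> T) (p, i)" for p i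
  proof (cases "p \<in> S")
    case True
    have "s (p, i) = (if a \<in> T \<and> p \<in> T \<and> i = 0 then s (a, 0) else 0)"
      using fun_cong[OF sectionsD(3)[OF s a(1) a(2)[OF True]], of i] by (auto simp: mv_spread_tmap split: if_splits)
    moreover have "s (a, 0) = 0" if "a \<notin> T" using sectionsD(1)[OF s, of a] that by (simp add: supp_def)
    ultimately show ?thesis using True by (auto simp: unit_sec_def)
  next
    case False
    then show ?thesis using fun_cong[OF sectionsD(2)[OF s False], of i] by (simp add: unit_sec_def)
  qed
  have "s = fscale (s (a, 0)) (unit_sec (S \<inter> T))"
  proof
    fix x show "s x = fscale (s (a, 0)) (unit_sec (S \<inter> T)) x"
      using eq[of "fst x" "snd x"] unfolding fscale_apply prod.collapse .
  qed
  then show ?thesis ..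
qed

lemma indecomposable_principal: "indecomposable_pmod (spread_module {x. a \<le> x} :: ('p::order, 'k::field) pmod)"
  by (rule indecomposable_spread[OF order_convex_principal])
    (auto dest: scalar_if_least[of a "{x. a \<le> x}", rotated 2])

lemma order_convex_spread: "order_convex (spread A B)"
  unfolding order_convex_def spread_def by (blast intro: order_trans)

text \<open>Induction along unoriented paths; a Hasse arrow may be read as any comparable pair inside the spread.\<close>

lemma connected_spread_induct:
  assumes "connected_spread A B" "x \<in> spread A B" "y \<in> spread A B" "P x"
    and up: "\<And>u v. u \<in> spread A B \<Longrightarrow> v \<in> spread A B \<Longrightarrow> u \<le> v \<Longrightarrow> P u \<Longrightarrow> P v"
    and down: "\<And>u v. u \<in> spread A B \<Longrightarrow> v \<in> spread A B \<Longrightarrow> u \<le> v \<Longrightarrow> P v \<Longrightarrow> P u"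
  shows "P y"
proof -
  have "(x, y) \<in> (hasse_arrows (spread A B) \<union> (hasse_arrows (spread A B))\<inverse>)\<^sup>*"
    using assms(1-3) unfolding connected_spread_def by blast
  then show ?thesis
  proof (induction rule: rtrancl_induct)
    case base
    show ?case by (rule assms(4))
  next
    case (step u v)
    then show ?case using up[of u v] down[of v u] by (auto simp: hasse_arrows_def)
  qed
qed

text \<open>For an upset T, a section of the spread module on T takes the same scalar value at the two ends of
  every arrow of S, so it is constant on the connected spread S.\<close>

lemma scalar_if_upset:
  assumes S: "connected_spread A B" and T: "upset T"
    and s: "s \<in> sections (spread A B) (spread_module T :: ('p::order, 'k::field) pmod)"
  shows "\<exists>c. s = fscale c (unit_sec (spread A B \<inter> T))"
proof -
  let ?S = "spread A B"
  obtain a where a: "a \<in> ?S" using S unfolding connected_spread_def by blast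
  have arrow: "s (u, 0) = s (v, 0)" if "u \<in> ?S" "u \<le> v" for u v
  proof -
    have "s (v, 0) = (if u \<in> T \<and> v \<in> T then s (u, 0) else 0)"
      using fun_cong[OF sectionsD(3)[OF s that], of 0] by (auto simp: mv_spread_tmap split: if_splits)
    moreover have "s (u, 0) = 0" if "u \<notin> T" using sectionsD(1)[OF s, of u] that by (simp add: supp_def)
    moreover have "v \<in> T" if "u \<in> T" using T that \<open>u \<le> v\<close> unfolding upset_def by blast
    ultimately show ?thesis by auto
  qed
  have const: "s (p, 0) = s (a, 0)" if "p \<in> ?S" for p
    by (rule connected_spread_induct[OF S a that]) (use arrow in auto)
  have eq: "s (p, i) = s (a, 0) * unit_sec (?S \<inter> T) (p, i)" for p i
  proof (cases "p \<in> ?S \<and> p \<in> T")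
    case True
    then show ?thesis using const[of p] sectionsD(1)[OF s, of p] by (cases "i = 0") (auto simp: unit_sec_def supp_def)
  next
    case False
    then have "s (p, i) = 0"
      using sectionsD(1)[OF s, of p] fun_cong[OF sectionsD(2)[OF s, of p], of i] by (cases "p \<in> ?S") (auto simp: supp_def)
    then show ?thesis using False by (auto simp: unit_sec_def)
  qed
  have "s = fscale (s (a, 0)) (unit_sec (?S \<inter> T))"
  proof
    fix x show "s x = fscale (s (a, 0)) (unit_sec (?S \<inter> T)) x"
      using eq[of "fst x" "snd x"] unfolding fscale_apply prod.collapse .
  qed
  then show ?thesis ..
qed

text \<open>A lexicographic rank: spreads with a lower source come later, and among spreads with the same source the
  smaller one comes later. The factor exceeds every value of the second summand.\<close>

definition source_rank :: "'p::{finite, order} set \<Rightarrow> nat" where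
  "source_rank S = card {x. \<exists>s\<in>S. s \<le> x} * Suc (card (UNIV :: 'p set)) + (card (UNIV :: 'p set) - card S)"

lemma leadsD:
  assumes "leads S T" "p \<le> q"
  shows "p \<in> S \<Longrightarrow> p \<in> T \<Longrightarrow> q \<in> T \<Longrightarrow> q \<in> S"
    and "p \<in> S \<Longrightarrow> q \<in> S \<Longrightarrow> q \<in> T \<Longrightarrow> p \<in> T"
  using assms unfolding leads_def by blast+

lemma leads_meet: "leads S T \<Longrightarrow> S \<inter> T \<noteq> {}"
  unfolding leads_def by (rule conjunct1)

text \<open>The canonical map from S to T being nonzero puts the source of S into T, above the source of T. If
  the sources agree then T is contained in S, because nothing of T above the source may lie outside S.\<close>

lemma source_rank_less:
  fixes S T :: "'p::{finite, order} set"
  assumes a: "a \<in> S" "\<And>x. x \<in> S \<Longrightarrow> a \<le> x" and b: "b \<in> T" "\<And>x. x \<in> T \<Longrightarrow> b \<le> x"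
    and ne: "S \<noteq> T" and l: "leads S T"
  shows "source_rank S < source_rank T"
proof -
  let ?up = "\<lambda>S :: 'p set. {x. \<exists>s\<in>S. s \<le> x}" and ?N = "card (UNIV :: 'p set)"
  obtain p where p: "p \<in> S" "p \<in> T" using leads_meet[OF l] by blast
  have aT: "a \<in> T" by (rule leadsD(2)[OF l a(2)[OF p(1)] a(1) p])
  have up: "?up U = {x. c \<le> x}" if c: "c \<in> U" "\<And>x. x \<in> U \<Longrightarrow> c \<le> x" for c and U :: "'p set"
  proof (intro equalityI subsetI)
    fix x assume "x \<in> ?up U"
    then obtain u where u: "u \<in> U" "u \<le> x" by blast
    show "x \<in> {x. c \<le> x}" using order_trans[OF c(2)[OF u(1)] u(2)] by simp
  qed (use c(1) in blast)
  have upS: "?up S = {x. a \<le> x}" by (rule up[OF a])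
  have upT: "?up T = {x. b \<le> x}" by (rule up[OF b])
  show ?thesis
  proof (cases "a = b")
    case False
    have ba: "b \<le> a" using b(2)[OF aT] .
    have sub: "{x. a \<le> x} \<subseteq> {x. b \<le> x}" using order_trans[OF ba] by blast
    have b: "b \<notin> {x. a \<le> x}" "b \<in> {x. b \<le> x}" using ba False by auto
    have "{x. a \<le> x} \<noteq> {x. b \<le> x}"
    proof
      assume "{x. a \<le> x} = {x. b \<le> x}"
      from b[folded this] show False by (rule notE)
    qed
    with sub have "?up S \<subset> ?up T" unfolding upS upT by (rule psubsetI)
    then have "card (?up S) < card (?up T)" by (intro psubset_card_mono) simp_all
    then have "Suc (card (?up S)) * Suc ?N \<le> card (?up T) * Suc ?N" by (intro mult_le_mono1) simp
    then show ?thesis unfolding source_rank_def by simp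
  next
    case True
    have "T \<subseteq> S"
    proof
      fix x assume x: "x \<in> T"
      show "x \<in> S" using leadsD(1)[OF l b(2)[OF x]] a(1) aT x True by simp
    qed
    then have "T \<subset> S" using ne by blast
    then have "card T < card S" by (intro psubset_card_mono) simp_all
    moreover have "card S \<le> ?N" by (rule card_mono) simp_all
    ultimately show ?thesis unfolding source_rank_def upS upT True by simp
  qed
qed

text \<open>Both ends of an arrow in S lie in T as soon as one does: upwards since T is an upset, downwards by
  the condition on the canonical map. So connectedness puts all of S into T.\<close>

lemma leads_upset_subset:
  assumes S: "connected_spread A B" and T: "upset T" and l: "leads (spread A B) T"
  shows "spread A B \<subseteq> T"
proof
  fix y assume y: "y \<in> spread A B"
  obtain x where x: "x \<in> spread A B" "x \<in> T" using leads_meet[OF l] by blast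
  show "y \<in> T"
  proof (rule connected_spread_induct[OF S x(1) y, where P = "\<lambda>x. x \<in> T"])
    show "x \<in> T" by (rule x(2))
    show "v \<in> T" if "u \<le> v" "u \<in> T" for u v using T that unfolding upset_def by blast
    show "u \<in> T" if "u \<in> spread A B" "v \<in> spread A B" "u \<le> v" "v \<in> T" for u v
      by (rule leadsD(2)[OF l that(3,1,2,4)])
  qed
qed

theorem theorem1p2:
  fixes X :: "('p::{finite, order}, 'k::field) pmod set set"
  assumes spreads: "\<forall>c\<in>X. \<exists>A B. connected_spread A B \<and> c = iso_class (spread_module (spread A B))"
    and projectives: "\<forall>Q. projective_pmod Q \<and> indecomposable_pmod Q \<longrightarrow> iso_class Q \<in> X"
  shows
    "((\<forall>A B. connected_spread A B \<and> iso_class (spread_module (spread A B)) \<in> X \<longrightarrow> (\<exists>!a. a \<in> A)) \<longrightarrow>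
        homological_invariant X (K0_rel X) (K0_quot X)) \<and>
     ((\<forall>M. is_pmod M \<and> iso_class M \<in> X \<longrightarrow> upset (pm_supp M)) \<longrightarrow>
        homological_invariant X (K0_rel X) (K0_quot X))"
proof -
  define SS where "SS = {S. \<exists>A B. connected_spread A B \<and> S = spread A B \<and>
    iso_class (spread_module S :: ('p, 'k) pmod) \<in> X}"
  have X: "X = (\<lambda>S. iso_class (spread_module S)) ` SS"
  proof (intro equalityI subsetI)
    fix c assume c: "c \<in> X"
    obtain A B where AB: "connected_spread A B" "c = iso_class (spread_module (spread A B))"
      using spreads c by blast
    then have "spread A B \<in> SS" using c unfolding SS_def by blast
    then show "c \<in> (\<lambda>S. iso_class (spread_module S)) ` SS" unfolding AB(2) by (rule imageI)
  qed (auto simp: SS_def)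
  have convex: "order_convex S" if "S \<in> SS" for S using that order_convex_spread unfolding SS_def by blast
  have nonempty: "S \<noteq> {}" if "S \<in> SS" for S using that unfolding SS_def connected_spread_def by blast
  have principal: "{x. a \<le> x} \<in> SS" for a
  proof -
    let ?P = "spread_module {x. a \<le> x} :: ('p, 'k) pmod"
    have "iso_class ?P \<in> X" using projectives projective_principal indecomposable_principal by blast
    then have "iso_class ?P \<in> (\<lambda>S. iso_class (spread_module S)) ` SS" unfolding X .
    then obtain S where S: "S \<in> SS" "iso_class ?P = iso_class (spread_module S)" by (elim imageE) blast
    have iso: "pm_isomorphic ?P (spread_module S)"
      using S(2) iso_class_eq_iff[OF is_pmod_spread[OF order_convex_principal] is_pmod_spread[OF convex[OF S(1)]]]
      by blast
    have "p \<in> {x. a \<le> x} \<longleftrightarrow> p \<in> S" for p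
      using pm_isomorphic_vdim_eq_0[OF iso, of p] pm_isomorphic_vdim_eq_0[OF pm_isomorphic_sym[OF iso], of p]
      by (cases "a \<le> p"; cases "p \<in> S") simp_all
    then have "{x. a \<le> x} = S" by blast
    then show ?thesis using S(1) by simp
  qed
  have 1: "homological_invariant X (K0_rel X) (K0_quot X)"
    if single: "\<forall>A B. connected_spread A B \<and> iso_class (spread_module (spread A B) :: ('p, 'k) pmod) \<in> X \<longrightarrow> (\<exists>!a. a \<in> A)"
  proof -
    have least: "\<exists>a\<in>S. \<forall>x\<in>S. a \<le> x" if "S \<in> SS" for S
    proof -
      obtain A B where AB: "connected_spread A B" "S = spread A B"
        "iso_class (spread_module S :: ('p, 'k) pmod) \<in> X" using \<open>S \<in> SS\<close> unfolding SS_def by blast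
      then obtain a where a: "A = {a}" using single by blast
      have "a \<in> S" using AB(1) unfolding AB(2) a connected_spread_def set_le_def spread_def by auto
      then show ?thesis unfolding AB(2) a spread_def by blast
    qed
    interpret directed_spreads SS source_rank "TYPE('k)"
    proof
      show "\<exists>c. s = fscale c (unit_sec (S \<inter> T))"
        if "S \<in> SS" "s \<in> sections S (spread_module T :: ('p, 'k) pmod)" for S T s
        using least[OF that(1)] scalar_if_least[OF _ _ that(2)] by blast
      show "source_rank S < source_rank T" if "S \<in> SS" "T \<in> SS" "S \<noteq> T" "leads S T" for S T
        using least[OF that(1)] least[OF that(2)] source_rank_less[OF _ _ _ _ that(3,4)] by metis
    qed (use convex nonempty principal in auto)
    show ?thesis using homological projectives unfolding X by blast
  qed
  have 2: "homological_invariant X (K0_rel X) (K0_quot X)"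
    if up: "\<forall>M. is_pmod M \<and> iso_class M \<in> X \<longrightarrow> upset (pm_supp M)"
  proof -
    have upset: "upset S" if "S \<in> SS" for S
    proof -
      have "upset (pm_supp (spread_module S :: ('p, 'k) pmod))"
        using up is_pmod_spread[OF convex[OF that]] that X by blast
      moreover have "pm_supp (spread_module S :: ('p, 'k) pmod) = S" by (auto simp: pm_supp_def)
      ultimately show ?thesis by simp
    qed
    interpret directed_spreads SS card "TYPE('k)"
    proof
      fix S T assume S: "S \<in> SS" and T: "T \<in> SS"
      obtain A B where AB: "connected_spread A B" "S = spread A B" using S unfolding SS_def by blast
      show "\<exists>c. s = fscale c (unit_sec (S \<inter> T))" if "s \<in> sections S (spread_module T :: ('p, 'k) pmod)" for s
        using scalar_if_upset[OF AB(1) upset[OF T]] that unfolding AB(2) by blast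
      show "card S < card T" if "S \<noteq> T" "leads S T"
      proof (rule psubset_card_mono)
        show "S \<subset> T" using leads_upset_subset[OF AB(1) upset[OF T]] that unfolding AB(2) by blast
      qed simp
    qed (use convex nonempty principal in auto)
    show ?thesis using homological projectives unfolding X by blast
  qed
  show ?thesis using 1 2 by blast
qed

end
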